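(* Let $f\in\mathbb{Z}[X]$ be a polynomial of degree $2$ or $3$. Then $G_f$ exists. Further, for every integer $k\geq G_f$ there are infinitely many integers $n\geq 0$ such that none of the integers $f(n+1),f(n+2),\dots,f(n+k)$ is coprime to all the others (i.e. for each $i\in\{1,\dots,k\}$ there is $j\in\{1,\dots,k\}$, $j\neq i$, with $\gcd(f(n+i),f(n+j))>1$).
   Context: For a polynomial $f\in\mathbb{Z}[X]$, consider the sequence $s(n)=f(n)$, $n\geq 1$. A block of consecutive terms $f(m+1),\dots,f(m+k)$ ($m\ge 0$) is said to have the property if none of them is coprime to all the others. $G_f$ denotes the smallest integer $G\geq 2$ such that for every integer $k\geq G$ one can find $k$ consecutive terms of this sequence having the property; "$G_f$ exists" means such an integer $G$ exists. *)

theory Defs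
  imports "HOL-Computational_Algebra.Polynomial"
begin

definition has_property :: "int poly \<Rightarrow> nat \<Rightarrow> nat \<Rightarrow> bool" where
  "has_property f m k \<longleftrightarrow>
     (\<forall>i\<in>{1..k}. \<exists>j\<in>{1..k}. j \<noteq> i \<and>
        \<not> coprime (poly f (int (m + i))) (poly f (int (m + j))))"

definition G_admissible :: "int poly \<Rightarrow> nat \<Rightarrow> bool" where
  "G_admissible f G \<longleftrightarrow> G \<ge> 2 \<and> (\<forall>k\<ge>G. \<exists>m. has_property f m k)"

definition G_exists :: "int poly \<Rightarrow> bool" where
  "G_exists f \<longleftrightarrow> (\<exists>G. G_admissible f G)"

definition G_f :: "int poly \<Rightarrow> nat" where
  "G_f f = (LEAST G. G_admissible f G)"

end

theory Submission
  imports Complex_Main Defs "HOL-Number_Theory.Cong"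
    "HOL-Computational_Algebra.Computational_Algebra"
begin

text \<open>A prime \<open>p\<close> that divides two terms of the block covers both of them, and by the Chinese remainder
  theorem the position of the block may be prescribed modulo each prime separately.

  For a quadratic with leading coefficient \<open>a\<close> and discriminant \<open>D\<close>, put the vertex at the middle of the
  block modulo every prime not dividing \<open>2a\<close>. The terms at distance \<open>y/2\<close> on both sides of the middle are then
  divisible by the same primes, namely those dividing \<open>a\<^sup>2y\<^sup>2 - D\<close>, so only those \<open>y\<close> remain for which this number
  is zero or composed of finitely many bad primes. There are at most \<open>(log k)\<^sup>C\<close> of them, and each can be covered by a
  prime of its own of size at least \<open>k/C\<close> dividing some \<open>a\<^sup>2h\<^sup>2 - D\<close> with \<open>h \<le> k/2\<close>: by Chebyshev's method there are
  at least \<open>ck / log k\<close> such primes, and a positive proportion of them can be spared because everything they covered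
  is covered by finitely many small primes.

  A cubic with a rational root is a multiple of a quadratic. For an irreducible cubic let \<open>\<sigma>\<close> be the sum of
  \<open>log p / p\<close> over the primes \<open>p \<le> k/2\<close> modulo which the cubic does not split. Chebyshev's method applied to
  the resultant of \<open>f(X)\<close> and \<open>f(X + h)\<close>, \<open>h \<le> k/2\<close>, yields at least \<open>ck\<sigma> / log k\<close> primes exceeding \<open>k/2\<close>, each of
  which can cover one arbitrary term. A greedy choice of residue classes modulo the primes up to \<open>k/2\<close> leaves fewer
  terms than that: if \<open>\<sigma> \<ge> \<epsilon> log k\<close> because the sum of \<open>1/p\<close> over the primes modulo which the cubic has
  a root diverges, and otherwise because almost all primes split, so that at most \<open>Ck(\<sigma> / log k)\<^sup>3\<close> terms are left.
  The divergence of both sums is derived from lattice points and the norm form of the cubic field.\<close>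

section \<open>Estimates for primes\<close>

text \<open>A pool prime can serve any single term because it divides two values of the polynomial
  at a prescribed distance \<open>h\<close>, less than half the block: of \<open>i + h\<close> and
  \<open>i - h\<close> one lies in the block. It is relied on for that term only, so everything
  turns on comparing the number of leftovers with the size of the pool. For a cubic this is
  delicate: one root per prime on average lets the sieve leave about \<open>k / log k\<close> terms,
  and Chebyshev's method may give a pool of the same order, with incomparable constants. The way out
  is that a common root of \<open>f(X)\<close> and \<open>f(X + h)\<close> modulo a suitable
  \<open>p\<close> forces \<open>p\<close> to split. Hence the weight of the non-split primes is
  missing from the product of resultants and must be made up by primes above \<open>k/2\<close>.
  Large \<open>sigma\<close> then means a pool of positive density, while small \<open>sigma\<close>
  means three roots modulo most primes and a cubic gain in the sieve. The divergence of
  \<open>sigma\<close> absorbs the bounded losses of Chebyshev's method. It holds because an Euler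
  product with factors \<open>1 + 3 p^(-1-e)\<close> would otherwise outgrow \<open>1/e\<close>,
  while elements of small norm are too few to allow that.\<close>

definition primes_le :: "nat \<Rightarrow> nat set" where
  "primes_le n = {p. prime p \<and> p \<le> n}"

lemma finite_primes_le [simp]: "finite (primes_le n)"
  unfolding primes_le_def by (rule finite_subset[of _ "{..n}"]) auto

lemma card_primes_le: "card (primes_le n) \<le> n"
proof -
  have "primes_le n \<subseteq> {1..n}"
    unfolding primes_le_def using prime_gt_0_nat by (auto simp: Suc_le_eq)
  then show ?thesis using card_mono[of "{1..n}" "primes_le n"] by simp
qed

lemma prod_primes_dvd:
  fixes m :: nat
  assumes "finite A" "\<And>p. p \<in> A \<Longrightarrow> prime p" "\<And>p. p \<in> A \<Longrightarrow> p dvd m"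
  shows "\<Prod>A dvd m"
  using assms
proof (induction A rule: finite_induct)
  case (insert p A)
  have "coprime p (\<Prod>A)"
    using insert by (intro prod_coprime_right) (metis insertCI primes_coprime)
  then show ?case using insert by (simp add: divides_mult)
qed simp

section \<open>Chebyshev's upper bounds for primes\<close>

definition theta :: "nat \<Rightarrow> real" where
  "theta n = (\<Sum>p\<in>primes_le n. ln (real p))"

lemma prime_dvd_choose_double:
  fixes p n :: nat
  assumes "prime p" "n < p" "p \<le> 2 * n"
  shows "p dvd (2 * n choose n)"
proof -
  have "p dvd fact (2 * n)" using assms by (simp add: prime_dvd_fact_iff)
  also have "fact (2 * n) = fact n * fact n * (2 * n choose n)"
    using binomial_fact_lemma[of n "2 * n"] by (simp add: mult_2)
  finally show ?thesis using assms by (simp add: prime_dvd_mult_iff prime_dvd_fact_iff)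
qed

text \<open>Every prime in \<open>(n, 2n]\<close> divides the central binomial coefficient, which is
  at most \<open>4^n\<close>; taking logarithms bounds their total weight.\<close>

lemma theta_double: "theta (2 * n) \<le> theta n + real n * ln 4"
proof -
  define A where "A = {p. prime p \<and> n < p \<and> p \<le> 2 * n}"
  have fin: "finite A" unfolding A_def by (rule finite_subset[of _ "{..2*n}"]) auto
  have "\<Prod>A dvd (2 * n choose n)"
    by (rule prod_primes_dvd[OF fin]) (auto simp: A_def prime_dvd_choose_double)
  then have "\<Prod>A \<le> (2 * n choose n)" by (intro dvd_imp_le) auto
  also have "\<dots> \<le> 2 ^ (2 * n)" by (rule binomial_le_pow2)
  also have "\<dots> = 4 ^ n" by (simp add: power_mult)
  finally have "real (\<Prod>A) \<le> real (4 ^ n)" by (rule of_nat_mono)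
  moreover have pos: "\<Prod>A > 0" using prime_gt_0_nat by (intro prod_pos) (auto simp: A_def)
  ultimately have "ln (real (\<Prod>A)) \<le> ln (4 ^ n)"
    by (subst ln_le_cancel_iff) (auto simp del: of_nat_prod)
  moreover have "ln (real (\<Prod>A)) = (\<Sum>p\<in>A. ln (real p))"
    using fin prime_gt_0_nat by (subst of_nat_prod, subst ln_prod) (auto simp: A_def)
  ultimately have "(\<Sum>p\<in>A. ln (real p)) \<le> real n * ln 4" by (simp add: ln_realpow)
  moreover have "primes_le (2 * n) = primes_le n \<union> A" unfolding primes_le_def A_def by auto
  then have "theta (2 * n) = theta n + (\<Sum>p\<in>A. ln (real p))"
    unfolding theta_def using fin
    by (simp only:) (rule sum.union_disjoint, auto simp: primes_le_def A_def)
  ultimately show ?thesis by simp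
qed

lemma theta_mono: "m \<le> n \<Longrightarrow> theta m \<le> theta n"
  unfolding theta_def
  by (rule sum_mono2) (auto simp: primes_le_def dest: prime_gt_0_nat)

lemma ln4_le: "ln (4::real) \<le> 2"
  using ln_realpow[of 2 2] ln_le_minus_one[of 2] by simp

lemma theta_le: "theta n \<le> 6 * real n"
proof (induction n rule: less_induct)
  case (less n)
  show ?case
  proof (cases "n \<le> 1")
    case True
    then have "primes_le n = {}" unfolding primes_le_def by (auto dest: prime_gt_1_nat)
    then show ?thesis by (simp add: theta_def)
  next
    case False
    \<comment> \<open>Half of \<open>n\<close>, rounded up. The induction yields
      \<open>6 m + 2 m \<le> 4 (n + 1)\<close>, which is at most \<open>6 n\<close> once
      \<open>n \<ge> 2\<close>.\<close>
    define m where "m = (n + 1) div 2"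
    have m: "m < n" "n \<le> 2 * m" "2 * m \<le> n + 1" using False unfolding m_def by auto
    have "theta n \<le> theta (2 * m)" using m by (intro theta_mono)
    also have "\<dots> \<le> theta m + real m * ln 4" by (rule theta_double)
    also have "\<dots> \<le> 6 * real m + real m * 2"
      using less[OF m(1)] ln4_le by (intro add_mono mult_left_mono) auto
    also have "\<dots> \<le> 6 * real n"
    proof -
      have "2 * real m \<le> real n + 1" using m(3) by linarith
      moreover have "real n \<ge> 2" using False by linarith
      ultimately show ?thesis by linarith
    qed
    finally show ?thesis .
  qed
qed

lemma ln_le_2_sqrt: "x > 0 \<Longrightarrow> ln x \<le> 2 * sqrt x"
  using ln_le_minus_one[of "sqrt x"] by (simp add: ln_sqrt)

text \<open>Primes above \<open>sqrt n\<close> weigh at least \<open>ln n / 2\<close> each in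
  \<open>theta\<close>, whence \<open>12 n\<close>; the at most \<open>sqrt n\<close> others add
  \<open>2 n\<close> through \<open>ln n \<le> 2 sqrt n\<close>.\<close>

lemma card_primes_le_bound: "real (card (primes_le n)) * ln (real n) \<le> 14 * real n"
proof (cases "n \<le> 1")
  case True
  then show ?thesis by (cases n) auto
next
  case False
  define r where "r = nat \<lfloor>sqrt (real n)\<rfloor>"
  have ln: "ln (real n) > 0" using False by simp
  have "real r = of_int \<lfloor>sqrt (real n)\<rfloor>" unfolding r_def by simp
  then have r: "real r \<le> sqrt (real n)" "sqrt (real n) < real r + 1" by linarith+
  have "real (card (primes_le n - primes_le r)) * (ln (real n) / 2) \<le> (\<Sum>p\<in>primes_le n - primes_le r. ln (real p))"
  proof (rule sum_bounded_below)
    fix p assume "p \<in> primes_le n - primes_le r"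
    then have p: "prime p" "p \<le> n" "p > r" by (auto simp: primes_le_def)
    then have "sqrt (real n) \<le> real p" using r by linarith
    then have "ln (sqrt (real n)) \<le> ln (real p)" using False prime_gt_0_nat[OF p(1)] by (subst ln_le_cancel_iff) auto
    then show "ln (real n) / 2 \<le> ln (real p)" using False by (simp add: ln_sqrt)
  qed
  also have "\<dots> \<le> theta n"
    unfolding theta_def by (rule sum_mono2) (auto simp: primes_le_def dest: prime_gt_0_nat)
  also have "\<dots> \<le> 6 * real n" by (rule theta_le)
  finally have 1: "real (card (primes_le n - primes_le r)) * ln (real n) \<le> 12 * real n" by simp
  have "card (primes_le n) \<le> card (primes_le r \<union> (primes_le n - primes_le r))"
    by (intro card_mono) auto
  also have "\<dots> \<le> card (primes_le r) + card (primes_le n - primes_le r)" by (rule card_Un_le)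
  finally have "real (card (primes_le n)) \<le> real r + real (card (primes_le n - primes_le r))"
    using card_primes_le[of r] by linarith
  then have "real (card (primes_le n)) * ln (real n) \<le> (real r + real (card (primes_le n - primes_le r))) * ln (real n)"
    using ln by (intro mult_right_mono) auto
  also have "\<dots> \<le> sqrt (real n) * (2 * sqrt (real n)) + 12 * real n"
  proof -
    have "real r * ln (real n) \<le> sqrt (real n) * (2 * sqrt (real n))"
      using r(1) ln ln_le_2_sqrt[of "real n"] False by (intro mult_mono) auto
    then show ?thesis using 1 unfolding distrib_right by linarith
  qed
  also have "\<dots> = 14 * real n" by simp
  finally show ?thesis .
qed

text \<open>A weak Stirling bound; the inductive step is \<open>(1 + 1/n)^n \<le> e\<close> in
  logarithmic form.\<close>

lemma ln_fact_lower: "ln (fact n :: real) \<ge> real n * ln (real n) - real n"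
proof (induction n)
  case (Suc n)
  show ?case
  proof (cases "n = 0")
    case False
    have "ln (real (Suc n)) - ln (real n) = ln (real (Suc n) / real n)"
      using False by (subst ln_div) auto
    also have "real (Suc n) / real n = 1 + 1 / real n" using False by (simp add: field_simps)
    finally have "ln (real (Suc n)) - ln (real n) \<le> 1 / real n"
      using ln_add_one_self_le_self[of "1 / real n"] by simp
    then have "real n * (ln (real (Suc n)) - ln (real n)) \<le> 1"
      using False by (simp add: field_simps)
    moreover have "ln (fact (Suc n) :: real) = ln (real (Suc n)) + ln (fact n)"
      by (simp add: ln_mult del: of_nat_Suc)
    ultimately show ?thesis using Suc by (simp add: algebra_simps)
  qed simp
qed simp

text \<open>Any finite set of primes containing the prime factors is allowed, so that one index set
  serves all integers of a double sum and the order of summation can be exchanged.\<close>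

lemma ln_eq_sum_multiplicity:
  assumes "m > 0" "finite W" "prime_factors m \<subseteq> W" "\<And>p. p \<in> W \<Longrightarrow> prime p"
  shows "ln (real m) = (\<Sum>p\<in>W. real (multiplicity p m) * ln (real p))"
proof -
  have "m = (\<Prod>p\<in>prime_factors m. p ^ multiplicity p m)" using assms(1) by (rule prime_factorization_nat)
  then have "ln (real m) = ln (\<Prod>p\<in>prime_factors m. real p ^ multiplicity p m)"
    by (metis (mono_tags, lifting) of_nat_power of_nat_prod prod.cong)
  also have "\<dots> = (\<Sum>p\<in>prime_factors m. ln (real p ^ multiplicity p m))"
    by (rule ln_prod) (auto dest: in_prime_factors_imp_prime prime_gt_0_nat)
  also have "\<dots> = (\<Sum>p\<in>prime_factors m. real (multiplicity p m) * ln (real p))"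
    by (intro sum.cong refl ln_realpow)
  also have "\<dots> = (\<Sum>p\<in>W. real (multiplicity p m) * ln (real p))"
    using assms by (intro sum.mono_neutral_left)
      (auto simp: prime_factors_multiplicity)
  finally show ?thesis .
qed

text \<open>Legendre's device: as a count of exponents, a multiplicity summed over many integers
  turns into a sum of root counts modulo prime powers.\<close>

lemma card_powers_dvd:
  fixes p m :: nat
  assumes "prime p" "m > 0" "multiplicity p m \<le> E"
  shows "card {e\<in>{1..E}. p ^ e dvd m} = multiplicity p m"
proof -
  have "{e\<in>{1..E}. p ^ e dvd m} = {1..multiplicity p m}"
    using assms by (auto simp: power_dvd_iff_le_multiplicity prime_nat_iff intro: dvd_trans[OF le_imp_power_dvd multiplicity_dvd])
  then show ?thesis by simp
qed

lemma sum_geometric_le: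
  fixes x :: real
  assumes "x > 1"
  shows "(\<Sum>e=1..E. 1 / x ^ e) \<le> 1 / (x - 1)"
proof -
  have "(\<Sum>e=1..E. 1 / x ^ e) = (1 - 1 / x ^ E) / (x - 1)"
  proof (induction E)
    case (Suc E)
    have "(\<Sum>e=1..Suc E. 1 / x ^ e) = (1 - 1 / x ^ E) / (x - 1) + 1 / x ^ Suc E"
      using Suc by simp
    also have "\<dots> = (1 - 1 / x ^ Suc E) / (x - 1)" using assms by (simp add: divide_simps) (simp add: algebra_simps)
    finally show ?case .
  qed simp
  also have "\<dots> \<le> 1 / (x - 1)" using assms by (intro divide_right_mono) auto
  finally show ?thesis .
qed

text \<open>Chebyshev's method: \<open>\<Prod>s\<le>S. w s\<close> is too large to be composed of the primes in \<open>A\<close> alone.\<close>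
lemma large_prime_divisors:
  fixes w :: "nat \<Rightarrow> nat" and d S X :: nat and B :: real
  assumes lower: "\<And>s. s \<in> {1..S} \<Longrightarrow> s ^ d \<le> w s"
    and upper: "\<And>s. s \<in> {1..S} \<Longrightarrow> real (w s) \<le> B"
    and roots: "\<And>p e. prime p \<Longrightarrow> e \<ge> 1 \<Longrightarrow>
      real (card {s\<in>{1..S}. p ^ e dvd w s}) \<le> real d * (real S / real p ^ e + 1)"
    and A: "finite A" "\<And>p. p \<in> A \<Longrightarrow> prime p"
    and small: "\<And>p s. prime p \<Longrightarrow> p \<le> X \<Longrightarrow> s \<in> {1..S} \<Longrightarrow> p dvd w s \<Longrightarrow> p \<in> A"
    and pos: "X > 0" "S > 0" "B \<ge> 1"
  shows "real d * (real S * ln (real S) - real S) \<le>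
     real d * (real S * (\<Sum>p\<in>A. ln (real p) / (real p - 1)) + real (card A) * ln B) +
     real (card {p. prime p \<and> p > X \<and> (\<exists>s\<in>{1..S}. p dvd w s)}) * (real d * (real S / real X + 1) * ln B)"
proof -
  define L where "L = {p. prime p \<and> p > X \<and> (\<exists>s\<in>{1..S}. p dvd w s)}"
  have wpos: "w s > 0" if "s \<in> {1..S}" for s
    using lower[OF that] that by (metis atLeastAtMost_iff gr0I le_zero_eq not_one_le_zero power_not_zero)
  define W where "W = A \<union> (\<Union>s\<in>{1..S}. prime_factors (w s))"
  have Wfin: "finite W" using A by (auto simp: W_def)
  have Wp: "prime p" if "p \<in> W" for p
    using that A by (auto simp: W_def)
  have Lfin: "finite L" 
    by (rule finite_subset[OF _ Wfin]) (use wpos in \<open>auto simp: L_def W_def prime_factors_dvd\<close>)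
  have W: "W \<subseteq> A \<union> L"
  proof
    fix p assume "p \<in> W"
    then consider "p \<in> A" | s where "s \<in> {1..S}" "p \<in> prime_factors (w s)" by (auto simp: W_def)
    then show "p \<in> A \<union> L"
    proof cases
      case 2
      then have "prime p" "p dvd w s" by (auto simp: prime_factors_dvd wpos)
      then show ?thesis using small[of p s] 2 by (cases "p \<le> X") (auto simp: L_def)
    qed simp
  qed
  have nonneg: "(\<Sum>s=1..S. real (multiplicity p (w s)) * ln (real p)) \<ge> 0" if "p \<in> A \<union> L" for p
  proof (rule sum_nonneg)
    have "real p \<ge> 1" using that A(2) prime_ge_1_nat[of p] by (auto simp: L_def)
    then show "real (multiplicity p (w s)) * ln (real p) \<ge> 0" for s by simp
  qed
  have "ln (fact S) = (\<Sum>s=1..S. ln (real s))"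
    unfolding fact_prod of_nat_prod by (subst ln_prod) auto
  then have "real d * ln (fact S) = (\<Sum>s=1..S. ln (real s ^ d))"
    by (simp add: sum_distrib_left ln_realpow)
  also have "\<dots> \<le> (\<Sum>s=1..S. ln (real (w s)))"
  proof (rule sum_mono)
    fix s assume s: "s \<in> {1..S}"
    have "real s ^ d \<le> real (w s)" using lower[OF s] by (metis of_nat_le_iff of_nat_power)
    then show "ln (real s ^ d) \<le> ln (real (w s))" using s wpos[OF s] by (subst ln_le_cancel_iff) auto
  qed
  also have "\<dots> = (\<Sum>s=1..S. \<Sum>p\<in>W. real (multiplicity p (w s)) * ln (real p))"
    by (intro sum.cong refl ln_eq_sum_multiplicity wpos Wfin Wp) (auto simp: W_def)
  also have "\<dots> = (\<Sum>p\<in>W. \<Sum>s=1..S. real (multiplicity p (w s)) * ln (real p))"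
    by (rule sum.swap)
  also have "\<dots> \<le> (\<Sum>p\<in>A \<union> L. \<Sum>s=1..S. real (multiplicity p (w s)) * ln (real p))"
    using W A(1) Lfin nonneg by (intro sum_mono2) auto
  also have "\<dots> \<le> (\<Sum>p\<in>A. \<Sum>s=1..S. real (multiplicity p (w s)) * ln (real p))
      + (\<Sum>p\<in>L. \<Sum>s=1..S. real (multiplicity p (w s)) * ln (real p))"
  proof -
    have "(\<Sum>p\<in>A \<inter> L. \<Sum>s=1..S. real (multiplicity p (w s)) * ln (real p)) \<ge> 0"
      by (intro sum_nonneg[of "A \<inter> L"] nonneg) auto
    then show ?thesis using A Lfin by (subst sum_Un) auto
  qed
  also have "(\<Sum>p\<in>A. \<Sum>s=1..S. real (multiplicity p (w s)) * ln (real p)) \<le>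
     (\<Sum>p\<in>A. real d * (real S * (ln (real p) / (real p - 1)) + ln B))"
  proof (rule sum_mono)
    fix p assume p: "p \<in> A"
    then have pp: "prime p" using A by auto
    then have p1: "real p > 1" using prime_gt_1_nat by fastforce
    \<comment> \<open>The largest exponent of \<open>p\<close> in any \<open>w s\<close>. Since
      \<open>p^E \<le> B\<close>, the \<open>+ 1\<close> terms of the root counts add up to at most
      \<open>ln B\<close> for each small prime.\<close>
    define E where "E = Max ((\<lambda>s. multiplicity p (w s)) ` {1..S})"
    have E: "multiplicity p (w s) \<le> E" if "s \<in> {1..S}" for s
      unfolding E_def using that by (intro Max_ge) auto
    obtain s0 where s0: "s0 \<in> {1..S}" "E = multiplicity p (w s0)"
    proof -
      have "E \<in> (\<lambda>s. multiplicity p (w s)) ` {1..S}" unfolding E_def using pos by (intro Max_in) auto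
      then show ?thesis using that by auto
    qed
    have "p ^ E dvd w s0" unfolding s0 by (rule multiplicity_dvd)
    then have "p ^ E \<le> w s0" using wpos[OF s0(1)] by (rule dvd_imp_le)
    then have "real p ^ E \<le> B" using upper[OF s0(1)] by (metis of_nat_le_iff of_nat_power order_trans)
    then have "ln (real p ^ E) \<le> ln B" using p1 pos by (subst ln_le_cancel_iff) auto
    then have EB: "real E * ln (real p) \<le> ln B" using p1 by (simp add: ln_realpow)
    have "(\<Sum>s=1..S. real (multiplicity p (w s))) = (\<Sum>s=1..S. \<Sum>e=1..E. if p ^ e dvd w s then 1 else 0)"
    proof (rule sum.cong[OF refl])
      fix s assume s: "s \<in> {1..S}"
      have "real (multiplicity p (w s)) = real (card {e\<in>{1..E}. p ^ e dvd w s})"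
        using card_powers_dvd[OF pp wpos[OF s] E[OF s]] by simp
      also have "\<dots> = (\<Sum>e=1..E. if p ^ e dvd w s then 1 else 0)"
        by (simp add: sum.If_cases Int_def)
      finally show "real (multiplicity p (w s)) = \<dots>" .
    qed
    also have "\<dots> = (\<Sum>e=1..E. \<Sum>s=1..S. if p ^ e dvd w s then 1 else 0)" by (rule sum.swap)
    also have "\<dots> = (\<Sum>e=1..E. real (card {s\<in>{1..S}. p ^ e dvd w s}))"
      by (simp add: sum.If_cases Int_def)
    also have "\<dots> \<le> (\<Sum>e=1..E. real d * (real S * (1 / real p ^ e) + 1))"
      using roots[OF pp] by (intro sum_mono) auto
    also have "\<dots> = real d * (real S * (\<Sum>e=1..E. 1 / real p ^ e) + real E)"
      by (simp add: sum_distrib_left sum.distrib distrib_left del: sum_divide_distrib)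
    also have "\<dots> \<le> real d * (real S * (1 / (real p - 1)) + real E)"
      using sum_geometric_le[OF p1] by (intro mult_left_mono add_mono) auto
    finally have "(\<Sum>s=1..S. real (multiplicity p (w s))) * ln (real p) \<le>
       real d * (real S * (1 / (real p - 1)) + real E) * ln (real p)"
      using p1 by (intro mult_right_mono) auto
    also have "\<dots> = real d * (real S * (ln (real p) / (real p - 1)) + real E * ln (real p))"
      by (simp add: algebra_simps)
    also have "\<dots> \<le> real d * (real S * (ln (real p) / (real p - 1)) + ln B)"
      using EB by (intro mult_left_mono) auto
    finally show "(\<Sum>s=1..S. real (multiplicity p (w s)) * ln (real p)) \<le> \<dots>"
      by (simp add: sum_distrib_right)
  qed
  also have "\<dots> = real d * (real S * (\<Sum>p\<in>A. ln (real p) / (real p - 1)) + real (card A) * ln B)"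
    by (simp add: sum.distrib sum_distrib_left distrib_left)
  also have "(\<Sum>p\<in>L. \<Sum>s=1..S. real (multiplicity p (w s)) * ln (real p)) \<le>
      (\<Sum>p\<in>L. real d * (real S / real X + 1) * ln B)"
  proof (rule sum_mono)
    fix p assume "p \<in> L"
    then have p: "prime p" "p > X" by (auto simp: L_def)
    have p1: "real p > 1" using p prime_gt_1_nat by fastforce
    have lnB: "ln B \<ge> 0" using pos by simp
    \<comment> \<open>Above \<open>X\<close> a cruder count suffices: the whole
      \<open>p\<close>-part of \<open>w s\<close> is at most \<open>B\<close>, and \<open>p\<close>
      divides at most \<open>d * (S/X + 1)\<close> of the values.\<close>
    have "(\<Sum>s=1..S. real (multiplicity p (w s)) * ln (real p)) \<le> (\<Sum>s=1..S. if p dvd w s then ln B else 0)"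
    proof (rule sum_mono)
      fix s assume s: "s \<in> {1..S}"
      show "real (multiplicity p (w s)) * ln (real p) \<le> (if p dvd w s then ln B else 0)"
      proof (cases "p dvd w s")
        case True
        have "p ^ multiplicity p (w s) \<le> w s" using wpos[OF s] multiplicity_dvd by (intro dvd_imp_le)
        then have "real p ^ multiplicity p (w s) \<le> B" using upper[OF s] by (metis of_nat_le_iff of_nat_power order_trans)
        then have "ln (real p ^ multiplicity p (w s)) \<le> ln B" using p1 pos by (subst ln_le_cancel_iff) auto
        then show ?thesis using True p1 by (simp add: ln_realpow)
      next
        case False
        then show ?thesis by (simp add: not_dvd_imp_multiplicity_0)
      qed
    qed
    also have "\<dots> = real (card {s\<in>{1..S}. p ^ 1 dvd w s}) * ln B"
      by (simp add: sum.If_cases Int_def)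
    also have "\<dots> \<le> (real d * (real S / real p ^ 1 + 1)) * ln B"
      using roots[OF p(1), of 1] lnB by (intro mult_right_mono) auto
    also have "\<dots> \<le> (real d * (real S / real X + 1)) * ln B"
      using p pos lnB by (intro mult_right_mono mult_left_mono add_mono divide_left_mono) auto
    finally show "(\<Sum>s=1..S. real (multiplicity p (w s)) * ln (real p)) \<le> real d * (real S / real X + 1) * ln B" .
  qed
  also have "\<dots> = real (card L) * (real d * (real S / real X + 1) * ln B)" by simp
  finally have main: "real d * ln (fact S) \<le> real d * (real S * (\<Sum>p\<in>A. ln (real p) / (real p - 1)) + real (card A) * ln B)
     + real (card L) * (real d * (real S / real X + 1) * ln B)" by simp
  have "real d * (real S * ln (real S) - real S) \<le> real d * ln (fact S)"
    using ln_fact_lower[of S] by (intro mult_left_mono) auto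
  with main show ?thesis unfolding L_def by linarith
qed

section \<open>Mertens' theorems with bounded error\<close>

lemma card_multiples_lower:
  assumes "(p::nat) > 0"
  shows "real (card {m\<in>{1..n}. p dvd m}) \<ge> real n / real p - 1"
proof -
  have "(\<lambda>j. p * j) ` {1..n div p} \<subseteq> {m\<in>{1..n}. p dvd m}"
    using assms by (auto simp: less_eq_div_iff_mult_less_eq mult.commute Suc_le_eq)
  then have "card ((\<lambda>j. p * j) ` {1..n div p}) \<le> card {m\<in>{1..n}. p dvd m}"
    by (intro card_mono) auto
  moreover have "card ((\<lambda>j. p * j) ` {1..n div p}) = n div p"
    using assms by (subst card_image) (auto simp: inj_on_def)
  ultimately have "n div p \<le> card {m\<in>{1..n}. p dvd m}" by simp
  moreover have "real n / real p - 1 \<le> real (n div p)"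
  proof -
    have "real n = real (n div p) * real p + real (n mod p)"
      by (metis div_mult_mod_eq of_nat_add of_nat_mult)
    moreover have "real (n mod p) \<le> real p" using assms by (simp add: less_imp_le)
    ultimately have "real n \<le> (real (n div p) + 1) * real p" by (simp add: algebra_simps)
    then show ?thesis using assms by (simp add: field_simps)
  qed
  ultimately show ?thesis by linarith
qed

text \<open>The logarithms of the distinct primes dividing \<open>m\<close> add up to at most
  \<open>ln m\<close>. Summed over \<open>m \<le> n\<close> and counted by multiples of
  \<open>p\<close>, the rounding costs only \<open>theta n \<le> 6 n\<close>.\<close>

lemma mertens_first_upper: "(\<Sum>p\<in>primes_le n. ln (real p) / real p) \<le> ln (real n) + 6"
proof (cases "n = 0")
  case True
  then show ?thesis by (simp add: primes_le_def)
next
  case False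
  have lnp: "ln (real p) \<ge> 0" if "p \<in> primes_le n" for p
    using that prime_ge_1_nat[of p] by (auto simp: primes_le_def)
  have "real n * (\<Sum>p\<in>primes_le n. ln (real p) / real p) - theta n
      = (\<Sum>p\<in>primes_le n. (real n / real p - 1) * ln (real p))"
    by (simp add: theta_def sum_distrib_left sum_subtractf algebra_simps)
  also have "\<dots> \<le> (\<Sum>p\<in>primes_le n. real (card {m\<in>{1..n}. p dvd m}) * ln (real p))"
    using lnp by (intro sum_mono mult_right_mono card_multiples_lower)
      (auto simp: primes_le_def prime_gt_0_nat)
  also have "\<dots> = (\<Sum>p\<in>primes_le n. \<Sum>m=1..n. if p dvd m then ln (real p) else 0)"
    by (simp add: sum.If_cases Int_def)
  also have "\<dots> = (\<Sum>m=1..n. \<Sum>p\<in>primes_le n. if p dvd m then ln (real p) else 0)"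
    by (rule sum.swap)
  also have "\<dots> \<le> (\<Sum>m=1..n. ln (real n))"
  proof (rule sum_mono)
    fix m assume m: "m \<in> {1..n}"
    have "(\<Sum>p\<in>primes_le n. if p dvd m then ln (real p) else 0) \<le>
          (\<Sum>p\<in>primes_le n. real (multiplicity p m) * ln (real p))"
    proof (rule sum_mono)
      fix p assume p: "p \<in> primes_le n"
      show "(if p dvd m then ln (real p) else 0) \<le> real (multiplicity p m) * ln (real p)"
      proof (cases "p dvd m")
        case True
        then have "multiplicity p m \<ge> 1"
          using m p by (intro multiplicity_geI) (auto simp: primes_le_def)
        then show ?thesis using True lnp[OF p] mult_right_mono[of 1 "real (multiplicity p m)" "ln (real p)"] by simp
      qed (use lnp[OF p] in simp)
    qed
    also have "\<dots> = ln (real m)"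
      using m by (intro ln_eq_sum_multiplicity[symmetric])
        (auto simp: primes_le_def prime_factors_dvd dest: dvd_imp_le)
    also have "\<dots> \<le> ln (real n)" using m by simp
    finally show "(\<Sum>p\<in>primes_le n. if p dvd m then ln (real p) else 0) \<le> ln (real n)" .
  qed
  also have "\<dots> = real n * ln (real n)" by simp
  finally have "real n * (\<Sum>p\<in>primes_le n. ln (real p) / real p) \<le> real n * (ln (real n) + 6)"
    using theta_le[of n] by (simp add: algebra_simps)
  then show ?thesis using False by simp
qed

lemma sum_ln_over_square_le: "(\<Sum>m=2..n. ln (real m) / (real m * (real m - 1))) \<le> 2"
proof -
  \<comment> \<open>The subtracted term imitates the tail integral of \<open>ln x / x^2\<close>,
    with slack, and makes the induction telescope.\<close>
  have "(\<Sum>m=2..n. ln (real m) / (real m * (real m - 1))) \<le> 2 - (if n \<ge> 1 then (ln (real n) + 2) / real n else 0)"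
  proof (induction n)
    case (Suc n)
    show ?case
    proof (cases "n = 0")
      case False
      have "ln (real (Suc n)) - ln (real n) = ln (real (Suc n) / real n)"
        using False by (subst ln_div) auto
      also have "real (Suc n) / real n = 1 + 1 / real n" using False by (simp add: field_simps)
      finally have "ln (real (Suc n)) - ln (real n) \<le> 1 / real n"
        using ln_add_one_self_le_self[of "1 / real n"] by simp
      then have "real (Suc n) * (ln (real (Suc n)) - ln (real n)) \<le> real (Suc n) * (1 / real n)"
        by (intro mult_left_mono) auto
      also have "\<dots> \<le> 2" using False by (simp add: field_simps)
      finally have *: "real (Suc n) * (ln (real (Suc n)) - ln (real n)) \<le> 2" .
      have "(ln (real (Suc n)) + 2) / real (Suc n) + ln (real (Suc n)) / (real (Suc n) * real n) - (ln (real n) + 2) / real n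
          = (real (Suc n) * (ln (real (Suc n)) - ln (real n)) - 2) / (real (Suc n) * real n)"
        using False by (simp add: divide_simps del: of_nat_Suc) (simp add: algebra_simps)
      also have "\<dots> \<le> 0" using * by (intro divide_nonpos_nonneg) auto
      finally show ?thesis using Suc False by (simp add: sum.cl_ivl_Suc)
    qed simp
  qed simp
  also have "\<dots> \<le> 2" by auto
  finally show ?thesis .
qed

text \<open>The geometric series over prime powers produces \<open>1 / (p - 1)\<close> where
  Mertens' sums have \<open>1 / p\<close>; the difference converges even when summed over all
  integers.\<close>

lemma sum_primes_pred_le:
  assumes "A \<subseteq> primes_le n"
  shows "(\<Sum>p\<in>A. ln (real p) / (real p - 1)) \<le> (\<Sum>p\<in>A. ln (real p) / real p) + 2"
proof -
  have sub: "primes_le n \<subseteq> {2..n}" using prime_ge_2_nat by (auto simp: primes_le_def)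
  have "(\<Sum>p\<in>A. ln (real p) / (real p - 1)) - (\<Sum>p\<in>A. ln (real p) / real p)
      = (\<Sum>p\<in>A. ln (real p) / (real p * (real p - 1)))"
    unfolding sum_subtractf[symmetric]
  proof (rule sum.cong[OF refl])
    fix p assume "p \<in> A"
    then have "p \<ge> 2" using assms sub by auto
    then show "ln (real p) / (real p - 1) - ln (real p) / real p = ln (real p) / (real p * (real p - 1))"
      by (simp add: divide_simps) (simp add: algebra_simps)
  qed
  also have "\<dots> \<le> (\<Sum>m=2..n. ln (real m) / (real m * (real m - 1)))"
    using assms sub by (intro sum_mono2) auto
  also have "\<dots> \<le> 2" by (rule sum_ln_over_square_le)
  finally show ?thesis by simp
qed

text \<open>The factorization method with \<open>w s = s\<close> and \<open>X = S = n\<close>: no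
  prime above \<open>n\<close> divides any \<open>s\<close>. The constant is 1 from Stirling, 14
  from the prime count and 2 from replacing \<open>p - 1\<close> by \<open>p\<close>.\<close>

lemma mertens_first_lower:
  assumes "n > 0"
  shows "(\<Sum>p\<in>primes_le n. ln (real p) / real p) \<ge> ln (real n) - 17"
proof -
  have "real 1 * (real n * ln (real n) - real n) \<le>
     real 1 * (real n * (\<Sum>p\<in>primes_le n. ln (real p) / (real p - 1)) + real (card (primes_le n)) * ln (real n)) +
     real (card {p. prime p \<and> p > n \<and> (\<exists>s\<in>{1..n}. p dvd s)}) * (real 1 * (real n / real n + 1) * ln (real n))"
  proof (rule large_prime_divisors)
    fix p e :: nat assume p: "prime p" "1 \<le> e"
    have "{s \<in> {1..n}. p ^ e dvd s} \<subseteq> (\<lambda>j. p ^ e * j) ` {1..n div p ^ e}"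
    proof
      fix s assume "s \<in> {s \<in> {1..n}. p ^ e dvd s}"
      then obtain j where j: "s = p ^ e * j" "1 \<le> s" "s \<le> n" by (auto elim!: dvdE simp del: One_nat_def)
      then have "j \<le> n div p ^ e" using p
        by (metis div_le_mono nonzero_mult_div_cancel_left not_prime_0 power_not_zero)
      then show "s \<in> (\<lambda>j. p ^ e * j) ` {1..n div p ^ e}" using j by (intro image_eqI[of _ _ j]) (auto simp: Suc_le_eq intro: gr0I)
    qed
    then have "card {s \<in> {1..n}. p ^ e dvd s} \<le> card ((\<lambda>j. p ^ e * j) ` {1..n div p ^ e})"
      by (intro card_mono) auto
    also have "\<dots> \<le> n div p ^ e" using card_image_le[of "{1..n div p ^ e}"] by simp
    finally have "real (card {s \<in> {1..n}. p ^ e dvd s}) \<le> real n / real (p ^ e)"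
      by (meson of_nat_div_le_of_nat of_nat_mono order_trans)
    then show "real (card {s \<in> {1..n}. p ^ e dvd s}) \<le> real 1 * (real n / real p ^ e + 1)"
      by simp
  qed (use assms in \<open>auto simp: primes_le_def\<close>)
  moreover have "{p. prime p \<and> p > n \<and> (\<exists>s\<in>{1..n}. p dvd s)} = {}"
    by (auto dest: dvd_imp_le)
  ultimately have "real n * ln (real n) - real n \<le> real n * (\<Sum>p\<in>primes_le n. ln (real p) / (real p - 1)) + 14 * real n"
    using card_primes_le_bound[of n] by (simp only:) simp
  then have "real n * (ln (real n) - 15) \<le> real n * (\<Sum>p\<in>primes_le n. ln (real p) / (real p - 1))"
    by (simp add: algebra_simps)
  then have "ln (real n) - 15 \<le> (\<Sum>p\<in>primes_le n. ln (real p) / (real p - 1))"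
    using assms by simp
  with sum_primes_pred_le[of "primes_le n" n] show ?thesis by simp
qed

text \<open>Abel summation of the first theorem against \<open>1 / ln n\<close>. The two-sided bound
  allows the split and non-split parts to be compared in the sieve estimate.\<close>

lemma mertens_second:
  obtains C where "C > 0"
    "\<And>n. n \<ge> 2 \<Longrightarrow> (\<Sum>p\<in>primes_le n. 1 / real p) \<le> ln (ln (real n)) + C"
    "\<And>n. n \<ge> 2 \<Longrightarrow> (\<Sum>p\<in>primes_le n. 1 / real p) \<ge> ln (ln (real n)) - C"
proof -
  define s where "s n = (\<Sum>p\<in>primes_le n. ln (real p) / real p)" for n
  define r where "r n = (\<Sum>p\<in>primes_le n. 1 / real p)" for n
  define b where "b n = s n - ln (real n)" for n
  have b: "\<bar>b n\<bar> \<le> 17" if "n \<ge> 1" for n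
    using mertens_first_lower[of n] mertens_first_upper[of n] that unfolding b_def s_def by auto
  have step: "primes_le (Suc n) = (if prime (Suc n) then insert (Suc n) (primes_le n) else primes_le n)" for n
    by (auto simp: primes_le_def le_Suc_eq)
  have new: "Suc n \<notin> primes_le n" for n by (simp add: primes_le_def)
  have rstep: "r (Suc n) - r n = (s (Suc n) - s n) / ln (real (Suc n))" if "n \<ge> 1" for n
    using that new[of n] by (auto simp: r_def s_def step)
  \<comment> \<open>Removing the boundary term of the Abel summation leaves increments that are a
    Riemann step for \<open>ln ln\<close> plus a bounded multiple of a telescoping
    difference.\<close>
  define V where "V n = r n - b n / ln (real n)" for n
  have Vstep: "V (Suc n) - V n = (ln (real (Suc n)) - ln (real n)) / ln (real (Suc n))
       + b n * (1 / ln (real n) - 1 / ln (real (Suc n)))" if "n \<ge> 2" for n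
  proof -
    have "ln (real n) > 0" "ln (real (Suc n)) > 0" using that by auto
    moreover have "r (Suc n) = r n + (s (Suc n) - s n) / ln (real (Suc n))" using rstep[of n] that by simp
    ultimately show ?thesis unfolding V_def b_def by (simp add: divide_simps) (simp add: algebra_simps)
  qed
  have dec: "1 / ln (real n) - 1 / ln (real (Suc n)) \<ge> 0" if "n \<ge> 2" for n
    using that by (auto intro!: divide_left_mono)
  have up: "V n \<le> V 2 + (ln (ln (real n)) - ln (ln 2)) + 17 * (1 / ln 2 - 1 / ln (real n))" if "n \<ge> 2" for n
    using that
  proof (induction n rule: dec_induct)
    case (step n)
    have l: "ln (real n) > 0" "ln (real (Suc n)) > 0" using step by auto
    have "(ln (real (Suc n)) - ln (real n)) / ln (real (Suc n)) = 1 - ln (real n) / ln (real (Suc n))"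
      using l by (simp add: diff_divide_distrib)
    also have "\<dots> \<le> - ln (ln (real n) / ln (real (Suc n)))"
      using ln_le_minus_one[of "ln (real n) / ln (real (Suc n))"] l by simp
    also have "\<dots> = ln (ln (real (Suc n))) - ln (ln (real n))" using l by (simp add: ln_div)
    finally have 1: "(ln (real (Suc n)) - ln (real n)) / ln (real (Suc n)) \<le> ln (ln (real (Suc n))) - ln (ln (real n))" .
    have 2: "b n * (1 / ln (real n) - 1 / ln (real (Suc n))) \<le> 17 * (1 / ln (real n) - 1 / ln (real (Suc n)))"
      using b[of n] step dec[of n] by (intro mult_right_mono) auto
    show ?case using Vstep[of n] step 1 2 by (simp add: algebra_simps)
  qed simp
  have ln23: "ln (2::real) > 0" "ln (3::real) > 0" by auto
  \<comment> \<open>The argument is \<open>n + 1\<close> here because concavity,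
    \<open>ln (n+2) - ln (n+1) \<le> ln (n+1) - ln n\<close>, bounds the Riemann step below by the
    next increment of \<open>ln ln\<close>.\<close>
  have low: "V n \<ge> V 2 + (ln (ln (real (Suc n))) - ln (ln 3)) - 17 * (1 / ln 2 - 1 / ln (real n))" if "n \<ge> 2" for n
    using that
  proof (induction n rule: dec_induct)
    case (step n)
    have l: "ln (real n) > 0" "ln (real (Suc n)) > 0" "ln (real (Suc (Suc n))) > 0" using step by auto
    have "real (Suc (Suc n)) * real n \<le> real (Suc n) * real (Suc n)" by (simp add: algebra_simps)
    then have "ln (real (Suc (Suc n)) * real n) \<le> ln (real (Suc n) * real (Suc n))"
      using step by (subst ln_le_cancel_iff) auto
    then have conc: "ln (real (Suc (Suc n))) + ln (real n) \<le> 2 * ln (real (Suc n))"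
      using step by (subst (asm) (1 2) ln_mult) auto
    have "ln (ln (real (Suc (Suc n)))) - ln (ln (real (Suc n))) = ln (ln (real (Suc (Suc n))) / ln (real (Suc n)))"
      using l by (simp add: ln_div)
    also have "\<dots> \<le> ln (real (Suc (Suc n))) / ln (real (Suc n)) - 1" using l by (intro ln_le_minus_one) auto
    also have "\<dots> = (ln (real (Suc (Suc n))) - ln (real (Suc n))) / ln (real (Suc n))" using l by (simp add: field_simps)
    also have "\<dots> \<le> (ln (real (Suc n)) - ln (real n)) / ln (real (Suc n))"
      using l conc by (intro divide_right_mono) auto
    finally have 1: "(ln (real (Suc n)) - ln (real n)) / ln (real (Suc n)) \<ge> ln (ln (real (Suc (Suc n)))) - ln (ln (real (Suc n)))" .
    have "(- 17) * (1 / ln (real n) - 1 / ln (real (Suc n))) \<le> b n * (1 / ln (real n) - 1 / ln (real (Suc n)))"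
      using b[of n] step dec[of n] by (intro mult_right_mono) auto
    then show ?case using Vstep[of n] step 1 by (simp add: algebra_simps)
  qed simp
  define C where "C = \<bar>V 2\<bar> + \<bar>ln (ln 2)\<bar> + \<bar>ln (ln 3)\<bar> + 34 * (1 / ln 2) + 1"
  have bb: "\<bar>b n / ln (real n)\<bar> \<le> 17 * (1 / ln 2)" if "n \<ge> 2" for n
  proof -
    have "\<bar>b n\<bar> / ln (real n) \<le> 17 / ln 2" using b[of n] that by (intro frac_le) auto
    then show ?thesis using that by (simp add: abs_div)
  qed
  have inv: "1 / ln (real n) \<ge> 0" if "n \<ge> 2" for n using that by simp
  show ?thesis
  proof (rule that[of C])
    show "C > 0" unfolding C_def using ln23 by (simp add: add_nonneg_pos)
    fix n :: nat assume n: "n \<ge> 2"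
    have "ln (ln (real (Suc n))) \<ge> ln (ln (real n))" using n by (subst ln_le_cancel_iff) auto
    then show "(\<Sum>p\<in>primes_le n. 1 / real p) \<ge> ln (ln (real n)) - C"
      using low[OF n] bb[OF n] inv[OF n] unfolding r_def[symmetric] V_def[of n] C_def abs_le_iff right_diff_distrib by linarith
    show "(\<Sum>p\<in>primes_le n. 1 / real p) \<le> ln (ln (real n)) + C"
      using up[OF n] bb[OF n] inv[OF n] unfolding r_def[symmetric] V_def[of n] C_def abs_le_iff right_diff_distrib by linarith
  qed
qed

section \<open>Covering a block by residue classes\<close>

lemma diff_dvd_poly_diff: "x - y dvd poly f x - poly f (y :: int)"
proof (induction f)
  case (pCons a f)
  have "poly (pCons a f) x - poly (pCons a f) y = (x - y) * poly f x + y * (poly f x - poly f y)"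
    by (simp add: algebra_simps)
  then show ?case using pCons by (metis dvd_add dvd_mult dvd_triv_left)
qed simp

lemma dvd_poly_shift:
  fixes m :: int
  assumes "m dvd x - y" "m dvd poly f y"
  shows "m dvd poly f x"
  using assms diff_dvd_poly_diff[of x y f] by (metis dvd_trans dvd_diff_right_iff dvd_add_right_iff diff_add_cancel)

lemma prime_linear_solution:
  fixes p :: nat and a b :: int
  assumes "prime p" "\<not> int p dvd a"
  shows "\<exists>n. int p dvd a * n + b"
proof -
  have "coprime (int p) a" using assms by (simp add: prime_imp_coprime)
  then have "coprime a (int p)" by (simp add: coprime_commute)
  then obtain x where "[a * x = 1] (mod int p)" using cong_solve_coprime_int by blast
  then have "int p dvd a * x - 1" by (simp add: cong_iff_dvd_diff)
  then have "int p dvd (- b) * (a * x - 1)" by (rule dvd_mult)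
  also have "(- b) * (a * x - 1) = a * (- b * x) + b" by (simp add: algebra_simps)
  finally show ?thesis by blast
qed

text \<open>A block is described by an integer position \<open>c p\<close> modulo each of finitely many primes; the primes
  dividing \<open>u\<close> are avoided.\<close>
definition coverable :: "int poly \<Rightarrow> int \<Rightarrow> nat \<Rightarrow> bool" where
  "coverable f u k \<longleftrightarrow> (\<exists>Ps c. finite Ps \<and> (\<forall>p\<in>Ps. prime p \<and> \<not> int p dvd u) \<and>
     (\<forall>i\<in>{1..k}. \<exists>p\<in>Ps. \<exists>j\<in>{1..k}. j \<noteq> i \<and>
        int p dvd poly f (c p + int i) \<and> int p dvd poly f (c p + int j)))"

lemma coverable_imp_has_property:
  assumes "coverable f u k"
  shows "\<exists>m. has_property f m k"
proof -
  obtain Ps c where Ps: "finite Ps" "\<And>p. p \<in> Ps \<Longrightarrow> prime p"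
    and cov: "\<And>i. i \<in> {1..k} \<Longrightarrow> \<exists>p\<in>Ps. \<exists>j\<in>{1..k}. j \<noteq> i \<and>
        int p dvd poly f (c p + int i) \<and> int p dvd poly f (c p + int j)"
    using assms unfolding coverable_def by blast
  have "\<exists>m. \<forall>p\<in>Ps. [m = nat (c p mod int p)] (mod p)"
    using Ps by (intro chinese_remainder_nat ballI impI primes_coprime) auto
  then obtain m where m: "\<And>p. p \<in> Ps \<Longrightarrow> [m = nat (c p mod int p)] (mod p)" by blast
  have shift: "int p dvd poly f (int (m + i))" if p: "p \<in> Ps" and "int p dvd poly f (c p + int i)" for p i
  proof (rule dvd_poly_shift[OF _ that(2)])
    have "[int m = int (nat (c p mod int p))] (mod int p)" using m[OF p] cong_int_iff by blast
    also have "int (nat (c p mod int p)) = c p mod int p"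
      using prime_gt_0_nat[OF Ps(2)[OF p]] by (intro int_nat_eq[THEN trans]) simp
    also have "[c p mod int p = c p] (mod int p)" by simp
    finally show "int p dvd int (m + i) - (c p + int i)" by (simp add: cong_iff_dvd_diff)
  qed
  have "has_property f m k" unfolding has_property_def
  proof
    fix i assume "i \<in> {1..k}"
    then obtain p j where pj: "p \<in> Ps" "j \<in> {1..k}" "j \<noteq> i"
        "int p dvd poly f (c p + int i)" "int p dvd poly f (c p + int j)"
      using cov by blast
    have "int p dvd poly f (int (m + i))" "int p dvd poly f (int (m + j))"
      using shift pj by auto
    moreover have "\<not> is_unit (int p)" using Ps(2)[OF pj(1)] prime_gt_1_nat[of p] by auto
    ultimately have "\<not> coprime (poly f (int (m + i))) (poly f (int (m + j)))"
      using not_coprimeI by blast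
    then show "\<exists>j\<in>{1..k}. j \<noteq> i \<and> \<not> coprime (poly f (int (m + i))) (poly f (int (m + j)))"
      using pj by blast
  qed
  then show ?thesis ..
qed

text \<open>Translating the block by multiples of the product of one witness prime per term
  preserves all the chosen divisibilities.\<close>

lemma has_property_infinite:
  assumes "has_property f m k"
  shows "infinite {n. has_property f n k}"
proof -
  have "\<forall>i\<in>{1..k}. \<exists>j\<in>{1..k}. j \<noteq> i \<and> (\<exists>p. prime p \<and> int p dvd poly f (int (m + i)) \<and> int p dvd poly f (int (m + j)))"
  proof
    fix i assume "i \<in> {1..k}"
    then obtain j where j: "j \<in> {1..k}" "j \<noteq> i" "\<not> coprime (poly f (int (m + i))) (poly f (int (m + j)))"
      using assms unfolding has_property_def by blast
    then have "gcd (poly f (int (m + i))) (poly f (int (m + j))) \<noteq> 1"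
      using coprime_iff_gcd_eq_1 by blast
    \<comment> \<open>The gcd is \<open>0\<close> if both terms vanish; a prime divisor exists even
      then, since \<open>1\<close> alone has none. This is why primes are multiplied and not
      gcds.\<close>
    then have "nat (gcd (poly f (int (m + i))) (poly f (int (m + j)))) \<noteq> 1"
      by (metis gcd_ge_0_int int_nat_eq of_nat_1)
    then obtain p where "prime p" "p dvd nat (gcd (poly f (int (m + i))) (poly f (int (m + j))))"
      using prime_factor_nat by blast
    moreover from this have "int p dvd gcd (poly f (int (m + i))) (poly f (int (m + j)))"
      by (metis gcd_ge_0_int int_nat_eq of_nat_dvd_iff)
    ultimately have "prime p" "int p dvd gcd (poly f (int (m + i))) (poly f (int (m + j)))"
      by auto
    then show "\<exists>j\<in>{1..k}. j \<noteq> i \<and> (\<exists>p. prime p \<and> int p dvd poly f (int (m + i)) \<and> int p dvd poly f (int (m + j)))"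
      using j by (auto intro!: bexI[of _ j])
  qed
  then have "\<forall>i\<in>{1..k}. \<exists>jp. fst jp \<in> {1..k} \<and> fst jp \<noteq> i \<and> prime (snd jp) \<and>
      int (snd jp) dvd poly f (int (m + i)) \<and> int (snd jp) dvd poly f (int (m + fst jp))"
    by (simp only: Bex_def split_paired_Ex fst_conv snd_conv) blast
  from bchoice[OF this] obtain jp where jp': "\<forall>i\<in>{1..k}. fst (jp i) \<in> {1..k} \<and> fst (jp i) \<noteq> i \<and> prime (snd (jp i)) \<and>
      int (snd (jp i)) dvd poly f (int (m + i)) \<and> int (snd (jp i)) dvd poly f (int (m + fst (jp i)))" ..
  define j p where "j i = fst (jp i)" and "p i = snd (jp i)" for i
  have jp: "j i \<in> {1..k} \<and> j i \<noteq> i \<and> prime (p i) \<and>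
      int (p i) dvd poly f (int (m + i)) \<and> int (p i) dvd poly f (int (m + j i))" if "i \<in> {1..k}" for i
    using jp' that unfolding j_def p_def by blast
  define W where "W = (\<Prod>i\<in>{1..k}. p i)"
  have W: "W > 0" unfolding W_def using jp prime_gt_0_nat by (intro prod_pos) blast
  have "has_property f (m + t * W) k" for t
    unfolding has_property_def
  proof
    fix i assume i: "i \<in> {1..k}"
    have d: "int (p i) dvd int (t * W)" unfolding W_def using i by (auto intro!: dvd_mult dvd_prodI)
    have "int (p i) dvd poly f (int (m + t * W + i))" "int (p i) dvd poly f (int (m + t * W + j i))"
    proof -
      have "int (m + t * W + x) - int (m + x) = int (t * W)" for x by simp
      then show "int (p i) dvd poly f (int (m + t * W + i))" "int (p i) dvd poly f (int (m + t * W + j i))"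
        using jp[OF i] d by (metis dvd_poly_shift)+
    qed
    moreover have "\<not> is_unit (int (p i))" using jp[OF i] prime_gt_1_nat[of "p i"] by auto
    ultimately have "\<not> coprime (poly f (int (m + t * W + i))) (poly f (int (m + t * W + j i)))"
      using not_coprimeI by blast
    then show "\<exists>j\<in>{1..k}. j \<noteq> i \<and> \<not> coprime (poly f (int (m + t * W + i))) (poly f (int (m + t * W + j)))"
      using jp[OF i] by blast
  qed
  then have "range (\<lambda>t. m + t * W) \<subseteq> {n. has_property f n k}" by auto
  moreover have "infinite (range (\<lambda>t. m + t * W))"
    using W by (intro range_inj_infinite) (auto simp: inj_on_def)
  ultimately show ?thesis using infinite_super by blast
qed

text \<open>An injection of the leftover terms \<open>U\<close> into the spare primes
  \<open>M\<close> gives each leftover a prime of its own, whose position is then chosen for that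
  term. Disjointness of \<open>Ps\<close> and \<open>M\<close> keeps the two choices of positions
  compatible.\<close>

lemma coverable_by_spare_primes:
  fixes c :: "nat \<Rightarrow> int"
  assumes Ps: "finite Ps" "finite M" "Ps \<inter> M = {}"
      "\<And>p. p \<in> Ps \<union> M \<Longrightarrow> prime p \<and> \<not> int p dvd u"
    and U: "U \<subseteq> {1..k}" "card U \<le> card M"
    and base: "\<And>i. i \<in> {1..k} - U \<Longrightarrow> \<exists>p\<in>Ps. \<exists>j\<in>{1..k}. j \<noteq> i \<and>
      int p dvd poly f (c p + int i) \<and> int p dvd poly f (c p + int j)"
    and spare: "\<And>i p. i \<in> U \<Longrightarrow> p \<in> M \<Longrightarrow> \<exists>n. \<exists>j\<in>{1..k}. j \<noteq> i \<and>
      int p dvd poly f (n + int i) \<and> int p dvd poly f (n + int j)"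
  shows "coverable f u k"
proof -
  have Ufin: "finite U" using U(1) by (rule finite_subset) simp
  obtain g where g: "inj_on g U" "g ` U \<subseteq> M" using U(2) inj_on_iff_card_le[OF Ufin Ps(2)] by blast
  define e where "e p = (SOME n. \<exists>j\<in>{1..k}. j \<noteq> inv_into U g p \<and>
     int p dvd poly f (n + int (inv_into U g p)) \<and> int p dvd poly f (n + int j))" for p
  have e: "\<exists>j\<in>{1..k}. j \<noteq> i \<and> int (g i) dvd poly f (e (g i) + int i) \<and> int (g i) dvd poly f (e (g i) + int j)"
    if i: "i \<in> U" for i
  proof -
    have inv: "inv_into U g (g i) = i" using g(1) i by simp
    have "g i \<in> M" using g(2) i by blast
    from spare[OF i this] show ?thesis unfolding e_def inv by (rule someI_ex)
  qed
  define cc where "cc p = (if p \<in> Ps then c p else e p)" for p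
  have "\<exists>p\<in>Ps \<union> M. \<exists>j\<in>{1..k}. j \<noteq> i \<and>
      int p dvd poly f (cc p + int i) \<and> int p dvd poly f (cc p + int j)" if i: "i \<in> {1..k}" for i
  proof (cases "i \<in> U")
    case True
    then have gM: "g i \<in> M" using g(2) by blast
    then have "cc (g i) = e (g i)" using Ps(3) by (auto simp: cc_def)
    then show ?thesis using e[OF True] by (rule_tac bexI[of _ "g i"]) (simp_all add: gM)
  next
    case False
    then obtain p where p: "p \<in> Ps" "\<exists>j\<in>{1..k}. j \<noteq> i \<and>
        int p dvd poly f (c p + int i) \<and> int p dvd poly f (c p + int j)" using base[of i] i by blast
    then show ?thesis by (rule_tac bexI[of _ p]) (simp_all add: cc_def)
  qed
  then show ?thesis unfolding coverable_def using Ps by (intro exI[of _ "Ps \<union> M"] exI[of _ cc]) auto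
qed

section \<open>Counting by residue classes, pigeonhole and smooth numbers\<close>

lemma card_le_residues:
  fixes S m :: nat
  assumes "m > 0" "finite R" "card R \<le> d" "A \<subseteq> {1..S}" "\<And>s. s \<in> A \<Longrightarrow> s mod m \<in> R"
  shows "real (card A) \<le> real d * (real S / real m + 1)"
proof -
  have "A \<subseteq> (\<Union>r\<in>R. (\<lambda>j. m * j + r) ` {..S div m})"
  proof
    fix s assume s: "s \<in> A"
    have "s = m * (s div m) + s mod m" by simp
    moreover have "s div m \<le> S div m" using s assms(4) by (intro div_le_mono) auto
    ultimately show "s \<in> (\<Union>r\<in>R. (\<lambda>j. m * j + r) ` {..S div m})" using assms(5)[OF s] by blast
  qed
  then have "card A \<le> card (\<Union>r\<in>R. (\<lambda>j. m * j + r) ` {..S div m})"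
    using assms(2) by (intro card_mono) auto
  also have "\<dots> \<le> (\<Sum>r\<in>R. card ((\<lambda>j. m * j + r) ` {..S div m}))" by (rule card_UN_le[OF assms(2)])
  also have "\<dots> \<le> (\<Sum>r\<in>R. S div m + 1)"
    by (intro sum_mono order_trans[OF card_image_le]) auto
  also have "\<dots> = card R * (S div m + 1)" by simp
  also have "\<dots> \<le> d * (S div m + 1)" using assms(3) by (intro mult_right_mono) auto
  finally have "real (card A) \<le> real d * (real (S div m) + 1)"
    by (metis of_nat_1 of_nat_add of_nat_le_iff of_nat_mult)
  also have "\<dots> \<le> real d * (real S / real m + 1)"
    by (intro mult_left_mono add_mono of_nat_div_le_of_nat) auto
  finally show ?thesis .
qed

text \<open>Each \<open>q\<close> takes over one hit of every remaining \<open>p\<close>, and by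
  pigeonhole some position of \<open>q\<close> achieves this for at least a proportion
  \<open>1/q\<close> of them. As no \<open>p\<close> has more hits than there are primes in
  \<open>Qs\<close>, the survivors end up with all their hits covered.\<close>

lemma clear_hits:
  fixes hits :: "'a \<Rightarrow> nat set"
  assumes "finite Qs" "\<And>q. q \<in> Qs \<Longrightarrow> q > 0 \<and> (\<exists>r. int q dvd poly f r)"
    and "finite A" "\<And>p. p \<in> A \<Longrightarrow> finite (hits p) \<and> card (hits p) \<le> card Qs"
  shows "\<exists>c A'. A' \<subseteq> A \<and> card A \<le> card A' * \<Prod>Qs \<and>
    (\<forall>p\<in>A'. \<forall>i\<in>hits p. \<exists>q\<in>Qs. int q dvd poly f (c q + int i))"
  using assms
proof (induction Qs arbitrary: A hits rule: finite_induct)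
  case empty
  then have "hits p = {}" if "p \<in> A" for p using that by fastforce
  then show ?case by (intro exI[of _ "\<lambda>_. 0"] exI[of _ A]) auto
next
  case (insert q Qs)
  obtain r where r: "int q dvd poly f r" and q: "q > 0" using insert.prems(1)[of q] by blast
  \<comment> \<open>The hit that \<open>q\<close> is to take over; \<open>g p\<close> below is the
    position of \<open>q\<close> that moves its root \<open>r\<close> onto it. For empty
    \<open>hits p\<close> the choice is arbitrary and harmless, since nothing remains to be
    covered.\<close>
  define e where "e p = (SOME i. i \<in> hits p)" for p
  define g where "g p = (r - int (e p)) mod int q" for p
  obtain c0 where c0: "card A \<le> card {p\<in>A. g p = c0} * q"
  proof -
    have "\<exists>c0\<in>{0..<int q}. card A \<le> card {p\<in>A. g p = c0} * q"
    proof (rule ccontr)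
      assume "\<not> ?thesis"
      then have *: "card {p\<in>A. g p = c0} * q < card A" if "c0 \<in> {0..<int q}" for c0
        using that by (meson linorder_not_le)
      have "card A * q = q * (\<Sum>c0\<in>{0..<int q}. card {p\<in>A. g p = c0})"
      proof -
        have "A = (\<Union>c0\<in>{0..<int q}. {p\<in>A. g p = c0})" using q by (auto simp: g_def)
        then have "card A = card (\<Union>c0\<in>{0..<int q}. {p\<in>A. g p = c0})" by simp
        also have "\<dots> = (\<Sum>c0\<in>{0..<int q}. card {p\<in>A. g p = c0})"
          using insert by (subst card_UN_disjoint) auto
        finally show ?thesis by simp
      qed
      also have "\<dots> = (\<Sum>c0\<in>{0..<int q}. card {p\<in>A. g p = c0} * q)"
        by (simp add: sum_distrib_left mult.commute)
      also have "\<dots> < (\<Sum>c0\<in>{0..<int q}. card A)"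
        using * q by (intro sum_strict_mono) auto
      also have "\<dots> = card A * q" by simp
      finally show False by simp
    qed
    then show ?thesis using that by blast
  qed
  define A1 where "A1 = {p\<in>A. g p = c0}"
  define hits' where "hits' p = hits p - {e p}" for p
  have "finite (hits' p) \<and> card (hits' p) \<le> card Qs" if "p \<in> A1" for p
  proof (cases "hits p = {}")
    case False
    then have "e p \<in> hits p" unfolding e_def by (simp add: some_in_eq)
    moreover have "finite (hits p)" "card (hits p) \<le> Suc (card Qs)"
      using insert that by (auto simp: A1_def)
    ultimately show ?thesis unfolding hits'_def by simp
  qed (simp add: hits'_def)
  then obtain c A' where A': "A' \<subseteq> A1" "card A1 \<le> card A' * \<Prod>Qs"
      "\<forall>p\<in>A'. \<forall>i\<in>hits' p. \<exists>q\<in>Qs. int q dvd poly f (c q + int i)"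
    using insert.IH[of A1 hits'] insert.prems by (auto simp: A1_def)
  have dvd: "int q dvd poly f (c0 + int (e p))" if "p \<in> A1" for p
  proof (rule dvd_poly_shift[OF _ r])
    have "[c0 = r - int (e p)] (mod int q)" using that by (auto simp: A1_def g_def)
    then show "int q dvd c0 + int (e p) - r" by (simp add: cong_iff_dvd_diff algebra_simps)
  qed
  show ?case
  proof (intro exI[of _ "c(q := c0)"] exI[of _ A'] conjI ballI)
    show "A' \<subseteq> A" using A' by (auto simp: A1_def)
    have "card A \<le> card A1 * q" using c0 by (simp add: A1_def)
    also have "\<dots> \<le> card A' * \<Prod>Qs * q" using A' by simp
    finally show "card A \<le> card A' * \<Prod>(insert q Qs)" using insert by (simp add: mult_ac)
    fix p i assume p: "p \<in> A'" and i: "i \<in> hits p"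
    show "\<exists>qa\<in>insert q Qs. int qa dvd poly f ((c(q := c0)) qa + int i)"
    proof (cases "i = e p")
      case True
      then show ?thesis using dvd p A' by auto
    next
      case False
      then obtain q' where "q' \<in> Qs" "int q' dvd poly f (c q' + int i)"
        using A'(3) p i by (auto simp: hits'_def)
      moreover have "q' \<noteq> q" using \<open>q' \<in> Qs\<close> insert by auto
      ultimately show ?thesis by auto
    qed
  qed
qed

text \<open>The vector of exponents determines the integer, and each exponent is at most
  \<open>log 2 N\<close>. For fixed \<open>Z\<close> this is polylogarithmic, which keeps the
  exceptional terms rare.\<close>

lemma card_smooth_le:
  assumes "finite Z" "\<And>p. p \<in> Z \<Longrightarrow> prime p" "N > 0"
  shows "finite {n. 0 < n \<and> n \<le> N \<and> prime_factors n \<subseteq> Z}"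
    "real (card {n. 0 < n \<and> n \<le> N \<and> prime_factors n \<subseteq> Z}) \<le> (log 2 (real N) + 1) ^ card Z"
proof -
  define A where "A = {n. 0 < n \<and> n \<le> N \<and> prime_factors n \<subseteq> Z}"
  have fin: "finite A" unfolding A_def by (rule finite_subset[of _ "{..N}"]) auto
  then show "finite {n. 0 < n \<and> n \<le> N \<and> prime_factors n \<subseteq> Z}" by (simp add: A_def)
  define M where "M = nat \<lfloor>log 2 (real N)\<rfloor>"
  define h where "h n = restrict (\<lambda>p. multiplicity p n) Z" for n :: nat
  have "inj_on h A"
  proof (rule inj_onI)
    fix m n assume mn: "m \<in> A" "n \<in> A" "h m = h n"
    have "multiplicity p m = multiplicity p n" if "prime p" for p
    proof (cases "p \<in> Z")
      case True
      then show ?thesis using fun_cong[OF mn(3), of p] by (simp add: h_def)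
    next
      case False
      then have "p \<notin> prime_factors m" "p \<notin> prime_factors n" using mn by (auto simp: A_def)
      then show ?thesis using that by (simp add: prime_factors_multiplicity)
    qed
    then show "m = n" using mn multiplicity_eq_nat[of m n] by (auto simp: A_def)
  qed
  moreover have "h ` A \<subseteq> (PiE Z (\<lambda>_. {..M}))"
  proof
    fix y assume "y \<in> h ` A"
    then obtain n where n: "n \<in> A" "y = h n" by auto
    have "multiplicity p n \<le> M" if "p \<in> Z" for p
    proof -
      have "2 ^ multiplicity p n \<le> p ^ multiplicity p n"
        using prime_ge_2_nat[OF assms(2)[OF that]] by (intro power_mono) auto
      also have "\<dots> \<le> n" using n by (intro dvd_imp_le multiplicity_dvd) (auto simp: A_def)
      also have "\<dots> \<le> N" using n by (auto simp: A_def)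
      finally have "real (2 ^ multiplicity p n) \<le> real N" by (rule of_nat_mono)
      then have "real (multiplicity p n) \<le> log 2 (real N)" using assms(3) by (subst le_log_iff) (auto simp: powr_realpow)
      then show ?thesis unfolding M_def by (simp add: le_nat_floor)
    qed
    then show "y \<in> (PiE Z (\<lambda>_. {..M}))" using n by (auto simp: h_def)
  qed
  ultimately have "card A \<le> card (PiE Z (\<lambda>_. {..M}))"
    by (intro card_inj_on_le) (auto intro!: finite_PiE assms)
  also have "\<dots> = (M + 1) ^ card Z" using assms by (simp add: card_PiE)
  finally have "real (card A) \<le> (real M + 1) ^ card Z" 
    using of_nat_mono[of "card A" "(M + 1) ^ card Z", where 'a = real] by (simp only: of_nat_power of_nat_add of_nat_1)
  also have "\<dots> \<le> (log 2 (real N) + 1) ^ card Z"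
  proof (intro power_mono add_mono)
    have "log 2 (real N) \<ge> 0" using assms(3) by simp
    then show "real M \<le> log 2 (real N)" unfolding M_def by simp
  qed auto
  finally show "real (card {n. 0 < n \<and> n \<le> N \<and> prime_factors n \<subseteq> Z}) \<le> (log 2 (real N) + 1) ^ card Z"
    by (simp add: A_def)
qed

section \<open>Quadratic polynomials\<close>

lemma poly_quad: "poly [:c, b, a:] (x::int) = a * x^2 + b * x + c"
  by (simp add: power2_eq_square algebra_simps)

text \<open>Modulo \<open>p\<close> the vertex of the parabola is placed at the middle \<open>t / 2\<close> of the block, so the roots
  come in pairs symmetric about it.\<close>
lemma quad_shift:
  fixes a b c n t x :: int and p :: nat
  assumes "prime p" "\<not> int p dvd 2 * a" "int p dvd 2 * a * n + b + a * t"
  shows "int p dvd poly [:c, b, a:] (n + x) \<longleftrightarrow> int p dvd a^2 * (2 * x - t)^2 - (b^2 - 4 * a * c)"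
proof -
  have "4 * a * poly [:c, b, a:] (n + x) - (a^2 * (2 * x - t)^2 - (b^2 - 4 * a * c)) =
      (2 * a * n + b + a * t) * (2 * a * n + 4 * a * x + b - a * t)"
    unfolding poly_quad by (simp add: power2_eq_square algebra_simps)
  then have "int p dvd 4 * a * poly [:c, b, a:] (n + x) - (a^2 * (2 * x - t)^2 - (b^2 - 4 * a * c))"
    using assms(3) by (metis dvd_mult2)
  then have "int p dvd 4 * a * poly [:c, b, a:] (n + x) \<longleftrightarrow> int p dvd a^2 * (2 * x - t)^2 - (b^2 - 4 * a * c)"
    by (metis dvd_diff_right_iff dvd_diff_left_iff dvd_diffD dvd_diff dvd_add_right_iff diff_add_cancel)
  moreover have "int p dvd 4 * a * y \<longleftrightarrow> int p dvd y" for y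
  proof -
    have "4 * a * y = 2 * (2 * a * y)" by simp
    moreover have "\<not> int p dvd 2" using assms(2) by auto
    ultimately show ?thesis using assms(1,2) by (metis prime_dvd_mult_iff prime_nat_int_transfer)
  qed
  ultimately show ?thesis by simp
qed

lemma quad_center:
  fixes a b t :: int
  assumes "prime (p::nat)" "\<not> int p dvd 2 * a"
  shows "\<exists>n. int p dvd 2 * a * n + b + a * t"
  using prime_linear_solution[of p "2 * a" "b + a * t"] assms by (simp add: algebra_simps)

text \<open>A sequence \<open>w\<close> to which \<open>large_prime_divisors\<close> applies and whose prime factors divide values of
  \<open>a\<^sup>2h\<^sup>2 - D\<close>.\<close>
lemma quad_sequence:
  fixes a D :: int
  assumes "a \<noteq> 0"
  obtains l d C :: nat and w :: "nat \<Rightarrow> nat" where "l \<ge> 1" "C \<ge> 1" "d \<ge> 1" "d \<le> 2"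
    "\<And>s. s \<ge> 1 \<Longrightarrow> s ^ d \<le> w s" "\<And>s. s \<ge> 1 \<Longrightarrow> w s \<le> C * s ^ 2"
    "\<And>p e S. prime p \<Longrightarrow> e \<ge> 1 \<Longrightarrow>
       real (card {s\<in>{1..S}. p ^ e dvd w s}) \<le> real d * (real S / real p ^ e + 1)"
    "\<And>p s. prime p \<Longrightarrow> p dvd w s \<Longrightarrow> int p dvd a^2 * (int (l * s))^2 - D"
proof (cases "D = 0")
  case True
  \<comment> \<open>For \<open>D = 0\<close> the value is the square \<open>a^2 s^2\<close>, for
    which the required root count modulo \<open>p^e\<close> fails; its divisor \<open>s\<close> is
    used in its place, with \<open>d = 1\<close>.\<close>
  show ?thesis
  proof (rule that[of 1 1 1 "\<lambda>s. s"])
    fix p e S :: nat assume "prime p" "e \<ge> 1"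
    then have "real (card {s\<in>{1..S}. p ^ e dvd s}) \<le> real 1 * (real S / real (p ^ e) + 1)"
      by (intro card_le_residues[where R = "{0}"]) (auto simp: prime_gt_0_nat)
    then show "real (card {s\<in>{1..S}. p ^ e dvd s}) \<le> real 1 * (real S / real p ^ e + 1)" by simp
  qed (use True in \<open>auto simp: self_le_power power2_eq_square intro!: dvd_mult\<close>)
next
  case False
  \<comment> \<open>With \<open>h = 2 a D s\<close> the factor \<open>D\<close> splits off:
    \<open>a^2 h^2 - D = D * W s\<close>. Since \<open>W s\<close> is \<open>-1\<close> modulo
    \<open>2 a D\<close>, its prime factors avoid those modulo which roots could degenerate.\<close>
  define W :: "int \<Rightarrow> int" where "W s = 4 * a^4 * D * s^2 - 1" for s
  define w where "w s = nat \<bar>W (int s)\<bar>" for s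
  define l where "l = nat \<bar>2 * a * D\<bar>"
  define C where "C = nat (4 * a^4 * \<bar>D\<bar> + 1)"
  have aD: "\<bar>a^4 * D\<bar> \<ge> 1" using assms False by (simp add: int_one_le_iff_zero_less)
  have dvdw: "int m dvd W (int s) \<longleftrightarrow> m dvd w s" for m s
    using of_nat_dvd_iff[of m "w s", where 'a = int] by (simp add: w_def)
  show ?thesis
  proof (rule that[of l C 2 w])
    show "l \<ge> 1" unfolding l_def using assms False by (simp add: Suc_le_eq)
    have "4 * a^4 * \<bar>D\<bar> \<ge> 0" by simp
    then show "C \<ge> 1" unfolding C_def by linarith
    fix s :: nat assume s: "s \<ge> 1"
    have s2: "int s ^ 2 \<ge> 1" using s by (simp add: self_le_power)
    have "\<bar>4 * a^4 * D * int s ^ 2\<bar> = 4 * \<bar>a^4 * D\<bar> * int s ^ 2" by (simp add: abs_mult)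
    also have "\<dots> \<ge> 4 * 1 * int s ^ 2" using aD by (intro mult_right_mono mult_left_mono) auto
    finally have "\<bar>W (int s)\<bar> \<ge> int s ^ 2" unfolding W_def using s2 by linarith
    then show "s ^ 2 \<le> w s" unfolding w_def by (simp add: nat_le_iff le_nat_iff)
    have "\<bar>W (int s)\<bar> \<le> \<bar>4 * a^4 * D * int s ^ 2\<bar> + 1" unfolding W_def by linarith
    also have "\<dots> \<le> (4 * a^4 * \<bar>D\<bar> + 1) * int s ^ 2" using s2 by (simp add: abs_mult algebra_simps)
    finally show "w s \<le> C * s ^ 2" unfolding w_def C_def
      by (simp add: nat_le_iff)
  next
    fix p s :: nat assume "prime p" "p dvd w s"
    then have d: "int p dvd W (int s)" using dvdw by simp
    have "a^2 * (int (l * s))^2 - D = D * W (int s)"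
      unfolding W_def l_def by (simp add: power_mult_distrib power2_eq_square algebra_simps power4_eq_xxxx)
    then show "int p dvd a^2 * (int (l * s))^2 - D" using d by simp
  next
    fix p e S :: nat assume p: "prime p" and e: "e \<ge> 1"
    show "real (card {s\<in>{1..S}. p ^ e dvd w s}) \<le> real 2 * (real S / real p ^ e + 1)"
    proof (cases "{s\<in>{1..S}. p ^ e dvd w s} = {}")
      case True
      then show ?thesis by (simp only: card.empty) simp
    next
      case ne: False
      then obtain s0 where s0: "s0 \<in> {1..S}" "p ^ e dvd w s0" by auto
      have pnot: "\<not> int p dvd 2 * (a^4 * D) * int s" if "p ^ e dvd w s" for s
      proof
        assume "int p dvd 2 * (a^4 * D) * int s"
        then have "int p dvd 2 * int s * (2 * (a^4 * D) * int s)" by (rule dvd_mult)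
        moreover have "int p dvd W (int s)" using that e dvdw[of p s] by (meson dvd_power dvd_trans less_le_trans zero_less_one)
        ultimately have "int p dvd 2 * int s * (2 * (a^4 * D) * int s) - W (int s)" by (rule dvd_diff)
        also have "\<dots> = 1" unfolding W_def by (simp add: power2_eq_square algebra_simps)
        finally show False using p prime_gt_1_nat[of p] by simp
      qed
      have "s mod p ^ e \<in> {s0 mod p ^ e, nat ((- int s0) mod int (p ^ e))}"
        if s: "s \<in> {s\<in>{1..S}. p ^ e dvd w s}" for s
      proof -
        have "int (p ^ e) dvd W (int s)" "int (p ^ e) dvd W (int s0)"
          using s s0 dvdw[of "p ^ e"] by blast+
        then have "int (p ^ e) dvd W (int s) - W (int s0)" by (rule dvd_diff)
        also have "W (int s) - W (int s0) = (4 * (a^4 * D)) * ((int s - int s0) * (int s + int s0))"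
          unfolding W_def by (simp add: power2_eq_square algebra_simps)
        finally have 1: "int p ^ e dvd (4 * (a^4 * D)) * ((int s - int s0) * (int s + int s0))" by simp
        have "\<not> int p dvd 2 * (a^4 * D) * int s" using pnot s by auto
        then have n2: "\<not> int p dvd 2" "\<not> int p dvd a^4 * D" "\<not> int p dvd int s" by (auto simp: dvd_mult dvd_mult2)
        have pi: "prime (int p)" using p by simp
        have "\<not> int p dvd 4 * (a^4 * D)"
        proof
          assume "int p dvd 4 * (a^4 * D)"
          then have "int p dvd 2 * 2" using n2(2) pi by (simp add: prime_dvd_mult_iff)
          then show False using n2(1) pi prime_dvd_mult_iff by blast
        qed
        then have "coprime (int p ^ e) (4 * (a^4 * D))"
          using prime_imp_power_coprime[OF pi] coprime_commute by blast
        then have 2: "int p ^ e dvd (int s - int s0) * (int s + int s0)"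
          using 1 coprime_dvd_mult_right_iff by blast
        \<comment> \<open>A common factor would divide \<open>2 s\<close>. So the whole power
          \<open>p^e\<close> falls on one of the two factors, leaving only the classes of
          \<open>s0\<close> and \<open>- s0\<close>.\<close>
        have "\<not> (int p dvd int s - int s0 \<and> int p dvd int s + int s0)"
        proof
          assume "int p dvd int s - int s0 \<and> int p dvd int s + int s0"
          then have "int p dvd (int s - int s0) + (int s + int s0)" using dvd_add by blast
          then have "int p dvd 2 * int s" by simp
          then show False using n2 pi by (simp add: prime_dvd_mult_iff)
        qed
        then have "int p ^ e dvd int s - int s0 \<or> int p ^ e dvd int s + int s0"
        proof (cases "int p dvd int s - int s0")
          case True
          then have "coprime (int p ^ e) (int s + int s0)"
            using \<open>\<not> (_ \<and> _)\<close> prime_imp_power_coprime[OF pi] coprime_commute by blast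
          then show ?thesis using 2 coprime_dvd_mult_left_iff by blast
        next
          case False
          then have "coprime (int p ^ e) (int s - int s0)"
            using prime_imp_power_coprime[OF pi] coprime_commute by blast
          then show ?thesis using 2 coprime_dvd_mult_right_iff by blast
        qed
        then show ?thesis
        proof
          assume "int p ^ e dvd int s - int s0"
          then have "[int s = int s0] (mod int (p ^ e))" by (simp add: cong_iff_dvd_diff)
          then have "[s = s0] (mod p ^ e)" using cong_int_iff by blast
          then show ?thesis by (simp add: cong_def)
        next
          assume "int p ^ e dvd int s + int s0"
          then have "[int s = - int s0] (mod int (p ^ e))" by (simp add: cong_iff_dvd_diff)
          then have "int s mod int (p ^ e) = (- int s0) mod int (p ^ e)" by (simp add: cong_def)
          then have "nat (int (s mod p ^ e)) = nat ((- int s0) mod int (p ^ e))" by (simp only: zmod_int)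
          then show ?thesis by simp
        qed
      qed
      then have "real (card {s\<in>{1..S}. p ^ e dvd w s}) \<le> real 2 * (real S / real (p ^ e) + 1)"
        using p by (intro card_le_residues[where R = "{s0 mod p ^ e, nat ((- int s0) mod int (p ^ e))}"])
          (auto simp: prime_gt_0_nat card_insert_if)
      then show ?thesis by simp
    qed
  qed auto
qed

section \<open>Abundance of large prime divisors\<close>

lemma eventually_ln_power_le: "eventually (\<lambda>n::nat. a * ln (real n) ^ m \<le> real n) sequentially"
proof -
  have "((\<lambda>x. ln x ^ m / exp (ln x)) \<longlongrightarrow> (0::real)) at_top"
    by (rule filterlim_compose[OF tendsto_power_div_exp_0 ln_at_top])
  then have "((\<lambda>n. ln (real n) ^ m / exp (ln (real n))) \<longlongrightarrow> (0::real)) sequentially"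
    by (rule filterlim_compose[OF _ filterlim_real_sequentially])
  then have "((\<lambda>n. a * (ln (real n) ^ m / exp (ln (real n)))) \<longlongrightarrow> a * 0) sequentially"
    by (intro tendsto_mult tendsto_const)
  then have "eventually (\<lambda>n. a * (ln (real n) ^ m / exp (ln (real n))) < 1) sequentially"
    by (rule order_tendstoD) simp
  then show ?thesis using eventually_gt_at_top[of 0]
    by eventually_elim (simp add: field_simps)
qed

text \<open>Mertens' upper bound is inserted into the factorization method, and the weight of the
  primes up to \<open>X\<close> outside \<open>A\<close>, which divide no \<open>w s\<close>, is
  kept as a gain. That gain is what enlarges the pool for cubics. The 9 is 1 from Stirling, 6 from
  Mertens and 2 from \<open>p - 1\<close>.\<close>

lemma large_primes_lower:
  fixes w :: "nat \<Rightarrow> nat" and d S X :: nat and B :: real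
  assumes "d \<ge> 1" and lower: "\<And>s. s \<in> {1..S} \<Longrightarrow> s ^ d \<le> w s"
    and upper: "\<And>s. s \<in> {1..S} \<Longrightarrow> real (w s) \<le> B"
    and roots: "\<And>p e. prime p \<Longrightarrow> e \<ge> 1 \<Longrightarrow>
      real (card {s\<in>{1..S}. p ^ e dvd w s}) \<le> real d * (real S / real p ^ e + 1)"
    and A: "A \<subseteq> primes_le X"
    and small: "\<And>p s. prime p \<Longrightarrow> p \<le> X \<Longrightarrow> s \<in> {1..S} \<Longrightarrow> p dvd w s \<Longrightarrow> p \<in> A"
    and pos: "X > 0" "S > 0" "B \<ge> 1"
  shows "real S * (ln (real S) - ln (real X) + (\<Sum>p\<in>primes_le X - A. ln (real p) / real p) - 9) \<le>
    (real (card (primes_le X)) +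
     real (card {p. prime p \<and> p > X \<and> (\<exists>s\<in>{1..S}. p dvd w s)}) * (real S / real X + 1)) * ln B"
proof -
  define n where "n = real (card {p. prime p \<and> p > X \<and> (\<exists>s\<in>{1..S}. p dvd w s)})"
  define r where "r = (\<Sum>p\<in>primes_le X - A. ln (real p) / real p)"
  have Afin: "finite A" using A by (rule finite_subset) simp
  have "real d * (real S * ln (real S) - real S) \<le>
     real d * (real S * (\<Sum>p\<in>A. ln (real p) / (real p - 1)) + real (card A) * ln B) +
     n * (real d * (real S / real X + 1) * ln B)"
    unfolding n_def using A
    by (intro large_prime_divisors lower upper roots Afin small pos) (auto simp: primes_le_def)
  also have "\<dots> = real d * (real S * (\<Sum>p\<in>A. ln (real p) / (real p - 1)) + real (card A) * ln B +
     n * ((real S / real X + 1) * ln B))" by (simp add: algebra_simps)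
  finally have "real S * ln (real S) - real S \<le>
     real S * (\<Sum>p\<in>A. ln (real p) / (real p - 1)) + real (card A) * ln B + n * ((real S / real X + 1) * ln B)"
    using assms(1) by simp
  moreover have "real S * (\<Sum>p\<in>A. ln (real p) / (real p - 1)) \<le> real S * (ln (real X) + 8 - r)"
  proof (rule mult_left_mono)
    have "(\<Sum>p\<in>A. ln (real p) / real p) + r = (\<Sum>p\<in>primes_le X. ln (real p) / real p)"
      unfolding r_def using sum.subset_diff[OF A, of "\<lambda>p. ln (real p) / real p"] by simp
    then show "(\<Sum>p\<in>A. ln (real p) / (real p - 1)) \<le> ln (real X) + 8 - r"
      using sum_primes_pred_le[OF A] mertens_first_upper[of X] by simp
  qed simp
  moreover have "real (card A) * ln B \<le> real (card (primes_le X)) * ln B"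
    using A pos by (intro mult_right_mono of_nat_mono card_mono) auto
  ultimately show ?thesis unfolding n_def[symmetric] r_def[symmetric] by (simp add: algebra_simps)
qed

text \<open>Cutting at \<open>S / T\<close> for a large constant \<open>T\<close> creates a surplus
  \<open>ln T\<close> that beats all bounded losses; the price is that the primes exceed only a
  fixed fraction of \<open>S\<close>.\<close>

lemma many_large_primes:
  fixes w :: "nat \<Rightarrow> nat" and d C E :: nat
  assumes "d \<ge> 1" "C \<ge> 1"
    and lower: "\<And>s. s \<ge> 1 \<Longrightarrow> s ^ d \<le> w s"
    and upper: "\<And>s. s \<ge> 1 \<Longrightarrow> w s \<le> C * s ^ E"
    and roots: "\<And>p e S. prime p \<Longrightarrow> e \<ge> 1 \<Longrightarrow>
      real (card {s\<in>{1..S}. p ^ e dvd w s}) \<le> real d * (real S / real p ^ e + 1)"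
  obtains T :: nat and c :: real and S0 :: nat where "T \<ge> 1" "c > 0" 
    "\<And>S. S \<ge> S0 \<Longrightarrow>
      c * real S \<le> real (card {p. prime p \<and> p > S div T \<and> (\<exists>s\<in>{1..S}. p dvd w s)}) * ln (real S)"
proof -
  \<comment> \<open>\<open>28 (E + 1)\<close> makes the contribution of the prime count up to
    \<open>X\<close> at most \<open>S\<close> (14 from its bound, 2 from
    \<open>ln S \<le> 2 ln X\<close>); \<open>ln T \<ge> 11\<close> then leaves a surplus of
    \<open>11 - 9 - 1\<close>.\<close>
  define T where "T = max (28 * (E + 1)) (nat \<lceil>exp 11 :: real\<rceil>)"
  have T1: "T \<ge> 28 * (E + 1)" by (simp add: T_def)
  then have T0: "T \<ge> 1" by simp
  have "exp 11 \<le> real (nat \<lceil>exp 11 :: real\<rceil>)" by (rule real_nat_ceiling_ge)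
  then have "exp 11 \<le> real T" unfolding T_def by linarith
  then have lnT: "ln (real T) \<ge> 11" using T0 by (subst ln_ge_iff) auto
  define c where "c = 1 / (3 * real T * (real E + 1))"
  \<comment> \<open>\<open>S \<ge> C\<close> absorbs the constant factor of \<open>B\<close> into
    \<open>ln S\<close>; \<open>S \<ge> 4 T^2\<close> gives \<open>sqrt S \<le> X\<close>.\<close>
  define S0 where "S0 = max C (4 * T^2)"
  show ?thesis
  proof (rule that[OF T0])
    show "c > 0" using T0 unfolding c_def by simp
    fix S assume S: "S \<ge> S0"
    define X where "X = S div T"
    define L where "L = {p. prime p \<and> p > X \<and> (\<exists>s\<in>{1..S}. p dvd w s)}"
    have SC: "S \<ge> C" "S \<ge> 4 * T^2" using S by (auto simp: S0_def)
    have S1: "S \<ge> 4" using SC(2) T0 by (metis le_trans mult_le_mono2 nat_mult_1_right one_le_power)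
    have S1': "S \<ge> 1" "real S \<ge> 1" "real S > 0" using S1 by auto
    have "S < T * (X + 1)" unfolding X_def using T0 by (simp add: dividend_less_times_div)
    then have XS: "real S < real T * (real X + 1)" by (metis of_nat_1 of_nat_add of_nat_less_iff of_nat_mult)
    have XS2: "real X * real T \<le> real S"
      unfolding X_def by (metis div_times_less_eq_dividend of_nat_le_iff of_nat_mult)
    have "real S \<ge> 4 * real T ^ 2" using SC(2) by (metis of_nat_le_iff of_nat_mult of_nat_numeral of_nat_power)
    then have sq: "sqrt (real S) \<ge> 2 * real T" by (intro real_le_rsqrt) (simp add: power_mult_distrib)
    then have "real S \<ge> 2 * real T * sqrt (real S)"
      using mult_right_mono[OF sq, of "sqrt (real S)"] by simp
    then have "2 * real T * sqrt (real S) < real T * (real X + 1)" using XS by linarith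
    then have "2 * sqrt (real S) < real X + 1" using T0 by (simp add: mult.assoc)
    moreover have "sqrt (real S) \<ge> 1" using S1' by simp
    ultimately have Xsq: "sqrt (real S) \<le> real X" "real X \<ge> 1" by linarith+
    have X0: "X > 0" using Xsq by (cases X) auto
    have lnX: "ln (real S) \<le> 2 * ln (real X)"
    proof -
      have "ln (sqrt (real S)) \<le> ln (real X)" using Xsq S1' by (subst ln_le_cancel_iff) auto
      then show ?thesis using S1' by (simp add: ln_sqrt)
    qed
    have lnXle: "ln (real X) \<le> ln (real S) - ln (real T)"
    proof -
      have "ln (real X * real T) \<le> ln (real S)" using XS2 X0 T0 S1' by (subst ln_le_cancel_iff) auto
      then show ?thesis using X0 T0 by (simp add: ln_mult)
    qed
    define B where "B = real (C * S ^ E)"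
    have B1: "B \<ge> 1" unfolding B_def using assms(2) S1' by (metis One_nat_def Suc_leI mult_pos_pos less_le_trans of_nat_1 of_nat_le_iff zero_less_power zero_less_one)
    have lnB: "ln B \<le> (real E + 1) * ln (real S)"
    proof -
      have "ln B = ln (real C) + real E * ln (real S)"
        unfolding B_def using assms(2) S1' by (simp add: ln_mult ln_realpow)
      also have "ln (real C) \<le> ln (real S)" using SC(1) assms(2) by simp
      finally show ?thesis by (simp add: algebra_simps)
    qed
    have main: "real S * (ln (real S) - ln (real X) + 0 - 9) \<le>
        (real (card (primes_le X)) + real (card L) * (real S / real X + 1)) * ln B"
    proof -
      have "real (w s) \<le> B" if s: "s \<in> {1..S}" for s
      proof -
        have "w s \<le> C * s ^ E" using upper s by simp
        also have "\<dots> \<le> C * S ^ E" using s by (intro mult_left_mono power_mono) auto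
        finally show ?thesis unfolding B_def by (rule of_nat_mono)
      qed
      then show ?thesis
        using large_primes_lower[of d S w B "primes_le X" X] assms(1) lower roots X0 S1' B1
        unfolding L_def by (simp add: primes_le_def)
    qed
    have 2: "real (card (primes_le X)) * ln B \<le> real S"
    proof -
      have "real (card (primes_le X)) * ln B \<le> real (card (primes_le X)) * ((real E + 1) * (2 * ln (real X)))"
        using lnB lnX by (intro mult_left_mono order_trans[OF lnB]) auto
      also have "\<dots> = (real (card (primes_le X)) * ln (real X)) * (2 * (real E + 1))" by (simp add: algebra_simps)
      also have "\<dots> \<le> (14 * real X) * (2 * (real E + 1))"
        by (intro mult_right_mono card_primes_le_bound) auto
      also have "\<dots> = real X * real (28 * (E + 1))" by (simp add: algebra_simps)
      also have "\<dots> \<le> real X * real T" using T1 by (intro mult_left_mono of_nat_mono) auto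
      also have "\<dots> \<le> real S" by (rule XS2)
      finally show ?thesis .
    qed
    have 3: "(real S / real X + 1) * ln B \<le> 3 * real T * ((real E + 1) * ln (real S))"
    proof (intro mult_mono lnB)
      have "real S \<le> 2 * real T * real X"
        using XS mult_left_mono[OF Xsq(2), of "real T"] by (simp add: algebra_simps)
      then have "real S / real X \<le> 2 * real T" using X0 by (simp add: field_simps)
      then show "real S / real X + 1 \<le> 3 * real T" using T0 by linarith
    qed (use B1 in auto)
    have "real S * (ln (real T) - 9) \<le> real S * (ln (real S) - ln (real X) + 0 - 9)"
      using lnXle by (intro mult_left_mono) auto
    also have "\<dots> \<le> real (card (primes_le X)) * ln B + real (card L) * ((real S / real X + 1) * ln B)"
      using main by (simp add: algebra_simps)
    also have "\<dots> \<le> real S + real (card L) * (3 * real T * ((real E + 1) * ln (real S)))"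
      by (intro add_mono 2 mult_left_mono 3) simp
    finally have "real S * (ln (real T) - 10) \<le> real (card L) * (3 * real T * ((real E + 1) * ln (real S)))"
      by (simp add: algebra_simps)
    moreover have "real S * 1 \<le> real S * (ln (real T) - 10)" using lnT by (intro mult_left_mono) auto
    ultimately have "real S \<le> real (card L) * (3 * real T * ((real E + 1) * ln (real S)))" by simp
    then show "c * real S \<le> real (card {p. prime p \<and> p > S div T \<and> (\<exists>s\<in>{1..S}. p dvd w s)}) * ln (real S)"
      unfolding c_def L_def[symmetric] X_def[symmetric] using T0
      by (simp only: times_divide_eq_left mult_1_left, subst pos_divide_le_eq) (auto simp: mult_ac)
  qed
qed

text \<open>Avoiding the primes dividing \<open>2 * a\<close> makes completing the square reversible
  modulo every prime used; the reducible cubics depend on this avoidance as well.\<close>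

lemma quadratic_coverable:
  fixes a b c :: int
  assumes a: "a \<noteq> 0"
  shows "\<exists>K. \<forall>k\<ge>K. coverable [:c, b, a:] (2 * a) k"
proof -
  define f where "f = [:c, b, a:]"
  define D where "D = b^2 - 4 * a * c"
  define v where "v y = a^2 * y^2 - D" for y
  define good where "good p \<longleftrightarrow> prime p \<and> \<not> int p dvd 2 * a" for p :: nat
  obtain l d C :: nat and w :: "nat \<Rightarrow> nat" where lC: "l \<ge> 1" "C \<ge> 1" "d \<ge> 1" "d \<le> 2"
    and wl: "\<And>s. s \<ge> 1 \<Longrightarrow> s ^ d \<le> w s" and wu: "\<And>s. s \<ge> 1 \<Longrightarrow> w s \<le> C * s ^ 2"
    and wr: "\<And>p e S. prime p \<Longrightarrow> e \<ge> 1 \<Longrightarrow>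
       real (card {s\<in>{1..S}. p ^ e dvd w s}) \<le> real d * (real S / real p ^ e + 1)"
    and wv: "\<And>p s. prime p \<Longrightarrow> p dvd w s \<Longrightarrow> int p dvd a^2 * (int (l * s))^2 - D"
    by (rule quad_sequence[OF a, of D]) blast
  obtain T :: nat and c0 :: real and S0 :: nat where T: "T \<ge> 1" "c0 > 0"
    and pool: "\<And>S. S \<ge> S0 \<Longrightarrow>
      c0 * real S \<le> real (card {p. prime p \<and> p > S div T \<and> (\<exists>s\<in>{1..S}. p dvd w s)}) * ln (real S)"
    by (rule many_large_primes[OF lC(3) lC(2) wl wu wr]) blast+
  define Pool where "Pool S = {p. prime p \<and> p > S div T \<and> (\<exists>s\<in>{1..S}. p dvd w s)}" for S
  have good_large: "good p" if "prime p" "p > nat \<bar>2 * a\<bar>" for p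
  proof -
    have "\<not> int p dvd 2 * a"
    proof
      assume "int p dvd 2 * a"
      then have "\<bar>int p\<bar> \<le> \<bar>2 * a\<bar>" using a by (intro dvd_imp_le_int) auto
      then show False using that by linarith
    qed
    then show ?thesis using that by (simp add: good_def)
  qed
  have Pool_card: "c0 * real S \<le> real (card (Pool S)) * ln (real S)" if "S \<ge> S0" for S
    using pool[OF that] by (simp add: Pool_def)
  \<comment> \<open>The supply for the fixed small primes \<open>Qs\<close>: good primes modulo
    which \<open>f\<close> has a root. It is infinite because the pools are nonempty for arbitrarily
    large \<open>S\<close>.\<close>
  define R where "R = {p. good p \<and> (\<exists>h\<ge>1. int p dvd v (int h))}"
  have R_inf: "infinite R"
    unfolding infinite_nat_iff_unbounded
  proof
    fix M
    define S where "S = max (max 2 S0) (T * max M (nat \<bar>2 * a\<bar>))"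
    have S: "S \<ge> 2" "S \<ge> S0" "S \<ge> T * max M (nat \<bar>2 * a\<bar>)" by (auto simp: S_def)
    have "S div T \<ge> T * max M (nat \<bar>2 * a\<bar>) div T" using S by (intro div_le_mono)
    then have X: "S div T \<ge> max M (nat \<bar>2 * a\<bar>)" using T by simp
    have "c0 * real S > 0" using S T by simp
    then have "card (Pool S) \<noteq> 0" using Pool_card[OF S(2)] by (intro notI) simp
    then obtain p where "p \<in> Pool S" by (metis card.empty ex_in_conv)
    then obtain s where p: "prime p" "p > S div T" "s \<ge> 1" "p dvd w s" by (auto simp: Pool_def)
    have "good p" using p X by (intro good_large) auto
    moreover have "int p dvd v (int (l * s))" using wv[OF p(1,4)] by (simp add: v_def)
    moreover have "l * s \<ge> 1" using lC p by (simp add: Suc_le_eq)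
    ultimately have "p \<in> R" unfolding R_def by blast
    then show "\<exists>n>M. n \<in> R" using p X by (intro exI[of _ p]) auto
  qed
  \<comment> \<open>Bounds the hits of a centred pool prime: its roots fill at most two residue
    classes, and \<open>p > S / T\<close> gives \<open>k / p \<le> 2 l T\<close>.\<close>
  define J where "J = 2 * (2 * l * T + 1)"
  obtain Qs where Qs: "finite Qs" "card Qs = J" "Qs \<subseteq> R"
    using infinite_arbitrarily_large[OF R_inf, of J] by blast
  have Qs_good: "good q" if "q \<in> Qs" for q using that Qs by (auto simp: R_def)
  have good_cancel: "int p dvd y" if "good p" "int p dvd (2 * a) * y" for p y
    using that prime_dvd_multD[of "int p" "2 * a" y] unfolding good_def by auto
  have center: "\<exists>n. int p dvd 2 * a * n + b + a * t" if "good p" for p t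
    using quad_center[of p a b t] that by (auto simp: good_def)
  have shift: "int p dvd poly f (n + x) \<longleftrightarrow> int p dvd v (2 * x - t)"
    if "good p" "int p dvd 2 * a * n + b + a * t" for p n x t
    using quad_shift[of p a n b t c x] that unfolding good_def f_def v_def D_def by blast
  have Qs_root: "q > 0 \<and> (\<exists>r. int q dvd poly f r)" if q: "q \<in> Qs" for q
  proof -
    obtain h where h: "int q dvd v (int h)" using q Qs by (auto simp: R_def)
    obtain n where n: "int q dvd 2 * a * n + b + a * (- int h)" using center Qs_good[OF q] by blast
    have "int q dvd poly f (n + 0)" using shift[OF Qs_good[OF q] n, of 0] h by simp
    then show ?thesis using Qs_good[OF q] by (auto simp: good_def prime_gt_0_nat)
  qed
  \<comment> \<open>The bad primes: those whose position is reserved for another purpose, and those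
    modulo which the square cannot be completed.\<close>
  define Z where "Z = Qs \<union> prime_factors (nat \<bar>2 * a\<bar>)"
  have Zp: "prime p" if "p \<in> Z" for p using that Qs_good by (auto simp: Z_def good_def)
  have Zfin: "finite Z" using Qs by (simp add: Z_def)
  define Cv where "Cv = nat (a^2 + \<bar>D\<bar>)"
  define z where "z = card Z"
  \<comment> \<open>\<open>C4 * ln S\<close> will bound \<open>log 2 N + 1\<close>. Then
    \<open>a1\<close> is such that the exceptional terms, multiplied by the pigeonhole loss
    \<open>\<Prod>Qs\<close>, stay below the pool size \<open>c0 * S / ln S\<close>.\<close>
  define C4 where "C4 = (ln (real Cv * 16 * real l ^ 2) + 2) / ln 2 + 1"
  define a1 where "a1 = (5 + 4 * \<bar>C4\<bar> ^ z) * real (\<Prod>Qs) / c0"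
  obtain S1 where S1: "\<And>S. S \<ge> S1 \<Longrightarrow> a1 * ln (real S) ^ (z + 1) \<le> real S"
    using eventually_ln_power_le[of a1 "z + 1"] unfolding eventually_sequentially by blast
  \<comment> \<open>Primes above \<open>Sm\<close> do not divide \<open>2 * a\<close> and are not in
    \<open>Qs\<close>; with \<open>k > 2 * Sm\<close> every \<open>q\<close> in \<open>Qs\<close>
    has room for a partner at distance \<open>q\<close>.\<close>
  define Sm where "Sm = Max (insert (nat \<bar>2 * a\<bar>) Qs)"
  define S2 where "S2 = max (max S0 S1) (max 3 (T * Sm))"
  have Cv1: "Cv \<ge> 1"
  proof -
    have "a^2 \<ge> 1" using a by (simp add: int_one_le_iff_zero_less)
    then show ?thesis unfolding Cv_def by linarith
  qed
  show ?thesis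
  proof (intro exI[of _ "2 * l * (S2 + 1) + 1 + 2 * Sm"] allI impI)
    fix k assume k: "k \<ge> 2 * l * (S2 + 1) + 1 + 2 * Sm"
    \<comment> \<open>The largest \<open>S\<close> with \<open>2 l S \<le> k - 1\<close>, so that
      every distance \<open>l * s\<close> fits on one side of any term.\<close>
    define S where "S = (k - 1) div (2 * l)"
    define X where "X = S div T"
    have "S \<ge> 2 * l * (S2 + 1) div (2 * l)" unfolding S_def using k by (intro div_le_mono) auto
    then have "S \<ge> S2 + 1" using lC by simp
    then have S: "S \<ge> S0" "S \<ge> S1" "S \<ge> 3" "S \<ge> T * Sm" by (auto simp: S2_def)
    have "X \<ge> T * Sm div T" unfolding X_def using S by (intro div_le_mono)
    then have X: "X \<ge> Sm" using T by simp
    have Sm: "nat \<bar>2 * a\<bar> \<le> Sm" "\<And>q. q \<in> Qs \<Longrightarrow> q \<le> Sm" unfolding Sm_def using Qs by auto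
    have k1: "k \<ge> 1" using k by simp
    have "k - 1 < (2 * l) * (S + 1)" unfolding S_def using lC dividend_less_times_div[of "2 * l" "k - 1"] by simp
    then have kS: "k \<le> 2 * l * (S + 1)" by linarith
    have Sk: "2 * (l * S) \<le> k - 1" unfolding S_def using div_times_less_eq_dividend[of "k - 1" "2 * l"] by (simp add: mult_ac)
    have lnS: "ln (real S) \<ge> 1"
    proof -
      have "exp 1 \<le> real S" using exp_le S(3) by linarith
      then show ?thesis using S(3) by (subst ln_ge_iff) auto
    qed
    have "S < T * (X + 1)" unfolding X_def using T by (simp add: dividend_less_times_div)
    define A where "A = Pool S"
    have A_ne: "card A \<noteq> 0"
    proof
      assume "card A = 0"
      then have "c0 * real S \<le> 0" using Pool_card[OF S(1)] by (simp add: A_def)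
      then show False using T S(3) by (simp add: mult_le_0_iff)
    qed
    then have A_fin: "finite A" by (intro card_ge_0_finite) simp
    have A_good: "good p" "p > X" if "p \<in> A" for p
      using that X Sm(1) by (auto simp: A_def Pool_def X_def intro!: good_large)
    \<comment> \<open>Twice the midpoint of \<open>{1..k}\<close>; the reflection of the block is
      \<open>i\<close> to \<open>t - i\<close>.\<close>
    define t where "t = int k + 1"
    define n0 where "n0 p = (SOME n. int p dvd 2 * a * n + b + a * t)" for p :: nat
    have n0: "int p dvd 2 * a * n0 p + b + a * t" if "good p" for p
      unfolding n0_def by (rule someI_ex[OF center[OF that]])
    \<comment> \<open>What \<open>p\<close> covers in its central position, and what others have to
      take over when \<open>p\<close> is moved elsewhere.\<close>
    define hits where "hits p = {i\<in>{1..k}. int p dvd poly f (n0 p + int i)}" for p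
    have hits_card: "finite (hits p) \<and> card (hits p) \<le> card Qs" if p: "p \<in> A" for p
    proof (cases "hits p = {}")
      case False
      then obtain i0 where i0: "i0 \<in> hits p" by blast
      have gp: "good p" "prime p" using A_good[OF p] by (auto simp: good_def)
      have v0: "int p dvd v (2 * int i0 - t)" using i0 shift[OF gp(1) n0[OF gp(1)]] by (simp add: hits_def)
      have "i mod p \<in> {i0 mod p, nat ((t - int i0) mod int p)}" if i: "i \<in> hits p" for i
      proof -
        have "int p dvd v (2 * int i - t)" using i shift[OF gp(1) n0[OF gp(1)]] by (simp add: hits_def)
        then have "int p dvd v (2 * int i - t) - v (2 * int i0 - t)" using v0 by (rule dvd_diff)
        also have "\<dots> = (2 * a) * ((2 * a) * ((int i - int i0) * (int i - (t - int i0))))"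
          unfolding v_def by (simp add: power2_eq_square algebra_simps)
        finally have "int p dvd (int i - int i0) * (int i - (t - int i0))"
          using good_cancel[OF gp(1)] by blast
        then have "int p dvd int i - int i0 \<or> int p dvd int i - (t - int i0)"
          using gp(2) by (simp add: prime_dvd_mult_iff)
        then have "int i mod int p = int i0 mod int p \<or> int i mod int p = (t - int i0) mod int p"
          by (simp add: mod_eq_dvd_iff)
        then have "int (i mod p) = int (i0 mod p) \<or> nat (int (i mod p)) = nat ((t - int i0) mod int p)"
          by (auto simp: zmod_int)
        then show ?thesis by auto
      qed
      then have "real (card (hits p)) \<le> real 2 * (real k / real p + 1)"
        using gp by (intro card_le_residues[where R = "{i0 mod p, nat ((t - int i0) mod int p)}"])
          (auto simp: prime_gt_0_nat card_insert_if hits_def)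
      also have "\<dots> \<le> real 2 * (real (2 * l * T) + 1)"
      proof -
        have "2 * l * (S + 1) \<le> 2 * l * (T * (X + 1))"
          using \<open>S < T * (X + 1)\<close> by (intro mult_le_mono2) simp
        with kS have "k \<le> 2 * l * (T * (X + 1))" by (rule le_trans)
        also have "\<dots> \<le> 2 * l * (T * p)" using A_good(2)[OF p] by (intro mult_le_mono2) simp
        also have "\<dots> = 2 * l * T * p" by simp
        finally have "real k \<le> real (2 * l * T) * real p" by (metis of_nat_le_iff of_nat_mult)
        then have "real k / real p \<le> real (2 * l * T)" using gp(2) by (simp add: divide_le_eq prime_gt_0_nat)
        then show ?thesis by simp
      qed
      also have "\<dots> = real J" by (simp add: J_def)
      finally show ?thesis using Qs(2) by (simp add: hits_def)
    qed simp
    have "\<exists>c A'. A' \<subseteq> A \<and> card A \<le> card A' * \<Prod>Qs \<and>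
        (\<forall>p\<in>A'. \<forall>i\<in>hits p. \<exists>q\<in>Qs. int q dvd poly f (c q + int i))"
      by (rule clear_hits[OF Qs(1) Qs_root A_fin hits_card])
    then obtain cQ A' where "A' \<subseteq> A \<and> card A \<le> card A' * \<Prod>Qs \<and>
        (\<forall>p\<in>A'. \<forall>i\<in>hits p. \<exists>q\<in>Qs. int q dvd poly f (cQ q + int i))"
      by (elim exE) (rule that)
    then have A': "A' \<subseteq> A" "card A \<le> card A' * \<Prod>Qs"
        "\<forall>p\<in>A'. \<forall>i\<in>hits p. \<exists>q\<in>Qs. int q dvd poly f (cQ q + int i)"
      by simp_all
    have A'_fin: "finite A'" using A'(1) A_fin by (rule finite_subset)
    define N where "N = Cv * k ^ 2"
    define V where "V i = v (2 * int i - t)" for i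
    have N0: "N > 0" using Cv1 k1 by (simp add: N_def)
    have V_le: "nat \<bar>V i\<bar> \<le> N" if i: "i \<in> {1..k}" for i
    proof -
      have "\<bar>2 * int i - t\<bar> \<le> \<bar>int k\<bar>" using i by (auto simp: t_def)
      then have "(2 * int i - t)^2 \<le> (int k)^2" by (simp only: abs_le_square_iff)
      then have "a^2 * (2 * int i - t)^2 \<le> a^2 * (int k)^2" by (intro mult_left_mono) auto
      moreover have "\<bar>D\<bar> * 1 \<le> \<bar>D\<bar> * (int k)^2" using k1 by (intro mult_left_mono) (auto simp: self_le_power)
      moreover have "\<bar>V i\<bar> \<le> a^2 * (2 * int i - t)^2 + \<bar>D\<bar>"
      proof -
        have "a^2 * (2 * int i - t)^2 \<ge> 0" by simp
        then show ?thesis unfolding V_def v_def by linarith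
      qed
      ultimately have "\<bar>V i\<bar> \<le> (a^2 + \<bar>D\<bar>) * (int k)^2" by (simp add: algebra_simps)
      then show ?thesis unfolding N_def Cv_def by (simp add: nat_le_iff)
    qed
    define Smooth where "Smooth = {n. 0 < n \<and> n \<le> N \<and> prime_factors n \<subseteq> Z}"
    \<comment> \<open>The exceptional terms: the midpoint, which is its own mirror image, and those
      with \<open>V i\<close> zero or composed of bad primes only. Values \<open>1\<close> and
      \<open>-1\<close> count as such, having no prime factor at all.\<close>
    define E where "E = {i\<in>{1..k}. 2 * int i = t \<or> nat \<bar>V i\<bar> \<in> insert 0 Smooth}"
    have E_fin: "finite E" by (simp add: E_def)
    have Smooth: "finite Smooth" "real (card Smooth) \<le> (log 2 (real N) + 1) ^ z"
      using card_smooth_le[OF Zfin Zp N0] by (simp_all add: Smooth_def z_def)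
    have E_card: "real (card E) \<le> 5 + 4 * (log 2 (real N) + 1) ^ z"
    proof -
      define E1 where "E1 = {i\<in>{1..k}. nat \<bar>V i\<bar> \<in> insert 0 Smooth}"
      \<comment> \<open>The absolute value and sign of \<open>V i\<close> and the side of the
        midpoint determine \<open>i\<close>; hence the factor 4.\<close>
      define g where "g i = (nat \<bar>V i\<bar>, V i > 0, 2 * int i > t)" for i
      have "inj_on g E1"
      proof (rule inj_onI)
        fix i j assume ij: "g i = g j"
        then have "V i = V j" by (auto simp: g_def)
        then have "a^2 * ((2 * int i - t)^2 - (2 * int j - t)^2) = 0"
          by (simp add: V_def v_def algebra_simps)
        then have "(2 * int i - t)^2 = (2 * int j - t)^2" using a by simp
        then have "\<bar>2 * int i - t\<bar> = \<bar>2 * int j - t\<bar>" by (simp add: power2_eq_iff abs_eq_iff)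
        moreover have "(2 * int i > t) = (2 * int j > t)" using ij by (simp add: g_def)
        ultimately show "i = j" by (auto simp: abs_if split: if_splits)
      qed
      moreover have "g ` E1 \<subseteq> insert 0 Smooth \<times> UNIV" by (auto simp: E1_def g_def)
      ultimately have "card E1 \<le> card (insert 0 Smooth \<times> (UNIV :: (bool \<times> bool) set))"
        using Smooth(1) by (intro card_inj_on_le) auto
      also have "\<dots> \<le> (card Smooth + 1) * 4"
        using Smooth(1) by (simp add: card_cartesian_product card_insert_if card_UNIV_bool flip: UNIV_Times_UNIV)
      finally have "card E1 \<le> (card Smooth + 1) * 4" .
      then have "card E \<le> 5 + 4 * card Smooth" if "card E \<le> card E1 + 1" using that by simp
      moreover have "card E \<le> card E1 + 1"
      proof -
        have "card E \<le> card (insert (nat (t div 2)) E1)"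
          by (intro card_mono) (auto simp: E_def E1_def)
        also have "\<dots> \<le> card E1 + 1" by (simp add: card_insert_if E1_def)
        finally show ?thesis .
      qed
      ultimately have "card E \<le> 5 + 4 * card Smooth" by blast
      then have "real (card E) \<le> real (5 + 4 * card Smooth)" by (rule of_nat_mono)
      then have "real (card E) \<le> 5 + 4 * real (card Smooth)" by simp
      then show ?thesis using Smooth(2) by linarith
    qed
    have logN: "log 2 (real N) + 1 \<le> C4 * ln (real S)"
    proof -
      have "k \<le> 4 * l * S"
      proof -
        have "2 * l * (S + 1) \<le> 2 * l * (2 * S)" using S(3) by (intro mult_le_mono2) auto
        also have "\<dots> = 4 * l * S" by simp
        finally show ?thesis by (rule le_trans[OF kS])
      qed
      then have "N \<le> Cv * (4 * l * S) ^ 2" unfolding N_def by (intro mult_left_mono power_mono) auto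
      then have "real N \<le> real (Cv * (4 * l * S) ^ 2)" by (rule of_nat_mono)
      also have "\<dots> = (real Cv * 16 * real l ^ 2) * real S ^ 2" by (simp add: power_mult_distrib)
      finally have NS: "real N \<le> (real Cv * 16 * real l ^ 2) * real S ^ 2" .
      have c1: "real Cv * 16 * real l ^ 2 \<ge> 1"
      proof -
        have "1 \<le> Cv * 16 * l ^ 2" using Cv1 lC by (simp add: Suc_le_eq)
        then have "real 1 \<le> real (Cv * 16 * l ^ 2)" by (rule of_nat_mono)
        then show ?thesis by simp
      qed
      have "ln (real N) \<le> ln ((real Cv * 16 * real l ^ 2) * real S ^ 2)"
        using NS N0 c1 S(3) by (subst ln_le_cancel_iff) (auto simp only: of_nat_0_less_iff intro!: mult_pos_pos[of "_ * _ * _"])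
      also have "\<dots> = ln (real Cv * 16 * real l ^ 2) + 2 * ln (real S)"
        using c1 S(3) by (subst ln_mult_pos) (simp_all only: ln_realpow, simp_all)
      also have "\<dots> \<le> ln (real Cv * 16 * real l ^ 2) * ln (real S) + 2 * ln (real S)"
        using mult_left_mono[OF lnS, of "ln (real Cv * 16 * real l ^ 2)"] c1 by simp
      finally have "ln (real N) / ln 2 \<le> (ln (real Cv * 16 * real l ^ 2) + 2) * ln (real S) / ln 2"
        by (intro divide_right_mono) (auto simp: algebra_simps)
      then have "log 2 (real N) + 1 \<le> (ln (real Cv * 16 * real l ^ 2) + 2) * ln (real S) / ln 2 + ln (real S)"
        using lnS by (simp add: log_def)
      also have "\<dots> = C4 * ln (real S)" by (simp add: C4_def algebra_simps)
      finally show ?thesis .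
    qed
    have E_le: "card E \<le> card A'"
    proof -
      have "0 \<le> log 2 (real N) + 1" using N0 by (simp add: add_nonneg_nonneg)
      then have "(log 2 (real N) + 1) ^ z \<le> (\<bar>C4\<bar> * ln (real S)) ^ z"
        using logN lnS by (intro power_mono) (auto intro: order_trans[OF logN] mult_right_mono)
      then have "real (card E) \<le> 5 * 1 + 4 * \<bar>C4\<bar> ^ z * ln (real S) ^ z"
        using E_card by (simp add: power_mult_distrib)
      also have "\<dots> \<le> 5 * ln (real S) ^ z + 4 * \<bar>C4\<bar> ^ z * ln (real S) ^ z"
        using lnS by (intro add_mono mult_left_mono one_le_power) auto
      finally have "real (card E) \<le> (5 + 4 * \<bar>C4\<bar> ^ z) * ln (real S) ^ z" by (simp add: algebra_simps)
      then have "real (card E) * ln (real S) * real (\<Prod>Qs) \<le> (5 + 4 * \<bar>C4\<bar> ^ z) * ln (real S) ^ z * ln (real S) * real (\<Prod>Qs)"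
        using lnS by (intro mult_right_mono of_nat_0_le_iff) auto
      also have "\<dots> = c0 * (a1 * ln (real S) ^ (z + 1))" using T by (simp add: a1_def field_simps)
      also have "\<dots> \<le> c0 * real S" using S1[OF S(2)] T by (intro mult_left_mono) auto
      also have "\<dots> \<le> real (card A) * ln (real S)" using Pool_card[OF S(1)] by (simp add: A_def)
      also have "\<dots> \<le> real (card A' * \<Prod>Qs) * ln (real S)"
        using A'(2) lnS by (intro mult_right_mono of_nat_mono) auto
      finally have "real (card E) * (ln (real S) * real (\<Prod>Qs)) \<le> real (card A') * (ln (real S) * real (\<Prod>Qs))"
        by (simp add: mult_ac)
      moreover have "ln (real S) * real (\<Prod>Qs) > 0"
      proof -
        have "\<Prod>Qs > 0" using Qs_root by (intro prod_pos) auto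
        then have "real (\<Prod>Qs) > 0" by (simp only: of_nat_0_less_iff)
        then show ?thesis using lnS by (intro mult_pos_pos) auto
      qed
      ultimately show ?thesis by (simp only: mult_le_cancel_right_pos of_nat_le_iff)
    qed
    have single: "\<exists>n. \<exists>j\<in>{1..k}. j \<noteq> i \<and> int p dvd poly f (n + int i) \<and> int p dvd poly f (n + int j)"
      if i: "i \<in> {1..k}" and p: "p \<in> A'" for i p
    proof -
      obtain s where s: "prime p" "s \<in> {1..S}" "p dvd w s" using p A'(1) by (auto simp: A_def Pool_def)
      define h where "h = l * s"
      have h: "h \<ge> 1" "2 * h \<le> k - 1"
        using s lC Sk by (auto simp: h_def Suc_le_eq intro: le_trans[of _ "2 * (l * S)"])
      have gp: "good p" using A_good A'(1) p by blast
      have vh: "int p dvd v (int h)" using wv[OF s(1,3)] by (simp add: v_def h_def)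
      \<comment> \<open>Since \<open>2 * h \<le> k - 1\<close>, one direction stays in the block.
        The vertex modulo \<open>p\<close> is then moved halfway between \<open>i\<close> and
        \<open>j\<close>, where both arguments give \<open>v h\<close>.\<close>
      define j where "j = (if i + h \<le> k then i + h else i - h)"
      have j: "j \<in> {1..k}" "j \<noteq> i" "\<bar>int i - int j\<bar> = int h"
        using h i by (auto simp: j_def of_nat_diff)
      obtain n where n: "int p dvd 2 * a * n + b + a * (int i + int j)" using center[OF gp] by blast
      have "v (2 * int i - (int i + int j)) = v (int h)" "v (2 * int j - (int i + int j)) = v (int h)"
        using j(3) by (auto simp: v_def abs_if power2_commute algebra_simps split: if_splits)
      then show ?thesis using shift[OF gp n] vh j by metis
    qed
    \<comment> \<open>The primes that remain in the central position; the bound \<open>N\<close> on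
      all \<open>V i\<close> makes the set finite.\<close>
    define Bs where "Bs = {p. good p \<and> p \<le> N} - A' - Qs"
    define cc where "cc p = (if p \<in> Qs then cQ p else n0 p)" for p
    have disj: "p \<notin> Qs" if "p \<in> A'" for p
      using A_good(2)[of p] A'(1) that X Sm(2)[of p] by force
    have cov: "\<exists>p\<in>Qs \<union> Bs. \<exists>j\<in>{1..k}. j \<noteq> i \<and>
        int p dvd poly f (cc p + int i) \<and> int p dvd poly f (cc p + int j)" if iE: "i \<in> {1..k} - E" for i
    proof (cases "\<exists>q\<in>Qs. int q dvd poly f (cQ q + int i)")
      case True
      then obtain q where q: "q \<in> Qs" "int q dvd poly f (cQ q + int i)" by blast
      \<comment> \<open>Roots modulo \<open>q\<close> recur with period \<open>q\<close>, so a
        neighbour at that distance is a partner.\<close>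
      define j where "j = (if i + q \<le> k then i + q else i - q)"
      have "2 * q \<le> k - 1" using Sm(2)[OF q(1)] k by linarith
      then have j: "j \<in> {1..k}" "j \<noteq> i" using iE Qs_root[OF q(1)] by (auto simp: j_def)
      have "int q dvd (cQ q + int j) - (cQ q + int i)" using \<open>2 * q \<le> k - 1\<close> iE by (auto simp: j_def of_nat_diff)
      then have "int q dvd poly f (cQ q + int j)" using q(2) dvd_poly_shift by blast
      then show ?thesis using q j by (intro bexI[of _ q] bexI[of _ j]) (auto simp: cc_def)
    next
      case nq: False
      have i: "i \<in> {1..k}" using iE by simp
      have ne: "2 * int i \<noteq> t" "nat \<bar>V i\<bar> > 0" "nat \<bar>V i\<bar> \<notin> Smooth" using iE by (auto simp: E_def)
      then obtain p where p: "p \<in> prime_factors (nat \<bar>V i\<bar>)" "p \<notin> Z"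
        using V_le[OF i] by (auto simp: Smooth_def)
      then have pp: "prime p" "p dvd nat \<bar>V i\<bar>" by (auto simp: prime_factors_dvd)
      have "int p dvd int (nat \<bar>V i\<bar>)" using pp(2) by (simp only: of_nat_dvd_iff)
      then have pV: "int p dvd V i" by simp
      have "p \<le> N" using pp(2) ne(2) V_le[OF i] by (meson dvd_imp_le le_trans)
      have "\<not> int p dvd 2 * a"
      proof
        assume "int p dvd 2 * a"
        then have "int p dvd int (nat \<bar>2 * a\<bar>)" by simp
        then have "p dvd nat \<bar>2 * a\<bar>" by (simp only: of_nat_dvd_iff)
        then have "p \<in> prime_factors (nat \<bar>2 * a\<bar>)" using pp(1) a by (simp add: prime_factors_dvd)
        then show False using p(2) by (simp add: Z_def)
      qed
      then have gp: "good p" using pp by (simp add: good_def)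
      then have hit: "int p dvd poly f (n0 p + int i)" using pV shift[OF gp n0[OF gp]] by (simp add: V_def)
      define j where "j = k + 1 - i"
      have j: "j \<in> {1..k}" "j \<noteq> i" using i ne(1) by (auto simp: j_def t_def)
      have "2 * int j - t = - (2 * int i - t)" using i by (simp add: j_def t_def of_nat_diff)
      then have "v (2 * int j - t) = V i" by (simp only: V_def v_def power2_minus)
      then have hitj: "int p dvd poly f (n0 p + int j)" using pV shift[OF gp n0[OF gp]] by simp
      have nQ: "p \<notin> Qs" using p(2) by (simp add: Z_def)
      \<comment> \<open>Were \<open>p\<close> spared, \<open>i\<close> would be one of its hits and
        hence covered by \<open>Qs\<close>, contrary to the case assumption.\<close>
      moreover have "p \<notin> A'" using nq A'(3) hit i by (auto simp: hits_def)
      ultimately have "p \<in> Bs" using gp \<open>p \<le> N\<close> by (simp add: Bs_def)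
      then show ?thesis using hit hitj j nQ by (intro bexI[of _ p] bexI[of _ j]) (auto simp: cc_def)
    qed
    have "finite Bs" unfolding Bs_def by (rule finite_subset[of _ "{..N}"]) auto
    then show "coverable [:c, b, a:] (2 * a) k"
      unfolding f_def[symmetric]
    proof (intro coverable_by_spare_primes[where Ps = "Qs \<union> Bs" and c = cc, OF _ A'_fin _ _ _ E_le cov single])
      show "(Qs \<union> Bs) \<inter> A' = {}" using disj by (auto simp: Bs_def)
      show "prime p \<and> \<not> int p dvd 2 * a" if "p \<in> (Qs \<union> Bs) \<union> A'" for p
        using that Qs_good A_good A'(1) by (auto simp: Bs_def good_def)
    qed (use Qs(1) in \<open>auto simp: E_def\<close>)
  qed
qed

section \<open>The norm form of a cubic\<close>

text \<open>Lagrange's theorem, by synthetic division over the integers: the quotient keeps the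
  leading coefficient, and primality sends every other root to the quotient.\<close>

lemma card_roots_mod_prime:
  fixes g :: "int poly" and p :: int
  assumes "prime p" "\<not> p dvd lead_coeff g" "finite A"
    and "\<And>x. x \<in> A \<Longrightarrow> p dvd poly g x" and "\<And>x y. x \<in> A \<Longrightarrow> y \<in> A \<Longrightarrow> p dvd x - y \<Longrightarrow> x = y"
  shows "card A \<le> degree g"
  using assms
proof (induction "degree g" arbitrary: g A)
  case 0
  then obtain a where g: "g = [:a:]" by (metis degree_eq_zeroE)
  have "A = {}" using 0 g by auto
  then show ?case by simp
next
  case (Suc n)
  show ?case
  proof (cases "A = {}")
    case False
    then obtain a where a: "a \<in> A" by blast
    define h where "h = synthetic_div g a"
    have g: "g = [:-a, 1:] * h + [:poly g a:]" unfolding h_def by (rule synthetic_div_correct'[symmetric])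
    have dh: "degree h = n" using Suc(2) by (simp add: h_def degree_synthetic_div)
    have lc: "lead_coeff h = lead_coeff g"
    proof -
      have "lead_coeff g = coeff g (Suc n)" using Suc(2) by simp
      also have "\<dots> = coeff ([:-a, 1:] * h) (Suc n)" by (subst g) simp
      also have "\<dots> = coeff h n" using dh by (simp add: coeff_eq_0)
      finally show ?thesis using dh by simp
    qed
    have "card (A - {a}) \<le> degree h"
    proof (rule Suc(1))
      fix x assume x: "x \<in> A - {a}"
      have "poly g x = (x - a) * poly h x + poly g a" by (subst g) (simp add: algebra_simps)
      then have "p dvd (x - a) * poly h x" using Suc(6)[of x] Suc(6)[OF a] x
        by (metis DiffD1 dvd_add_left_iff)
      moreover have "\<not> p dvd x - a" using Suc(7)[of x a] x a by auto
      ultimately show "p dvd poly h x" using Suc(3) by (simp add: prime_dvd_mult_iff)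
    qed (use Suc dh lc in auto)
    moreover have "card A = Suc (card (A - {a}))" using card.remove[OF Suc(5) a] .
    ultimately show ?thesis using dh Suc(2) by simp
  qed simp
qed

text \<open>The depressed monic shape: for \<open>f\<close> with leading coefficients
  \<open>a\<close>, \<open>b\<close>, the polynomial \<open>27 a^2 f(x)\<close> is of this form in
  the variable \<open>3 a x + b\<close>.\<close>

definition cubic :: "int \<Rightarrow> int \<Rightarrow> int \<Rightarrow> int" where
  "cubic P Q x = x^3 + P * x + Q"

text \<open>The norm of \<open>u + v \<theta> + w \<theta>\<^sup>2\<close> where \<open>\<theta>\<close> is a root of the cubic.\<close>
definition norm_form :: "int \<Rightarrow> int \<Rightarrow> int \<Rightarrow> int \<Rightarrow> int \<Rightarrow> int" where
  "norm_form P Q u v w = u^3 - 2 * u^2 * w * P + u * v^2 * P + 3 * u * v * w * Q + u * w^2 * P^2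
     - v^3 * Q - v * w^2 * P * Q + w^3 * Q^2"

text \<open>Modulo a root \<open>r\<close> the cubic is
  \<open>(X - r) (X^2 + r X + r^2 + P)\<close>. The norm becomes the value at \<open>r\<close> times
  the norm of the remainder \<open>(u - w (r^2 + P)) + (v - w r) X\<close> modulo the quadratic
  factor.\<close>

lemma norm_form_at_root:
  "norm_form P Q u v w = (u + v * r + w * r^2) *
     ((u - w * (r^2 + P))^2 - r * (v - w * r) * (u - w * (r^2 + P)) + (v - w * r)^2 * (r^2 + P))
   + cubic P Q r * (3 * u * v * w - v^3 - v * w^2 * P - w^3 * P * r + w^3 * Q - w^3 * r^3)"
  unfolding norm_form_def cubic_def by algebra

text \<open>The norm is the determinant of multiplication by the element. Replacing the first two
  columns by their values at \<open>r\<close> and \<open>s\<close> multiplies it by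
  \<open>s - r\<close>; the \<open>x\<close> and \<open>y\<close> are these values for the element
  times 1, \<theta> and \<open>\<theta>^2\<close>, and each product on the right pairs an
  \<open>x\<close> with a \<open>y\<close>.\<close>

lemma norm_form_two_roots:
  fixes P Q u v w r s :: int
  defines "x1 \<equiv> u + v * r + w * r^2" and "y1 \<equiv> u + v * s + w * s^2"
  defines "x2 \<equiv> r * x1 - w * cubic P Q r" and "y2 \<equiv> s * y1 - w * cubic P Q s"
    and "x3 \<equiv> r^2 * x1 - (v + w * r) * cubic P Q r" and "y3 \<equiv> s^2 * y1 - (v + w * s) * cubic P Q s"
  shows "(s - r) * norm_form P Q u v w =
    w * (x2 * y3 - x3 * y2) - v * (x1 * y3 - x3 * y1) + (u - w * P) * (x1 * y2 - x2 * y1)"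
  unfolding assms norm_form_def cubic_def by algebra

text \<open>Multiplicativity of the norm for the factor \<open>- v + w \<theta>\<close>, chosen
  because it cancels the \<open>\<theta>^2\<close> term. The norm of the resulting linear element is
  a binary cubic form.\<close>

lemma norm_form_mult_linear:
  "norm_form P Q u v w * norm_form P Q (- v) w 0 =
   norm_form P Q (- (u * v + w^2 * Q)) (w * u - v^2 - w^2 * P) 0"
  unfolding norm_form_def by (simp add: power2_eq_square power3_eq_cube algebra_simps)

lemma dvd_norm_form_root:
  assumes "m dvd cubic P Q r" "m dvd u + v * r + w * r^2"
  shows "m dvd norm_form P Q u v w"
  unfolding norm_form_at_root[of P Q u v w r] using assms by (simp add: dvd_add dvd_mult2)

lemma dvd_norm_form_quadratic:
  assumes "m dvd cubic P Q r" "m dvd v - w * r" "m dvd u - w * (r^2 + P)"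
  shows "m dvd norm_form P Q u v w"
proof -
  have "m dvd (u - w * (r^2 + P))^2 - r * (v - w * r) * (u - w * (r^2 + P)) + (v - w * r)^2 * (r^2 + P)"
    using assms by (simp add: power2_eq_square)
  then show ?thesis unfolding norm_form_at_root[of P Q u v w r] using assms(1)
    by (metis dvd_add dvd_mult dvd_mult2)
qed

text \<open>Two roots stand for two prime ideals of norm \<open>p\<close> containing the element. In
  the determinant identity every product pairs multiples of \<open>p\<close>, and
  \<open>s - r\<close> is invertible.\<close>

lemma square_dvd_norm_form:
  fixes p :: nat
  assumes p: "prime p" and r: "int p dvd cubic P Q r" "int p dvd u + v * r + w * r^2"
    and s: "int p dvd cubic P Q s" "int p dvd u + v * s + w * s^2" and "\<not> int p dvd s - r"
  shows "int p ^ 2 dvd norm_form P Q u v w"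
proof -
  have m: "int p ^ 2 dvd a * b" if "int p dvd a" "int p dvd b" for a b
    using mult_dvd_mono[OF that] by (simp add: power2_eq_square)
  have d: "int p dvd r * (u + v * r + w * r^2) - w * cubic P Q r"
    "int p dvd r^2 * (u + v * r + w * r^2) - (v + w * r) * cubic P Q r"
    "int p dvd s * (u + v * s + w * s^2) - w * cubic P Q s"
    "int p dvd s^2 * (u + v * s + w * s^2) - (v + w * s) * cubic P Q s"
    using r s by (simp_all add: dvd_diff dvd_mult)
  have "int p ^ 2 dvd (s - r) * norm_form P Q u v w"
    unfolding norm_form_two_roots
    by (rule dvd_add[OF dvd_diff]; rule dvd_mult; rule dvd_diff; rule m) (rule r s d)+
  moreover have "coprime (int p ^ 2) (s - r)"
    using assms prime_imp_power_coprime[of "int p" "s - r" 2] by (simp add: coprime_commute)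
  ultimately show ?thesis using coprime_dvd_mult_right_iff by blast
qed

text \<open>Used with \<open>m\<close> a prime and with \<open>m = 0\<close>.\<close>
lemma norm_form_anisotropic:
  fixes m :: int
  assumes prime: "\<And>x y. m dvd x * y \<Longrightarrow> m dvd x \<or> m dvd y"
    and noroot: "\<And>x y. m dvd x^3 + P * x * y^2 + Q * y^3 \<Longrightarrow> m dvd y"
    and N: "m dvd norm_form P Q u v w"
  shows "m dvd u \<and> m dvd v \<and> m dvd w"
proof -
  have cube: "m dvd x" if "m dvd x^3" for x
    using that prime by (metis power3_eq_cube)
  have form: "m dvd x \<and> m dvd y" if "m dvd x^3 + P * x * y^2 + Q * y^3" for x y
  proof -
    have y: "m dvd y" by (rule noroot[OF that])
    have "m dvd P * x * y^2 + Q * y^3" using y by (simp add: power2_eq_square power3_eq_cube)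
    then have "m dvd x^3" using that by (metis add.assoc dvd_add_left_iff)
    then show ?thesis using y cube by blast
  qed
  \<comment> \<open>Passing to a linear element turns the hypothesis into a statement on the binary
    cubic form, so both coefficients of that element are divisible by \<open>m\<close>.\<close>
  have "m dvd norm_form P Q (- (u * v + w^2 * Q)) (w * u - v^2 - w^2 * P) 0"
    unfolding norm_form_mult_linear[symmetric] using N by (rule dvd_mult2)
  also have "norm_form P Q (- (u * v + w^2 * Q)) (w * u - v^2 - w^2 * P) 0 =
     (- (u * v + w^2 * Q))^3 + P * (- (u * v + w^2 * Q)) * (- (w * u - v^2 - w^2 * P))^2 + Q * (- (w * u - v^2 - w^2 * P))^3"
    unfolding norm_form_def by (simp add: power2_eq_square power3_eq_cube algebra_simps)
  finally have st: "m dvd u * v + w^2 * Q" "m dvd w * u - v^2 - w^2 * P"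
    using form by (metis dvd_minus_iff)+
  \<comment> \<open>Eliminating \<open>u\<close> from the two divisibilities gives a second value of
    the binary form, now at \<open>v\<close> and \<open>w\<close>.\<close>
  have "v^3 + P * v * w^2 + Q * w^3 = w * (u * v + w^2 * Q) - v * (w * u - v^2 - w^2 * P)" by algebra
  then have "m dvd v^3 + P * v * w^2 + Q * w^3" using st by (simp add: dvd_diff)
  then have vw: "m dvd v" "m dvd w" using form by blast+
  have "u^3 = norm_form P Q u v w - (v * (u * v * P + 3 * u * w * Q - v^2 * Q - w^2 * P * Q)
     + w * (- 2 * u^2 * P + u * w * P^2 + w^2 * Q^2))" unfolding norm_form_def by algebra
  then have "m dvd u^3" using N vw by (metis dvd_add dvd_diff dvd_mult2)
  then show ?thesis using vw cube by blast
qed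

text \<open>By anisotropy a prime dividing the norm of an element not divisible by it must have a
  root \<open>r\<close>. The alternatives correspond to a prime ideal of degree one containing the
  element, or to the complementary ideal given by \<open>X^2 + r X + r^2 + P\<close>.\<close>

lemma norm_form_prime_dvd_cases:
  fixes p :: nat
  assumes p: "prime p" and N: "int p dvd norm_form P Q u v w"
    and ndvd: "\<not> (int p dvd u \<and> int p dvd v \<and> int p dvd w)"
  shows "\<exists>r. int p dvd cubic P Q r \<and> (int p dvd u + v * r + w * r^2 \<or>
    (int p dvd v - w * r \<and> int p dvd u - w * (r^2 + P)))"
proof -
  have pi: "prime (int p)" using p by simp
  obtain x y where xy: "int p dvd x^3 + P * x * y^2 + Q * y^3" "\<not> int p dvd y"
    using norm_form_anisotropic[of "int p" P Q u v w] N ndvd prime_dvd_multD[OF pi] by blast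
  obtain r where r: "int p dvd y * r + - x" using prime_linear_solution[OF p xy(2)] by blast
  have "y^3 * cubic P Q r = (y * r + - x) * (y^2 * r^2 + y * r * x + x^2 + P * y^2) + (x^3 + P * x * y^2 + Q * y^3)"
    unfolding cubic_def by algebra
  then have "int p dvd y^3 * cubic P Q r" using r xy(1) by (metis dvd_add dvd_mult2)
  then have F: "int p dvd cubic P Q r" using xy(2) pi by (metis prime_dvd_multD prime_dvd_power)
  define e where "e = v - w * r"
  define g where "g = u - w * (r^2 + P)"
  show ?thesis
  proof (cases "int p dvd u + v * r + w * r^2")
    case False
    have "int p dvd (u + v * r + w * r^2) * (g^2 - r * e * g + e^2 * (r^2 + P))"
      using N F unfolding norm_form_at_root[of P Q u v w r] e_def g_def
      by (metis dvd_add_left_iff dvd_mult2)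
    then have q: "int p dvd g^2 - r * e * g + e^2 * (r^2 + P)" using False pi prime_dvd_multD by blast
    show ?thesis
    proof (cases "int p dvd e")
      case True
      then have "int p dvd r * e * g - e^2 * (r^2 + P)" by (simp add: power2_eq_square)
      then have "int p dvd (r * e * g - e^2 * (r^2 + P)) + (g^2 - r * e * g + e^2 * (r^2 + P))"
        using q by (rule dvd_add)
      then have "int p dvd g^2" by simp
      then have "int p dvd g" using pi prime_dvd_power by blast
      then show ?thesis using F True unfolding e_def g_def by blast
    next
      case e: False
      \<comment> \<open>\<open>s\<close> is the zero of the remainder \<open>e X + g\<close>. The
        vanishing of its norm makes \<open>s\<close> a root of the quadratic factor, hence another
        root of the cubic, to which the first alternative applies.\<close>
      obtain s where s: "int p dvd e * s + g" using prime_linear_solution[OF p e] by blast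
      have "e^2 * (s^2 + r * s + r^2 + P) = (e * s + g) * (e * s - g + r * e) + (g^2 - r * e * g + e^2 * (r^2 + P))"
        by algebra
      then have "int p dvd e^2 * (s^2 + r * s + r^2 + P)" using s q by (metis dvd_add dvd_mult2)
      then have E: "int p dvd s^2 + r * s + r^2 + P" using e pi by (metis prime_dvd_multD prime_dvd_power)
      have "cubic P Q s = (s - r) * (s^2 + r * s + r^2 + P) + cubic P Q r" unfolding cubic_def by algebra
      then have Fs: "int p dvd cubic P Q s" using E F by (metis dvd_add dvd_mult)
      have "u + v * s + w * s^2 = w * (s^2 + r * s + r^2 + P) + (e * s + g)" unfolding e_def g_def by algebra
      then have "int p dvd u + v * s + w * s^2" using E s by (metis dvd_add dvd_mult)
      then show ?thesis using Fs by blast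
    qed
  qed (use F in blast)
qed

text \<open>11 is the sum of the absolute values of the numerical coefficients of the eight
  monomials; each coefficient in \<open>P\<close> and \<open>Q\<close> is at most
  \<open>(1 + |P| + |Q|)^2\<close>.\<close>

lemma norm_form_upper:
  assumes "\<bar>u\<bar> \<le> B" "\<bar>v\<bar> \<le> B" "\<bar>w\<bar> \<le> B"
  shows "\<bar>norm_form P Q u v w\<bar> \<le> 11 * (1 + \<bar>P\<bar> + \<bar>Q\<bar>)^2 * B^3"
proof -
  define K where "K = 1 + \<bar>P\<bar> + \<bar>Q\<bar>"
  have B: "B \<ge> 0" using assms by linarith
  have K: "1 \<le> K" "\<bar>P\<bar> \<le> K" "\<bar>Q\<bar> \<le> K" unfolding K_def by auto
  have K2: "1 \<le> K^2" "\<bar>P\<bar> \<le> K^2" "\<bar>Q\<bar> \<le> K^2" "\<bar>P\<bar> * \<bar>P\<bar> \<le> K^2" "\<bar>P\<bar> * \<bar>Q\<bar> \<le> K^2" "\<bar>Q\<bar> * \<bar>Q\<bar> \<le> K^2"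
  proof -
    have KK: "K \<le> K^2" using K by (simp add: self_le_power)
    show "1 \<le> K^2" "\<bar>P\<bar> \<le> K^2" "\<bar>Q\<bar> \<le> K^2" using K by (auto intro: order_trans[OF _ KK])
    show "\<bar>P\<bar> * \<bar>P\<bar> \<le> K^2" "\<bar>P\<bar> * \<bar>Q\<bar> \<le> K^2" "\<bar>Q\<bar> * \<bar>Q\<bar> \<le> K^2"
      unfolding power2_eq_square using K by (intro mult_mono; simp)+
  qed
  have mono: "\<bar>x * y * z * k\<bar> \<le> K^2 * B^3" if "\<bar>x\<bar> \<le> B" "\<bar>y\<bar> \<le> B" "\<bar>z\<bar> \<le> B" "\<bar>k\<bar> \<le> K^2" for x y z k
  proof -
    have "\<bar>x\<bar> * \<bar>y\<bar> * \<bar>z\<bar> * \<bar>k\<bar> \<le> B * B * B * K^2"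
      using that B by (intro mult_mono mult_nonneg_nonneg abs_ge_zero)
    then show ?thesis by (simp add: abs_mult power3_eq_cube mult_ac)
  qed
  have eq: "norm_form P Q u v w = u * u * u * 1 - 2 * (u * u * w * P) + u * v * v * P + 3 * (u * v * w * Q) +
     u * w * w * (P * P) - v * v * v * Q - v * w * w * (P * Q) + w * w * w * (Q * Q)"
    unfolding norm_form_def by (simp add: power2_eq_square power3_eq_cube algebra_simps)
  have tri: "\<bar>a - 2 * b + c + 3 * d + e - f - g + h\<bar> \<le> 11 * M"
    if "\<bar>a\<bar> \<le> M" "\<bar>b\<bar> \<le> M" "\<bar>c\<bar> \<le> M" "\<bar>d\<bar> \<le> M" "\<bar>e\<bar> \<le> M" "\<bar>f\<bar> \<le> M" "\<bar>g\<bar> \<le> M" "\<bar>h\<bar> \<le> M"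
    for a b c d e f g h M :: int
    using that unfolding abs_le_iff by linarith
  have "\<bar>norm_form P Q u v w\<bar> \<le> 11 * (K^2 * B^3)"
    unfolding eq using assms K2 by (intro tri mono) (simp_all only: abs_mult abs_1)
  then show ?thesis unfolding K_def by (simp add: mult.assoc)
qed

lemma norm_form_scale: "norm_form P Q (k * u) (k * v) (k * w) = k^3 * norm_form P Q u v w"
  unfolding norm_form_def by (simp add: power2_eq_square power3_eq_cube algebra_simps)

section \<open>Lattice points with norm divisible by a given prime\<close>

definition cubic_roots :: "int \<Rightarrow> int \<Rightarrow> nat \<Rightarrow> int set" where
  "cubic_roots P Q p = {r\<in>{0..<int p}. int p dvd cubic P Q r}"

lemma finite_cubic_roots [simp]: "finite (cubic_roots P Q p)"
  by (rule finite_subset[of _ "{0..<int p}"]) (auto simp: cubic_roots_def)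

lemma poly_cubic: "poly [:Q, P, 0, 1:] x = cubic P Q x"
  by (simp add: cubic_def power3_eq_cube algebra_simps)

lemma card_cubic_roots:
  assumes "prime p"
  shows "card (cubic_roots P Q p) \<le> 3"
proof -
  have "card (cubic_roots P Q p) \<le> degree [:Q, P, 0, 1:]"
  proof (rule card_roots_mod_prime[of "int p"])
    fix x y assume "x \<in> cubic_roots P Q p" "y \<in> cubic_roots P Q p" "int p dvd x - y"
    then have "x mod int p = y mod int p" "x mod int p = x" "y mod int p = y"
      by (simp_all only: mod_eq_dvd_iff) (simp_all add: cubic_roots_def)
    then show "x = y" by simp
  next
    show "finite (cubic_roots P Q p)" by (rule finite_cubic_roots)
    show "\<not> int p dvd lead_coeff [:Q, P, 0, 1:]" using prime_gt_1_nat[OF assms] by auto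
    show "prime (int p)" using assms by simp
    show "int p dvd poly [:Q, P, 0, 1:] x" if "x \<in> cubic_roots P Q p" for x
      unfolding poly_cubic using that by (simp add: cubic_roots_def)
  qed
  then show ?thesis by simp
qed

lemma cubic_root_mod:
  assumes "prime p" "int p dvd cubic P Q r"
  shows "r mod int p \<in> cubic_roots P Q p"
proof -
  have "int p dvd r mod int p - r" by (simp add: mod_eq_dvd_iff[symmetric])
  then have "int p dvd poly [:Q, P, 0, 1:] (r mod int p)"
    by (rule dvd_poly_shift) (use assms in \<open>simp add: poly_cubic del: poly_pCons\<close>)
  then show ?thesis using prime_gt_0_nat[OF assms(1)] by (simp add: cubic_roots_def poly_cubic del: poly_pCons)
qed

definition root_primes :: "int \<Rightarrow> int \<Rightarrow> nat set" where
  "root_primes P Q = {p. prime p \<and> (\<exists>r. int p dvd cubic P Q r)}"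

definition norm_bound :: "int \<Rightarrow> int \<Rightarrow> nat" where
  "norm_bound P Q = nat (11 * (1 + \<bar>P\<bar> + \<bar>Q\<bar>)^2)"

lemma norm_bound_pos: "norm_bound P Q \<ge> 1"
proof -
  have "0 < 1 + \<bar>P\<bar> + \<bar>Q\<bar>" by linarith
  then have "0 < 11 * (1 + \<bar>P\<bar> + \<bar>Q\<bar>)^2" by (intro mult_pos_pos zero_less_power) simp_all
  then have "0 < norm_bound P Q" unfolding norm_bound_def by (simp only: zero_less_nat_eq)
  then show ?thesis by (simp only: One_nat_def Suc_le_eq)
qed

lemma norm_form_le_norm_bound:
  assumes "\<bar>u\<bar> \<le> int b" "\<bar>v\<bar> \<le> int b" "\<bar>w\<bar> \<le> int b"
  shows "nat \<bar>norm_form P Q u v w\<bar> \<le> norm_bound P Q * b^3"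
proof -
  have "\<bar>norm_form P Q u v w\<bar> \<le> int (norm_bound P Q) * int b^3"
    using norm_form_upper[OF assms, of P Q] by (simp add: norm_bound_def)
  then show ?thesis by (metis nat_le_iff of_nat_mult of_nat_power)
qed

lemma sum_telescope_le:
  assumes "z \<ge> 1"
  shows "(\<Sum>n\<in>{z<..m}. 1 / (real n * (real n - 1))) \<le> 1 / real z"
proof (cases "z \<le> m")
  case True
  have "(\<Sum>n\<in>{z<..m}. 1 / (real n * (real n - 1))) = 1 / real z - 1 / real m"
    using True
  proof (induction m rule: dec_induct)
    case (step n)
    have "{z<..Suc n} = insert (Suc n) {z<..n}" using step by auto
    then have "(\<Sum>n\<in>{z<..Suc n}. 1 / (real n * (real n - 1))) =
       1 / (real (Suc n) * real n) + (1 / real z - 1 / real n)"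
      using step by simp
    also have "1 / (real (Suc n) * real n) = 1 / real n - 1 / real (Suc n)"
      using step assms by (simp add: field_simps)
    finally show ?case by simp
  qed simp
  then show ?thesis by simp
qed simp

text \<open>At most one point per cell of side \<open>e\<close>. The summand 1 serves the case
  \<open>e > B\<close>, where there is a single cell.\<close>

lemma card_le_cells:
  fixes S :: "(nat \<times> nat \<times> nat) set" and B e :: nat
  assumes S: "S \<subseteq> {..<B} \<times> {..<B} \<times> {..<B}" and e: "e \<ge> 1"
    and inj: "inj_on (\<lambda>(u, v, w). (u div e, v div e, w div e)) S"
  shows "real (card S) \<le> 8 * real B ^ 3 / real e ^ 3 + 1"
proof (cases "e \<le> B")
  case True
  have "(\<lambda>(u, v, w). (u div e, v div e, w div e)) ` S \<subseteq> {..B div e} \<times> {..B div e} \<times> {..B div e}"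
    using S by (auto intro!: div_le_mono)
  then have "card S \<le> card ({..B div e} \<times> {..B div e} \<times> {..B div e})"
    using inj by (intro card_inj_on_le) auto
  also have "\<dots> = (B div e + 1)^3" by (simp add: card_cartesian_product power3_eq_cube)
  finally have "real (card S) \<le> real ((B div e + 1)^3)" by (rule of_nat_mono)
  also have "\<dots> = (real (B div e) + 1)^3" by (simp add: add.commute)
  also have "\<dots> \<le> (2 * (real B / real e))^3"
  proof (intro power_mono)
    have "real (B div e) \<le> real B / real e" by (rule of_nat_div_le_of_nat)
    moreover have "1 \<le> real B / real e" using True e by simp
    ultimately show "real (B div e) + 1 \<le> 2 * (real B / real e)" by linarith
  qed simp
  also have "\<dots> = 8 * real B ^ 3 / real e ^ 3" by (simp add: power_mult_distrib power_divide)
  finally show ?thesis by simp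
next
  case False
  then have "(\<lambda>(u, v, w). (u div e, v div e, w div e)) ` S \<subseteq> {(0, 0, 0)}" using S by auto
  then have "card S \<le> card {(0::nat, 0::nat, 0::nat)}" using inj by (intro card_inj_on_le) auto
  then show ?thesis by (simp add: add_increasing)
qed

text \<open>Absence of rational roots, which for a cubic means irreducibility, in the homogeneous
  form that instantiates the anisotropy of the norm with \<open>m = 0\<close>.\<close>

locale irreducible_cubic =
  fixes P Q :: int
  assumes no_root: "\<And>x y. x^3 + P * x * y^2 + Q * y^3 = 0 \<Longrightarrow> y = 0"
begin

lemma norm_form_eq_0: "norm_form P Q u v w = 0 \<Longrightarrow> u = 0 \<and> v = 0 \<and> w = 0"
proof -
  assume "norm_form P Q u v w = 0"
  then have N: "0 dvd norm_form P Q u v w" by simp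
  have "0 dvd u \<and> 0 dvd v \<and> 0 dvd w"
  proof (rule norm_form_anisotropic[OF _ _ N])
    show "0 dvd y" if "0 dvd x^3 + P * x * y^2 + Q * y^3" for x y
      using no_root[of x y] that by (simp only: dvd_0_left_iff)
  qed simp
  then show "u = 0 \<and> v = 0 \<and> w = 0" by simp
qed

text \<open>Two points of \<open>S\<close> cannot lie in the same cell of side about \<open>p\<^bsup>1/3\<^esup>\<close>, since the norm of their
  difference is a nonzero multiple of \<open>p\<close>.\<close>
lemma packing:
  fixes S :: "(nat \<times> nat \<times> nat) set" and B p :: nat
  assumes S: "S \<subseteq> {..<B} \<times> {..<B} \<times> {..<B}" and p: "p > 0"
    and dvd: "\<And>u v w u' v' w'. (u, v, w) \<in> S \<Longrightarrow> (u', v', w') \<in> S \<Longrightarrow>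
      int p dvd norm_form P Q (int u - int u') (int v - int v') (int w - int w')"
  shows "real (card S) \<le> 64 * real (norm_bound P Q) * real B ^ 3 / real p + 1"
proof -
  let ?C = "norm_bound P Q"
  have C1: "?C \<ge> 1" by (rule norm_bound_pos)
  show ?thesis
  proof (cases "p < ?C")
    case True
    have "card S \<le> card ({..<B} \<times> {..<B} \<times> {..<B})" using S by (intro card_mono) auto
    also have "\<dots> = B ^ 3" by (simp add: card_cartesian_product power3_eq_cube)
    finally have "real (card S) \<le> real B ^ 3" by (metis of_nat_le_iff of_nat_power)
    also have "\<dots> \<le> 64 * real ?C * real B ^ 3 / real p"
    proof -
      have "real p \<le> 64 * real ?C" using True by linarith
      then have "real B ^ 3 * real p \<le> real B ^ 3 * (64 * real ?C)" by (intro mult_left_mono) auto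
      then show ?thesis using p by (simp add: pos_le_divide_eq mult_ac)
    qed
    finally show ?thesis by simp
  next
    case False
    \<comment> \<open>The integer cube root of \<open>p / ?C\<close>: differences within a cell are
      at most \<open>e - 1\<close>, so their norms stay below \<open>p\<close>, while
      \<open>p < ?C * (e + 1)^3\<close> bounds the number of cells.\<close>
    define e where "e = (LEAST e. p < ?C * (e + 1)^3)"
    have ex: "p < ?C * (p + 1)^3"
    proof -
      have "1 * (p + 1)^1 \<le> ?C * (p + 1)^3" using C1 by (intro mult_mono power_increasing) auto
      then show ?thesis by simp
    qed
    have e: "p < ?C * (e + 1)^3" unfolding e_def by (rule LeastI[of _ p]) (rule ex)
    have e0: "e \<ge> 1"
    proof (rule ccontr)
      assume "\<not> e \<ge> 1"
      then have "e = 0" by simp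
      then show False using e False by simp
    qed
    have e2: "?C * e^3 \<le> p"
      using not_less_Least[of "e - 1" "\<lambda>e. p < ?C * (e + 1)^3"] e0 unfolding e_def[symmetric] by simp
    define h where "h = (\<lambda>(u, v, w). (u div e, v div e, w div e))"
    have inj: "inj_on h S"
    proof (rule inj_onI)
      fix x x' assume x: "x \<in> S" "x' \<in> S" "h x = h x'"
      obtain u v w u' v' w' where xe: "x = (u, v, w)" "x' = (u', v', w')" by (metis prod_cases3)
      have close: "\<bar>int a - int a'\<bar> \<le> int (e - 1)" if "a div e = a' div e" for a a'
      proof -
        have 1: "a = e * (a div e) + a mod e" by (simp only: mult_div_mod_eq)
        have 2: "a' = e * (a div e) + a' mod e" unfolding that by (simp only: mult_div_mod_eq)
        have 3: "a mod e < e" "a' mod e < e" using e0 by simp_all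
        have "int a - int a' = int (a mod e) - int (a' mod e)"
          using arg_cong[OF 1, of int, unfolded of_nat_add] arg_cong[OF 2, of int, unfolded of_nat_add] by linarith
        then show ?thesis using e0 3 by linarith
      qed
      have cells: "u div e = u' div e" "v div e = v' div e" "w div e = w' div e"
        using x(3) unfolding xe h_def by simp_all
      define M where "M = norm_form P Q (int u - int u') (int v - int v') (int w - int w')"
      have "nat \<bar>M\<bar> \<le> ?C * (e - 1)^3"
        unfolding M_def by (intro norm_form_le_norm_bound close cells)
      also have "\<dots> < ?C * e^3" using C1 e0 by (simp add: power_strict_mono)
      also have "\<dots> \<le> p" by (rule e2)
      finally have "\<bar>M\<bar> < int p" by linarith
      moreover have "int p dvd M" unfolding M_def using dvd x(1,2) xe by blast
      ultimately have "M = 0" using dvd_imp_le_int[of M "int p"] by linarith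
      then have "int u - int u' = 0 \<and> int v - int v' = 0 \<and> int w - int w' = 0"
        unfolding M_def by (rule norm_form_eq_0)
      then have "u = u' \<and> v = v' \<and> w = w'" by simp
      then show "x = x'" using xe by simp
    qed
    have "real (card S) \<le> 8 * real B ^ 3 / real e ^ 3 + 1"
      using card_le_cells[OF S e0] inj unfolding h_def .
    also have "8 * real B ^ 3 / real e ^ 3 \<le> 64 * real ?C * real B ^ 3 / real p"
    proof -
      have "?C * (e + 1)^3 \<le> ?C * (2 * e)^3" using e0 by (intro mult_left_mono power_mono) auto
      also have "?C * (2 * e)^3 = 8 * ?C * e^3" by (simp add: power_mult_distrib)
      finally have "p \<le> 8 * ?C * e^3" using e by linarith
      then have "real p \<le> real (8 * ?C * e^3)" by (rule of_nat_mono)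
      then have "real p \<le> 8 * real ?C * real e ^ 3" by simp
      then have "8 * real B ^ 3 * real p \<le> 8 * real B ^ 3 * (8 * real ?C * real e ^ 3)"
        by (intro mult_left_mono) auto
      also have "\<dots> = 64 * real ?C * real B ^ 3 * real e ^ 3" by simp
      finally have "8 * real B ^ 3 \<le> 64 * real ?C * real B ^ 3 * real e ^ 3 / real p"
        using p by (simp only: pos_le_divide_eq of_nat_0_less_iff)
      also have "\<dots> = 64 * real ?C * real B ^ 3 / real p * real e ^ 3" by simp
      finally show ?thesis using e0 by (simp only: pos_divide_le_eq zero_less_power of_nat_0_less_iff less_le_trans[OF zero_less_one])
    qed
    finally show ?thesis by simp
  qed
qed

text \<open>The 6 is at most three roots times two types of ideal, each handled by packing. Points
  with all coefficients divisible by \<open>p\<close> are excluded, as they yield no root.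
  Differences carry a factor \<open>W\<close>, which is invertible modulo \<open>p\<close>.\<close>

lemma card_norm_prime_le:
  fixes p W B :: nat
  assumes p: "prime p" and W: "\<not> p dvd W"
  defines "X \<equiv> {..<B} \<times> {..<B} \<times> {..<B}"
  shows "real (card {(u, v, w) \<in> X. int p dvd norm_form P Q (1 + int W * int u) (int W * int v) (int W * int w) \<and>
      \<not> (int p dvd 1 + int W * int u \<and> int p dvd int W * int v \<and> int p dvd int W * int w)})
    \<le> 6 * (64 * real (norm_bound P Q) * real B ^ 3 / real p + 1)" (is "real (card ?H) \<le> 6 * ?b")
proof -
  define C1 where "C1 r = {(u, v, w) \<in> X. int p dvd (1 + int W * int u) + (int W * int v) * r + (int W * int w) * r^2}" for r
  define C2 where "C2 r = {(u, v, w) \<in> X. int p dvd (int W * int v) - (int W * int w) * r \<and>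
       int p dvd (1 + int W * int u) - (int W * int w) * (r^2 + P)}" for r
  have Xfin: "finite X" by (simp add: X_def)
  have C_fin: "finite (C1 r)" "finite (C2 r)" for r
    by (rule finite_subset[OF _ Xfin], force simp: C1_def C2_def)+
  have pi: "prime (int p)" using p by simp
  have pW: "\<not> int p dvd int W" using W by simp
  have descale: "int p dvd norm_form P Q x y z"
    if "int p dvd norm_form P Q (int W * x) (int W * y) (int W * z)" for x y z
    using that pW pi unfolding norm_form_scale by (metis prime_dvd_multD prime_dvd_power)
  have "?H \<subseteq> (\<Union>r\<in>cubic_roots P Q p. C1 r \<union> C2 r)"
  proof
    fix x assume x: "x \<in> ?H"
    obtain u v w where xe: "x = (u, v, w)" by (metis prod_cases3)
    let ?u = "1 + int W * int u" and ?v = "int W * int v" and ?w = "int W * int w"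
    have xX: "x \<in> X" using x by auto
    obtain r where r: "int p dvd cubic P Q r" "int p dvd ?u + ?v * r + ?w * r^2 \<or>
        (int p dvd ?v - ?w * r \<and> int p dvd ?u - ?w * (r^2 + P))"
      using norm_form_prime_dvd_cases[OF p, of P Q ?u ?v ?w] x xe by blast
    define s where "s = r mod int p"
    have s: "s \<in> cubic_roots P Q p" unfolding s_def by (rule cubic_root_mod[OF p r(1)])
    have sr: "int p dvd s - r" by (simp add: s_def mod_eq_dvd_iff[symmetric])
    have tr: "int p dvd poly g s" if "int p dvd poly g r" for g
      by (rule dvd_poly_shift[OF sr that])
    have eqs: "poly [:?u, ?v, ?w:] y = ?u + ?v * y + ?w * y^2" "poly [:?v, - ?w:] y = ?v - ?w * y"
      "poly [:?u - ?w * P, 0, - ?w:] y = ?u - ?w * (y^2 + P)" for y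
      by (simp_all add: power2_eq_square algebra_simps)
    have "int p dvd ?u + ?v * s + ?w * s^2 \<or> (int p dvd ?v - ?w * s \<and> int p dvd ?u - ?w * (s^2 + P))"
      using r(2) tr[of "[:?u, ?v, ?w:]"] tr[of "[:?v, - ?w:]"] tr[of "[:?u - ?w * P, 0, - ?w:]"]
      unfolding eqs by blast
    then have "x \<in> C1 s \<union> C2 s" using xX xe by (simp add: C1_def C2_def)
    then show "x \<in> (\<Union>r\<in>cubic_roots P Q p. C1 r \<union> C2 r)" using s by blast
  qed
  then have "card ?H \<le> card (\<Union>r\<in>cubic_roots P Q p. C1 r \<union> C2 r)"
    using C_fin by (intro card_mono) auto
  also have "\<dots> \<le> (\<Sum>r\<in>cubic_roots P Q p. card (C1 r \<union> C2 r))" by (rule card_UN_le) simp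
  finally have "real (card ?H) \<le> real (\<Sum>r\<in>cubic_roots P Q p. card (C1 r \<union> C2 r))"
    by (rule of_nat_mono)
  also have "\<dots> = (\<Sum>r\<in>cubic_roots P Q p. real (card (C1 r \<union> C2 r)))" by simp
  also have "\<dots> \<le> (\<Sum>r\<in>cubic_roots P Q p. 2 * ?b)"
  proof (rule sum_mono)
    fix r assume "r \<in> cubic_roots P Q p"
    then have F: "int p dvd cubic P Q r" by (simp add: cubic_roots_def)
    have "real (card (C1 r)) \<le> ?b"
    proof (rule packing)
      fix u v w u' v' w' assume a: "(u, v, w) \<in> C1 r" "(u', v', w') \<in> C1 r"
      show "int p dvd norm_form P Q (int u - int u') (int v - int v') (int w - int w')"
      proof (rule descale, rule dvd_norm_form_root[OF F])
        have "int p dvd ((1 + int W * int u) + (int W * int v) * r + (int W * int w) * r^2) -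
           ((1 + int W * int u') + (int W * int v') * r + (int W * int w') * r^2)"
          using a by (intro dvd_diff) (auto simp: C1_def)
        also have "\<dots> = int W * (int u - int u') + int W * (int v - int v') * r + int W * (int w - int w') * r^2"
          by (simp add: algebra_simps)
        finally show "int p dvd int W * (int u - int u') + int W * (int v - int v') * r + int W * (int w - int w') * r^2" .
      qed
    qed (use prime_gt_0_nat[OF p] in \<open>auto simp: C1_def X_def\<close>)
    moreover have "real (card (C2 r)) \<le> ?b"
    proof (rule packing)
      fix u v w u' v' w' assume a: "(u, v, w) \<in> C2 r" "(u', v', w') \<in> C2 r"
      show "int p dvd norm_form P Q (int u - int u') (int v - int v') (int w - int w')"
      proof (rule descale, rule dvd_norm_form_quadratic[OF F])
        have "int p dvd ((int W * int v) - (int W * int w) * r) - ((int W * int v') - (int W * int w') * r)"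
          by (rule dvd_diff) (use a in \<open>auto simp: C2_def\<close>)
        also have "\<dots> = int W * (int v - int v') - int W * (int w - int w') * r"
          by (simp add: algebra_simps)
        finally show "int p dvd int W * (int v - int v') - int W * (int w - int w') * r" .
        have "int p dvd ((1 + int W * int u) - (int W * int w) * (r^2 + P)) - ((1 + int W * int u') - (int W * int w') * (r^2 + P))"
          by (rule dvd_diff) (use a in \<open>auto simp: C2_def\<close>)
        also have "\<dots> = int W * (int u - int u') - int W * (int w - int w') * (r^2 + P)"
          by (simp add: algebra_simps)
        finally show "int p dvd int W * (int u - int u') - int W * (int w - int w') * (r^2 + P)" .
      qed
    qed (use prime_gt_0_nat[OF p] in \<open>auto simp: C2_def X_def\<close>)
    moreover have "real (card (C1 r \<union> C2 r)) \<le> real (card (C1 r)) + real (card (C2 r))"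
    using of_nat_mono[OF card_Un_le[of "C1 r" "C2 r"], where 'a = real] by (simp only: of_nat_add)
    ultimately have "real (card (C1 r \<union> C2 r)) \<le> ?b + ?b" by (meson add_mono order_trans)
    then show "real (card (C1 r \<union> C2 r)) \<le> 2 * ?b" by (simp only: mult_2)
  qed
  also have "\<dots> = real (card (cubic_roots P Q p)) * (2 * ?b)" by simp
  also have "\<dots> \<le> real 3 * (2 * ?b)"
    using card_cubic_roots[OF p, of P Q] by (intro mult_right_mono of_nat_mono) (auto intro!: add_nonneg_nonneg)
  finally show ?thesis by simp
qed

end

section \<open>Primes modulo which a cubic has a root\<close>

context irreducible_cubic
begin

text \<open>For fixed \<open>v\<close> and \<open>w\<close> the norm is a monic cubic in
  \<open>u\<close>, so each of the values \<open>1\<close> and \<open>-1\<close> is taken at most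
  three times.\<close>

lemma card_norm_pm1_le:
  fixes B W :: nat
  assumes "W > 0"
  shows "card {(u, v, w) \<in> {..<B} \<times> {..<B} \<times> {..<B}.
     \<bar>norm_form P Q (1 + int W * int u) (int W * int v) (int W * int w)\<bar> = 1} \<le> 6 * B^2"
proof -
  define g where "g c v w = [: w^3 * Q^2 - v^3 * Q - v * w^2 * P * Q - c,
      v^2 * P + 3 * v * w * Q + w^2 * P^2, - 2 * w * P, 1 :]" for c v w :: int
  have g: "poly (g c v w) u = norm_form P Q u v w - c" for c u v w
    by (simp add: g_def norm_form_def power2_eq_square power3_eq_cube algebra_simps)
  have deg: "g c v w \<noteq> 0" "degree (g c v w) = 3" for c v w by (simp_all add: g_def)
  define U where "U c v w = {x. poly (g c v w) x = 0}" for c v w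
  have U: "finite (U c v w)" "card (U c v w) \<le> 3" for c v w
    using poly_roots_finite[OF deg(1)] card_poly_roots_bound[OF deg(1)] unfolding U_def deg(2)
    by blast+
  define S where "S = {(u, v, w) \<in> {..<B} \<times> {..<B} \<times> {..<B}.
     \<bar>norm_form P Q (1 + int W * int u) (int W * int v) (int W * int w)\<bar> = 1}"
  define R where "R = (SIGMA vw : {..<B} \<times> {..<B}. U 1 (int W * int (fst vw)) (int W * int (snd vw)) \<union>
     U (-1) (int W * int (fst vw)) (int W * int (snd vw)))"
  define h where "h = (\<lambda>(u, v :: nat, w :: nat). ((v, w), 1 + int W * int u))"
  have "inj_on h S" using assms by (auto simp: inj_on_def h_def)
  moreover have "h ` S \<subseteq> R"
    by (auto simp: h_def S_def R_def U_def g)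
  moreover have "finite R" unfolding R_def using U by (intro finite_SigmaI) auto
  ultimately have "card S \<le> card R" by (intro card_inj_on_le)
  also have "card R = (\<Sum>vw\<in>{..<B} \<times> {..<B}. card (U 1 (int W * int (fst vw)) (int W * int (snd vw)) \<union>
     U (-1) (int W * int (fst vw)) (int W * int (snd vw))))"
    unfolding R_def using U by (intro card_SigmaI) auto
  also have "\<dots> \<le> (\<Sum>vw\<in>{..<B} \<times> {..<B}. 6)"
  proof (rule sum_mono)
    fix vw :: "nat \<times> nat"
    let ?v = "int W * int (fst vw)" and ?w = "int W * int (snd vw)"
    have "card (U 1 ?v ?w \<union> U (-1) ?v ?w) \<le> card (U 1 ?v ?w) + card (U (-1) ?v ?w)" by (rule card_Un_le)
    then show "card (U 1 ?v ?w \<union> U (-1) ?v ?w) \<le> 6" using U(2)[of 1 ?v ?w] U(2)[of "-1" ?v ?w] by simp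
  qed
  also have "\<dots> = 6 * B^2" by (simp add: power2_eq_square card_cartesian_product)
  finally show ?thesis unfolding S_def .
qed

text \<open>As \<open>p\<close> does not divide \<open>W\<close>, each coordinate is confined to one
  class modulo \<open>p\<close>: one point per cell of side \<open>p\<close>. The cubes are summed
  over \<open>p > z\<close>, and the extra 1 occurs only for \<open>p \<le> W B + 1\<close>.\<close>

lemma card_common_divisor_le:
  fixes B W z Y :: nat
  assumes "\<And>p. prime p \<Longrightarrow> p > z \<Longrightarrow> \<not> p dvd W" "z \<ge> 1"
  shows "real (card {(u, v, w) \<in> {..<B} \<times> {..<B} \<times> {..<B}. \<exists>p. prime p \<and> p > z \<and>
      int p dvd 1 + int W * int u \<and> int p dvd int W * int v \<and> int p dvd int W * int w})
    \<le> 8 * real B ^ 3 / real z + (real W * real B + 1)"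
proof -
  define S where "S p = {(u, v, w) \<in> {..<B} \<times> {..<B} \<times> {..<B}. 
      int p dvd 1 + int W * int u \<and> int p dvd int W * int v \<and> int p dvd int W * int w}" for p :: nat
  define M where "M = W * B + 1"
  have Sfin: "finite (S p)" for p
    by (rule finite_subset[of _ "{..<B} \<times> {..<B} \<times> {..<B}"]) (auto simp: S_def)
  define Ps where "Ps = {p\<in>{z<..M}. prime p}"
  have "{(u, v, w) \<in> {..<B} \<times> {..<B} \<times> {..<B}. \<exists>p. prime p \<and> p > z \<and>
      int p dvd 1 + int W * int u \<and> int p dvd int W * int v \<and> int p dvd int W * int w} \<subseteq> (\<Union>p\<in>Ps. S p)"
  proof
    fix x assume x: "x \<in> {(u, v, w) \<in> {..<B} \<times> {..<B} \<times> {..<B}. \<exists>p. prime p \<and> p > z \<and>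
      int p dvd 1 + int W * int u \<and> int p dvd int W * int v \<and> int p dvd int W * int w}"
    obtain u v w where xe: "x = (u, v, w)" by (rule prod_cases3)
    obtain p where a: "u \<in> {..<B}" "v \<in> {..<B}" "w \<in> {..<B}" "prime p" "z < p"
      "int p dvd 1 + int W * int u" "int p dvd int W * int v" "int p dvd int W * int w"
      using x unfolding xe by blast
    have "int p dvd int (1 + W * u)" using a(6) by simp
    then have "p dvd 1 + W * u" by (simp only: of_nat_dvd_iff)
    then have "p \<le> 1 + W * u" by (rule dvd_imp_le) simp
    also have "\<dots> \<le> M" unfolding M_def using a(1) by simp
    finally have "p \<in> Ps" using a by (simp add: Ps_def)
    moreover have "(u, v, w) \<in> S p" using a by (simp add: S_def)
    ultimately show "x \<in> (\<Union>p\<in>Ps. S p)" unfolding xe by blast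
  qed
  then have "card {(u, v, w) \<in> {..<B} \<times> {..<B} \<times> {..<B}. \<exists>p. prime p \<and> p > z \<and>
      int p dvd 1 + int W * int u \<and> int p dvd int W * int v \<and> int p dvd int W * int w} \<le> card (\<Union>p\<in>Ps. S p)"
    using Sfin by (intro card_mono) (auto simp: Ps_def)
  also have "\<dots> \<le> (\<Sum>p\<in>Ps. card (S p))" by (rule card_UN_le) (simp add: Ps_def)
  finally have "real (card {(u, v, w) \<in> {..<B} \<times> {..<B} \<times> {..<B}. \<exists>p. prime p \<and> p > z \<and>
      int p dvd 1 + int W * int u \<and> int p dvd int W * int v \<and> int p dvd int W * int w}) \<le> real (\<Sum>p\<in>Ps. card (S p))"
    by (rule of_nat_mono)
  also have "\<dots> = (\<Sum>p\<in>Ps. real (card (S p)))" by simp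
  also have "\<dots> \<le> (\<Sum>p\<in>Ps. 8 * real B ^ 3 * (1 / (real p * (real p - 1))) + 1)"
  proof (rule sum_mono)
    fix p assume "p \<in> Ps"
    then have p: "prime p" "p > z" by (auto simp: Ps_def)
    have pW: "\<not> p dvd W" by (rule assms(1)[OF p])
    have p2: "real p \<ge> 2" using prime_ge_2_nat[OF p(1)] by simp
    have pi: "prime (int p)" using p by simp
    define h where "h = (\<lambda>(u, v, w). (u div p, v div p, w div p))"
    have cls: "a = a'" if "int p dvd int W * (int a - int a')" "a div p = a' div p" for a a'
    proof -
      have "int p dvd int a - int a'" using that(1) pW pi by (simp add: prime_dvd_mult_iff)
      then have "int a mod int p = int a' mod int p" by (simp only: mod_eq_dvd_iff)
      then have "a mod p = a' mod p" by (simp only: zmod_int[symmetric] of_nat_eq_iff)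
      then show ?thesis using that(2) by (metis mult_div_mod_eq)
    qed
    have inj: "inj_on h (S p)"
    proof (rule inj_onI)
      fix x x' assume x: "x \<in> S p" "x' \<in> S p" "h x = h x'"
      obtain u v w where xe: "x = (u, v, w)" by (rule prod_cases3)
      obtain u' v' w' where xe': "x' = (u', v', w')" by (rule prod_cases3)
      have d: "int p dvd 1 + int W * int u" "int p dvd int W * int v" "int p dvd int W * int w"
        "int p dvd 1 + int W * int u'" "int p dvd int W * int v'" "int p dvd int W * int w'"
        using x(1,2) unfolding xe xe' S_def by simp_all
      have "int p dvd (1 + int W * int u) - (1 + int W * int u')" "int p dvd int W * int v - int W * int v'"
        "int p dvd int W * int w - int W * int w'"
        using d by (metis dvd_diff)+
      then have "int p dvd int W * (int u - int u')" "int p dvd int W * (int v - int v')" "int p dvd int W * (int w - int w')"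
        by (simp_all add: algebra_simps)
      moreover have "u div p = u' div p" "v div p = v' div p" "w div p = w' div p"
        using x(3) unfolding xe xe' h_def by simp_all
      ultimately have "u = u'" "v = v'" "w = w'" using cls by blast+
      then show "x = x'" by (simp only: xe xe')
    qed
    have "real (card (S p)) \<le> 8 * real B ^ 3 / real p ^ 3 + 1"
      using p2 inj unfolding h_def by (intro card_le_cells) (auto simp: S_def)
    also have "8 * real B ^ 3 / real p ^ 3 \<le> 8 * real B ^ 3 / (real p * (real p - 1))"
    proof (intro divide_left_mono)
      have "real p * (real p - 1) \<le> real p * (real p * real p)"
        using p2 by (intro mult_left_mono) (auto intro: order_trans[of _ "real p * 1"] mult_left_mono)
      then show "real p * (real p - 1) \<le> real p ^ 3" by (simp add: power3_eq_cube)
    qed (use p2 in auto)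
    finally show "real (card (S p)) \<le> 8 * real B ^ 3 * (1 / (real p * (real p - 1))) + 1" by simp
  qed
  also have "\<dots> = 8 * real B ^ 3 * (\<Sum>p\<in>Ps. 1 / (real p * (real p - 1))) + real (card Ps)"
    by (simp add: sum.distrib sum_distrib_left)
  also have "\<dots> \<le> 8 * real B ^ 3 * (1 / real z) + real M"
  proof (intro add_mono mult_left_mono)
    have "(\<Sum>p\<in>Ps. 1 / (real p * (real p - 1))) \<le> (\<Sum>p\<in>{z<..M}. 1 / (real p * (real p - 1)))"
      using assms(2) by (intro sum_mono2) (auto simp: Ps_def)
    also have "\<dots> \<le> 1 / real z" by (rule sum_telescope_le[OF assms(2)])
    finally show "(\<Sum>p\<in>Ps. 1 / (real p * (real p - 1))) \<le> 1 / real z" .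
    have "card Ps \<le> card {z<..M}" by (intro card_mono) (auto simp: Ps_def)
    then show "real (card Ps) \<le> real M" by simp
  qed auto
  finally show ?thesis by (simp add: M_def)
qed

text \<open>If the sum converged, choose \<open>z\<close> with small tail and consider the elements
  \<open>1 + W (u + v \<theta> + w \<theta>^2)\<close> for \<open>u\<close>, \<open>v\<close>,
  \<open>w\<close> below \<open>B\<close>, \<open>W\<close> being the product of the primes up to
  \<open>z\<close>. Their norms are prime to \<open>W\<close>. Norm 1 or -1, a common prime of the
  coefficients, and root primes above \<open>z\<close> account for at most 1/8, 1/4 and 3/8 of the
  box.\<close>

theorem sum_root_primes_unbounded:
  "\<exists>x. (\<Sum>p\<in>root_primes P Q \<inter> primes_le x. 1 / real p) > K"
proof (rule ccontr)
  assume "\<not> ?thesis"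
  then have bnd: "(\<Sum>p\<in>root_primes P Q \<inter> primes_le x. 1 / real p) \<le> K" for x by (meson linorder_not_le)
  define s where "s x = (\<Sum>p\<in>root_primes P Q \<inter> primes_le x. 1 / real p)" for x
  define NC where "NC = norm_bound P Q"
  have NC: "NC \<ge> 1" unfolding NC_def by (rule norm_bound_pos)
  \<comment> \<open>\<open>6 * 64 * NC * eta\<close> is 1/4, the share of the box left to the main
    term for root primes; \<open>z \<ge> 64\<close> below similarly turns \<open>8 / z\<close> into
    1/8.\<close>
  define eta where "eta = 1 / (1536 * real NC)"
  have eta: "eta > 0" using NC by (simp add: eta_def)
  have smono: "s x \<le> s y" if "x \<le> y" for x y
    unfolding s_def using that by (intro sum_mono2) (auto simp: primes_le_def)
  have bdd: "bdd_above (range s)" using bnd unfolding s_def by (intro bdd_aboveI) auto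
  obtain z0 where z0: "s z0 > Sup (range s) - eta"
    using less_cSup_iff[of "range s" "Sup (range s) - eta"] bdd eta by auto
  define z where "z = max z0 64"
  have z: "z \<ge> 64" by (simp add: z_def)
  have tail: "s x - s z \<le> eta" for x
  proof -
    have "s x \<le> Sup (range s)" using bdd by (intro cSup_upper) auto
    moreover have "s z \<ge> s z0" by (rule smono) (simp add: z_def)
    ultimately show ?thesis using z0 by linarith
  qed
  define W where "W = \<Prod>(primes_le z)"
  have Wpos: "W > 0" unfolding W_def by (rule prod_pos) (auto simp: primes_le_def prime_gt_0_nat)
  have Wdvd: "p dvd W" if "prime p" "p \<le> z" for p
    unfolding W_def using that by (intro dvd_prodI) (auto simp: primes_le_def)
  have Wnot: "\<not> p dvd W" if p: "prime p" "p > z" for p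
  proof
    assume "p dvd W"
    then obtain q where "q \<in> primes_le z" "p dvd q"
      unfolding W_def using p by (auto simp: prime_dvd_prod_iff)
    then show False using p dvd_imp_le[of p q] prime_gt_0_nat[of q] by (auto simp: primes_le_def)
  qed
  define c where "c = 6 * 14 * 8 * real NC * real W ^ 3"
  \<comment> \<open>\<open>exp (8 * c)\<close> makes the packing summands over all primes up to
    \<open>Y\<close> at most \<open>B^3 / 8\<close>; 48 does the same for \<open>6 * B^2\<close>,
    and \<open>16 * W\<close> for \<open>W * B\<close>.\<close>
  define B where "B = max (nat \<lceil>exp (8 * c)\<rceil>) (48 + 16 * W)"
  have B1: "B \<ge> 48" "B \<ge> 16 * W" by (auto simp: B_def)
  have "exp (8 * c) \<le> real (nat \<lceil>exp (8 * c)\<rceil>)" by (rule real_nat_ceiling_ge)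
  also have "\<dots> \<le> real B" by (simp add: B_def)
  finally have lnB: "8 * c \<le> ln (real B)" using B1 by (subst ln_ge_iff) auto
  define X where "X = {..<B} \<times> {..<B} \<times> {..<B}"
  define Nm where "Nm u v w = norm_form P Q (1 + int W * int u) (int W * int v) (int W * int w)" for u v w
  define Y where "Y = NC * (2 * W * B)^3"
  define S1 where "S1 = {(u, v, w) \<in> X. \<bar>Nm u v w\<bar> = 1}"
  define S2 where "S2 = {(u, v, w) \<in> X. \<exists>p. prime p \<and> p > z \<and>
      int p dvd 1 + int W * int u \<and> int p dvd int W * int v \<and> int p dvd int W * int w}"
  define S3 where "S3 p = {(u, v, w) \<in> X. int p dvd Nm u v w \<and>
     \<not> (int p dvd 1 + int W * int u \<and> int p dvd int W * int v \<and> int p dvd int W * int w)}" for p :: nat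
  define Ps where "Ps = root_primes P Q \<inter> primes_le Y - primes_le z"
  have Xfin: "finite X" by (simp add: X_def)
  have Sfin: "finite S1" "finite S2" "finite (S3 p)" for p
    by (rule finite_subset[OF _ Xfin], force simp: S1_def S2_def S3_def)+
  have "X \<subseteq> S1 \<union> S2 \<union> (\<Union>p\<in>Ps. S3 p)"
  proof
    fix x assume x: "x \<in> X"
    obtain u v w where xe: "x = (u, v, w)" by (rule prod_cases3)
    have uvw: "u < B" "v < B" "w < B" using x unfolding xe X_def by auto
    show "x \<in> S1 \<union> S2 \<union> (\<Union>p\<in>Ps. S3 p)"
    proof (cases "\<bar>Nm u v w\<bar> = 1")
      case True
      then show ?thesis using x xe by (simp add: S1_def)
    next
      case False
      then have "nat \<bar>Nm u v w\<bar> \<noteq> 1" by simp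
      then obtain p where p: "prime p" "p dvd nat \<bar>Nm u v w\<bar>" using prime_factor_nat by blast
      have "int p dvd int (nat \<bar>Nm u v w\<bar>)" using p(2) by (simp only: of_nat_dvd_iff)
      then have pN: "int p dvd Nm u v w" by simp
      have pz: "p > z"
      proof (rule ccontr)
        assume "\<not> p > z"
        then have "int p dvd int W" using Wdvd[OF p(1)] by (simp only: of_nat_dvd_iff not_less)
        \<comment> \<open>Every monomial other than the leading 1 carries a factor \<open>W\<close>,
          so a prime dividing \<open>W\<close> cannot divide the norm.\<close>
        have "\<exists>k. Nm u v w = 1 + int W * k"
        proof -
          have "Nm u v w = 1 + int W * (int u * (3 + 3 * int W * int u + (int W)^2 * (int u)^2)
             - 2 * (1 + int W * int u)^2 * int w * P + (1 + int W * int u) * int W * (int v)^2 * P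
             + 3 * (1 + int W * int u) * int W * int v * int w * Q + (1 + int W * int u) * int W * (int w)^2 * P^2
             - (int W)^2 * (int v)^3 * Q - (int W)^2 * int v * (int w)^2 * P * Q + (int W)^2 * (int w)^3 * Q^2)"
            unfolding Nm_def norm_form_def by algebra
          then show ?thesis by blast
        qed
        then obtain k where "Nm u v w = 1 + int W * k" by blast
        then have "int p dvd 1 + int W * k" using pN by simp
        moreover have "int p dvd int W * k" using \<open>int p dvd int W\<close> by simp
        ultimately have "int p dvd 1" by (simp only: dvd_add_left_iff)
        then show False using prime_gt_1_nat[OF p(1)] by simp
      qed
      show ?thesis
      proof (cases "int p dvd 1 + int W * int u \<and> int p dvd int W * int v \<and> int p dvd int W * int w")
        case True
        then have "x \<in> S2" using x p(1) pz unfolding xe S2_def by blast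
        then show ?thesis by blast
      next
        case nd: False
        have "\<exists>r. int p dvd cubic P Q r"
          using norm_form_prime_dvd_cases[OF p(1) pN[unfolded Nm_def] nd] by blast
        then have "p \<in> root_primes P Q" using p(1) by (simp add: root_primes_def)
        moreover have "p \<le> Y"
        proof -
          have nz: "Nm u v w \<noteq> 0"
          proof
            assume "Nm u v w = 0"
            then have "1 + int W * int u = 0" unfolding Nm_def using norm_form_eq_0 by blast
            moreover have "int W * int u \<ge> 0" by simp
            ultimately show False by linarith
          qed
          have ub: "1 + W * u \<le> 2 * W * B" "W * v \<le> 2 * W * B" "W * w \<le> 2 * W * B"
          proof -
            have "1 + W * u \<le> W * B + W * B" using Wpos uvw by (intro add_mono mult_le_mono2) (auto simp: Suc_le_eq)
            then show "1 + W * u \<le> 2 * W * B" by simp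
            have "W * v \<le> W * (2 * B)" "W * w \<le> W * (2 * B)" using uvw by (intro mult_le_mono2; simp)+
            then show "W * v \<le> 2 * W * B" "W * w \<le> 2 * W * B" by (simp_all add: mult_ac)
          qed
          have "nat \<bar>norm_form P Q (int (1 + W * u)) (int (W * v)) (int (W * w))\<bar> \<le> norm_bound P Q * (2 * W * B)^3"
            using ub by (intro norm_form_le_norm_bound) (simp_all only: abs_of_nat of_nat_le_iff)
          then have "nat \<bar>Nm u v w\<bar> \<le> Y" by (simp add: Nm_def Y_def NC_def)
          moreover have "p \<le> nat \<bar>Nm u v w\<bar>" using p(2) nz by (intro dvd_imp_le) auto
          ultimately show ?thesis by (rule le_trans[rotated])
        qed
        ultimately have "p \<in> Ps" using p(1) pz by (simp add: Ps_def primes_le_def)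
        moreover have "x \<in> S3 p" using x pN nd unfolding xe S3_def by blast
        ultimately show ?thesis by blast
      qed
    qed
  qed
  then have "card X \<le> card (S1 \<union> S2 \<union> (\<Union>p\<in>Ps. S3 p))"
    using Sfin by (intro card_mono) (auto simp: Ps_def)
  also have "\<dots> \<le> card (S1 \<union> S2) + card (\<Union>p\<in>Ps. S3 p)" by (rule card_Un_le)
  also have "\<dots> \<le> (card S1 + card S2) + (\<Sum>p\<in>Ps. card (S3 p))"
    by (intro add_mono card_Un_le card_UN_le) (simp add: Ps_def)
  finally have "real (card X) \<le> real ((card S1 + card S2) + (\<Sum>p\<in>Ps. card (S3 p)))" by (rule of_nat_mono)
  then have tot: "real B ^ 3 \<le> real (card S1) + real (card S2) + (\<Sum>p\<in>Ps. real (card (S3 p)))"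
    by (simp add: X_def card_cartesian_product power3_eq_cube)
  have b1: "real (card S1) \<le> real B ^ 3 / 8"
  proof -
    have "card S1 \<le> 6 * B^2" unfolding S1_def X_def Nm_def by (rule card_norm_pm1_le[OF Wpos])
    then have "real (card S1) \<le> real (6 * B^2)" by (rule of_nat_mono)
    also have "\<dots> = 48 * real B ^ 2 / 8" by simp
    also have "\<dots> \<le> real B * real B ^ 2 / 8" using B1 by (intro divide_right_mono mult_right_mono) auto
    finally show ?thesis by (simp add: power3_eq_cube power2_eq_square)
  qed
  have b2: "real (card S2) \<le> real B ^ 3 / 4"
  proof -
    have "real (card S2) \<le> 8 * real B ^ 3 / real z + (real W * real B + 1)"
      unfolding S2_def X_def using z by (intro card_common_divisor_le Wnot) auto
    also have "8 * real B ^ 3 / real z \<le> 8 * real B ^ 3 / 64" using z by (intro divide_left_mono) auto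
    also have "real W * real B + 1 \<le> real B ^ 3 / 8"
    proof -
      have B2: "16 * real W \<le> real B" "48 \<le> real B" using B1 by linarith+
      have "real W * real B \<le> real B ^ 3 / 16"
      proof -
        have "(16 * real W) * real B \<le> real B * real B" using B2 by (intro mult_right_mono) auto
        also have "\<dots> \<le> real B * real B * real B" using B2 mult_left_mono[of 1 "real B" "real B * real B"] by simp
        finally show ?thesis by (simp add: power3_eq_cube)
      qed
      moreover have "1 \<le> real B ^ 3 / 16"
      proof -
        have "48 ^ 3 \<le> real B ^ 3" using B2 by (intro power_mono) auto
        then show ?thesis by simp
      qed
      ultimately show ?thesis by linarith
    qed
    finally show ?thesis by simp
  qed
  have Psum: "(\<Sum>p\<in>Ps. 1 / real p) \<le> eta"
  proof (cases "z \<le> Y")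
    case True
    have "s Y = s z + (\<Sum>p\<in>Ps. 1 / real p)"
    proof -
      have "root_primes P Q \<inter> primes_le Y = (root_primes P Q \<inter> primes_le z) \<union> Ps"
        using True by (auto simp: Ps_def primes_le_def)
      then show ?thesis unfolding s_def
        by (simp only:) (rule sum.union_disjoint, auto simp: Ps_def)
    qed
    then show ?thesis using tail[of Y] by linarith
  next
    case False
    then have "Ps = {}" by (auto simp: Ps_def primes_le_def)
    then show ?thesis using eta by simp
  qed
  have "(\<Sum>p\<in>Ps. real (card (S3 p))) \<le> (\<Sum>p\<in>Ps. 6 * (64 * real NC * real B ^ 3 / real p + 1))"
  proof (rule sum_mono)
    fix p assume "p \<in> Ps"
    then have p: "prime p" "p > z" by (auto simp: Ps_def primes_le_def)
    show "real (card (S3 p)) \<le> 6 * (64 * real NC * real B ^ 3 / real p + 1)"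
      unfolding S3_def X_def NC_def Nm_def by (rule card_norm_prime_le[OF p(1) Wnot[OF p]])
  qed
  also have "\<dots> = (\<Sum>p\<in>Ps. (384 * real NC * real B ^ 3) * (1 / real p) + 6)"
    by (intro sum.cong refl) (simp add: algebra_simps)
  also have "\<dots> = 384 * real NC * real B ^ 3 * (\<Sum>p\<in>Ps. 1 / real p) + 6 * real (card Ps)"
    by (simp only: sum.distrib sum_distrib_left[symmetric] sum_constant mult.commute[of _ "6::real"])
  also have "\<dots> \<le> 384 * real NC * real B ^ 3 * eta + real B ^ 3 / 8"
  proof (intro add_mono mult_left_mono Psum)
    have BY: "B \<le> Y"
    proof -
      have "1 * (1 * B) \<le> NC * (2 * W * B)"
        using NC Wpos by (intro mult_le_mono) (auto simp: Suc_le_eq)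
      also have "\<dots> \<le> NC * (2 * W * B)^3" using Wpos B1 by (intro mult_le_mono2 self_le_power) auto
      finally show ?thesis by (simp add: Y_def)
    qed
    have lnBpos: "ln (real B) > 0" using B1 by simp
    have "card Ps \<le> card (primes_le Y)" by (intro card_mono) (auto simp: Ps_def)
    then have "6 * real (card Ps) * ln (real B) \<le> 6 * (real (card (primes_le Y)) * ln (real Y))"
      using BY B1 lnBpos by (auto intro!: mult_mono)
    also have "\<dots> \<le> 6 * (14 * real Y)" by (intro mult_left_mono card_primes_le_bound) auto
    also have "\<dots> = c * real B ^ 3" by (simp add: Y_def c_def power_mult_distrib)
    finally have 1: "6 * real (card Ps) * ln (real B) \<le> c * real B ^ 3" .
    have "8 * c * (6 * real (card Ps)) \<le> ln (real B) * (6 * real (card Ps))"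
      using lnB by (intro mult_right_mono) auto
    with 1 have "c * (8 * (6 * real (card Ps))) \<le> c * real B ^ 3" by (simp add: mult_ac)
    moreover have "c > 0" unfolding c_def using NC Wpos by simp
    ultimately show "6 * real (card Ps) \<le> real B ^ 3 / 8" by simp
  qed auto
  also have "384 * real NC * real B ^ 3 * eta = real B ^ 3 / 4" using NC by (simp add: eta_def)
  finally have b3: "(\<Sum>p\<in>Ps. real (card (S3 p))) \<le> real B ^ 3 / 4 + real B ^ 3 / 8" .
  have "real B ^ 3 > 0" using B1 by simp
  then show False using tot b1 b2 b3 by linarith
qed

end

section \<open>Primes modulo which a cubic splits\<close>

definition split_primes :: "int \<Rightarrow> int \<Rightarrow> nat set" where
  "split_primes P Q = {p. prime p \<and> card (cubic_roots P Q p) = 3}"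

text \<open>Comparison with an integral in discrete form: each summand beyond the first is at most a
  difference of \<open>m powr (- e) / e\<close>.\<close>

lemma sum_powr_le:
  fixes e :: real
  assumes "e > 0"
  shows "(\<Sum>m=1..n. real m powr (- 1 - e)) \<le> 1 + 1 / e"
proof -
  have "(\<Sum>m=1..n. real m powr (- 1 - e)) \<le> 1 + (1 - real n powr (- e)) / e" if "n \<ge> 1" for n
    using that
  proof (induction n rule: dec_induct)
    case (step n)
    have n: "real n > 0" "real (Suc n) > 0" using step by auto
    have "e * (1 / real (Suc n)) \<le> - (e * ln (1 - 1 / real (Suc n)))"
      using ln_le_minus_one[of "1 - 1 / real (Suc n)"] n assms
        mult_left_mono[of "1 / real (Suc n)" "- ln (1 - 1 / real (Suc n))" e] by (simp add: field_simps)
    also have "1 - 1 / real (Suc n) = real n / real (Suc n)" using n by (simp add: field_simps)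
    finally have "e / real (Suc n) \<le> e * (ln (real (Suc n)) - ln (real n))"
      using n by (simp add: ln_div algebra_simps)
    also have "\<dots> \<le> exp (e * (ln (real (Suc n)) - ln (real n))) - 1"
      using exp_ge_add_one_self[of "e * (ln (real (Suc n)) - ln (real n))"] by linarith
    finally have "real (Suc n) powr (- e) * (e / real (Suc n)) \<le>
        real (Suc n) powr (- e) * (exp (e * (ln (real (Suc n)) - ln (real n))) - 1)"
      by (rule mult_left_mono) simp
    also have "\<dots> = real n powr (- e) - real (Suc n) powr (- e)"
    proof -
      have "real (Suc n) powr (- e) * exp (e * (ln (real (Suc n)) - ln (real n))) = real n powr (- e)"
        using n unfolding powr_def by (simp add: exp_add[symmetric] algebra_simps)
      then show ?thesis by (simp add: algebra_simps)
    qed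
    finally have "real (Suc n) powr (- e) / real (Suc n) \<le> (real n powr (- e) - real (Suc n) powr (- e)) / e"
      using assms by (simp add: pos_le_divide_eq mult_ac)
    moreover have "real (Suc n) powr (- 1 - e) = real (Suc n) powr (- e) / real (Suc n)"
      using n powr_add[of "real (Suc n)" "- e" "-1"] by (simp add: powr_minus divide_inverse add.commute)
    ultimately have "real (Suc n) powr (- 1 - e) \<le> (real n powr (- e) - real (Suc n) powr (- e)) / e" by simp
    then show ?case using step.IH by (simp add: diff_divide_distrib)
  qed simp
  moreover have "1 + (1 - real n powr (- e)) / e \<le> 1 + 1 / e" using assms by (simp add: divide_right_mono)
  ultimately show ?thesis
    using assms by (cases "n \<ge> 1") (force, simp add: not_le)
qed

section \<open>Elements of small norm and a finite Euler product\<close>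

context irreducible_cubic
begin

text \<open>Minkowski's argument by pigeonhole: the box has \<open>(b + 1)^3 > \<Prod>T\<close>
  points but only \<open>\<Prod>T\<close> residue vectors, so two points have an admissible
  difference.\<close>

lemma small_vector:
  fixes T :: "nat set" and c :: "nat \<Rightarrow> int"
  assumes T: "finite T" "\<And>p. p \<in> T \<Longrightarrow> prime p"
  obtains u v w :: int and b :: nat where "b ^ 3 \<le> \<Prod>T" "\<bar>u\<bar> \<le> int b" "\<bar>v\<bar> \<le> int b" "\<bar>w\<bar> \<le> int b"
    "(u, v, w) \<noteq> (0, 0, 0)" "\<And>p. p \<in> T \<Longrightarrow> int p dvd u + v * c p + w * (c p)^2"
proof -
  define q where "q = \<Prod>T"
  define b where "b = (LEAST b. q < (b + 1)^3)"
  have ex: "q < (q + 1)^3" using power_increasing[of 1 3 "q + 1"] by simp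
  have b: "q < (b + 1)^3" unfolding b_def by (rule LeastI[of _ q]) (rule ex)
  have b2: "b^3 \<le> q"
  proof (cases "b = 0")
    case False
    then show ?thesis using not_less_Least[of "b - 1" "\<lambda>b. q < (b + 1)^3"] unfolding b_def[symmetric] by simp
  qed simp
  define Box where "Box = {..b} \<times> {..b} \<times> {..b}"
  define h where "h = (\<lambda>(u, v, w). restrict (\<lambda>p. (int u + int v * c p + int w * (c p)^2) mod int p) T)"
  have "h ` Box \<subseteq> PiE T (\<lambda>p. {0..<int p})"
  proof
    fix y assume "y \<in> h ` Box"
    then obtain u v w where y: "y = h (u, v, w)" by (auto simp: Box_def)
    show "y \<in> PiE T (\<lambda>p. {0..<int p})"
      unfolding y h_def using T prime_gt_0_nat by auto
  qed
  then have "card (h ` Box) \<le> card (PiE T (\<lambda>p. {0..<int p}))"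
    using T by (intro card_mono finite_PiE) auto
  also have "\<dots> = (\<Prod>p\<in>T. p)" using T by (simp add: card_PiE)
  also have "\<dots> = q" by (simp add: q_def)
  also have "\<dots> < (b + 1)^3" by (rule b)
  also have "\<dots> = card Box" by (simp add: Box_def card_cartesian_product power3_eq_cube)
  finally have "\<not> inj_on h Box" using pigeonhole by blast
  then obtain x y where xy: "x \<in> Box" "y \<in> Box" "x \<noteq> y" "h x = h y" unfolding inj_on_def by blast
  obtain u v w where x: "x = (u, v, w)" by (rule prod_cases3)
  obtain u' v' w' where y: "y = (u', v', w')" by (rule prod_cases3)
  show ?thesis
  proof (rule that)
    show "b ^ 3 \<le> \<Prod>T" using b2 by (simp add: q_def)
    show "\<bar>int u - int u'\<bar> \<le> int b" "\<bar>int v - int v'\<bar> \<le> int b" "\<bar>int w - int w'\<bar> \<le> int b"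
      using xy(1,2) unfolding x y Box_def by auto
    show "(int u - int u', int v - int v', int w - int w') \<noteq> (0, 0, 0)" using xy(3) unfolding x y by auto
    fix p assume p: "p \<in> T"
    have "(int u + int v * c p + int w * (c p)^2) mod int p = (int u' + int v' * c p + int w' * (c p)^2) mod int p"
      using fun_cong[OF xy(4), of p] p unfolding x y h_def by simp
    then have "int p dvd (int u + int v * c p + int w * (c p)^2) - (int u' + int v' * c p + int w' * (c p)^2)"
      by (simp only: mod_eq_dvd_iff)
    also have "\<dots> = (int u - int u') + (int v - int v') * c p + (int w - int w') * (c p)^2"
      by (simp add: algebra_simps)
    finally show "int p dvd (int u - int u') + (int v - int v') * c p + (int w - int w') * (c p)^2" .
  qed
qed

lemma prime_factors_prod_primes:
  fixes T :: "nat set"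
  assumes "finite T" "\<And>p. p \<in> T \<Longrightarrow> prime p"
  shows "prime_factors (\<Prod>T) = T"
proof -
  have "prime p \<and> p dvd \<Prod>T \<longleftrightarrow> p \<in> T" for p
  proof
    assume p: "prime p \<and> p dvd \<Prod>T"
    then obtain q where q: "q \<in> T" "p dvd q" using assms(1) by (auto simp: prime_dvd_prod_iff)
    then have "p = q" using p assms(2) primes_dvd_imp_eq by blast
    then show "p \<in> T" using q by simp
  next
    assume "p \<in> T"
    then show "prime p \<and> p dvd \<Prod>T" using assms by (auto intro: dvd_prodI)
  qed
  moreover have "\<Prod>T \<noteq> 0" using assms prime_gt_0_nat by (auto simp: prod_zero_iff)
  ultimately show ?thesis by (auto simp: prime_factors_dvd)
qed

text \<open>A pair \<open>(T, c)\<close> with \<open>c p\<close> a root modulo each \<open>p \<in> T\<close> plays the role of a squarefree ideal of norm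
  \<open>\<Prod>T\<close>; it contains an element of norm at most a constant times \<open>\<Prod>T\<close>, which almost determines it.\<close>
lemma euler_product_le:
  fixes A :: "nat set" and e :: real
  assumes A: "finite A" "A \<subseteq> split_primes P Q" "\<And>p. p \<in> A \<Longrightarrow> p > norm_bound P Q" and e: "e > 0"
  shows "(\<Prod>p\<in>A. 1 + 3 * real p powr (- 1 - e)) \<le> 54 * real (norm_bound P Q) * (1 + 1 / (3 * e))"
proof -
  define NC where "NC = norm_bound P Q"
  have NC: "NC \<ge> 1" unfolding NC_def by (rule norm_bound_pos)
  have Ap: "prime p" "card (cubic_roots P Q p) = 3" if "p \<in> A" for p
    using A(2) that by (auto simp: split_primes_def)
  \<comment> \<open>Expanding the Euler product, the factor 3 at each prime becomes the choice of
    one of its three roots.\<close>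
  define I where "I = (SIGMA T : Pow A. PiE T (cubic_roots P Q))"
  have Ifin: "finite I" unfolding I_def using A(1)
    by (intro finite_SigmaI finite_PiE) (auto intro: finite_subset)
  have IT: "finite (fst i)" "fst i \<subseteq> A" "\<And>p. p \<in> fst i \<Longrightarrow> prime p" if "i \<in> I" for i
  proof -
    show sub: "fst i \<subseteq> A" using that by (auto simp: I_def)
    show "finite (fst i)" by (rule finite_subset[OF sub A(1)])
    show "prime p" if "p \<in> fst i" for p using Ap(1) sub that by blast
  qed
  have Iroot: "int p dvd cubic P Q (snd i p)" "snd i p \<in> cubic_roots P Q p" if "i \<in> I" "p \<in> fst i" for i p
  proof -
    show "snd i p \<in> cubic_roots P Q p" using that by (auto simp: I_def)
    then show "int p dvd cubic P Q (snd i p)" by (simp add: cubic_roots_def)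
  qed
  define good where "good i a \<longleftrightarrow> (case a of (u, v, w, b) \<Rightarrow> b ^ 3 \<le> \<Prod>(fst i) \<and> \<bar>u\<bar> \<le> int b \<and> \<bar>v\<bar> \<le> int b \<and> \<bar>w\<bar> \<le> int b \<and>
     (u, v, w) \<noteq> (0, 0, 0) \<and> (\<forall>p\<in>fst i. int p dvd u + v * snd i p + w * (snd i p)^2))"
    for i :: "nat set \<times> (nat \<Rightarrow> int)" and a :: "int \<times> int \<times> int \<times> nat"
  have "\<exists>a. good i a" if i: "i \<in> I" for i
  proof -
    obtain u v w :: int and b :: nat where uvw: "b ^ 3 \<le> \<Prod>(fst i)" "\<bar>u\<bar> \<le> int b" "\<bar>v\<bar> \<le> int b" "\<bar>w\<bar> \<le> int b"
      "(u, v, w) \<noteq> (0, 0, 0)" "\<And>p. p \<in> fst i \<Longrightarrow> int p dvd u + v * snd i p + w * (snd i p)^2"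
      by (rule small_vector[OF IT(1)[OF i] IT(3)[OF i], of "snd i"]) (assumption, rule that)
    then have "good i (u, v, w, b)" unfolding good_def by simp
    then show ?thesis ..
  qed
  then have "\<forall>i\<in>I. \<exists>a. good i a" by blast
  from bchoice[OF this] obtain al where "\<forall>i\<in>I. good i (al i)" ..
  then have al: "\<And>i. i \<in> I \<Longrightarrow> good i (al i)" by blast
  define u where "u i = fst (al i)" for i
  define v where "v i = fst (snd (al i))" for i
  define w where "w i = fst (snd (snd (al i)))" for i
  define b where "b i = snd (snd (snd (al i)))" for i
  have al': "b i ^ 3 \<le> \<Prod>(fst i)" "\<bar>u i\<bar> \<le> int (b i)" "\<bar>v i\<bar> \<le> int (b i)" "\<bar>w i\<bar> \<le> int (b i)"
     "(u i, v i, w i) \<noteq> (0, 0, 0)" if "i \<in> I" for i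
    using al[OF that] unfolding good_def u_def v_def w_def b_def by (auto split: prod.splits)
  have aldvd: "int p dvd u i + v i * snd i p + w i * (snd i p)^2" if "i \<in> I" "p \<in> fst i" for i p
    using al[OF that(1)] that(2) unfolding good_def u_def v_def w_def b_def by (auto split: prod.splits)
  define Nm where "Nm i = nat \<bar>norm_form P Q (u i) (v i) (w i)\<bar>" for i
  \<comment> \<open>The cofactor of \<open>\<Prod>T\<close> in the norm of the chosen element,
    bounded by \<open>NC\<close>.\<close>
  define k where "k i = Nm i div \<Prod>(fst i)" for i
  have Nm: "Nm i > 0" "\<Prod>(fst i) * k i = Nm i" "k i \<le> NC" "k i > 0" if i: "i \<in> I" for i
  proof -
    show pos: "Nm i > 0"
    proof -
      have "norm_form P Q (u i) (v i) (w i) \<noteq> 0" using norm_form_eq_0 al'(5)[OF i] by blast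
      then show ?thesis by (simp add: Nm_def)
    qed
    have "\<Prod>(fst i) dvd Nm i"
    proof (rule prod_primes_dvd[OF IT(1,3)[OF i]])
      fix p assume p: "p \<in> fst i"
      have "int p dvd norm_form P Q (u i) (v i) (w i)"
        by (rule dvd_norm_form_root[OF Iroot(1)[OF i p] aldvd[OF i p]])
      then have "int p dvd int (Nm i)" unfolding Nm_def by simp
      then show "p dvd Nm i" by (simp only: of_nat_dvd_iff)
    qed simp_all
    then show eq: "\<Prod>(fst i) * k i = Nm i" unfolding k_def by simp
    have q0: "\<Prod>(fst i) > 0" using eq pos by (cases "\<Prod>(fst i)") auto
    have "Nm i \<le> NC * b i ^ 3"
      unfolding Nm_def NC_def using al'[OF i] by (intro norm_form_le_norm_bound)
    also have "\<dots> \<le> NC * \<Prod>(fst i)" using al'(1)[OF i] by (intro mult_le_mono2)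
    finally have "\<Prod>(fst i) * k i \<le> \<Prod>(fst i) * NC" using eq by (simp add: mult.commute)
    then show "k i \<le> NC" using q0 by simp
    show "k i > 0" using eq pos by (cases "k i") auto
  qed
  \<comment> \<open>Norm and cofactor recover \<open>\<Prod>T\<close>, hence \<open>T\<close>. If
    two pairs used different roots at \<open>p\<close>, then \<open>p^2\<close> would divide the
    norm and \<open>p\<close> the cofactor, impossible for \<open>p > NC\<close>.\<close>
  define g where "g i = ((u i, v i, w i), k i)" for i
  have inj: "inj_on g I"
  proof (rule inj_onI)
    fix i j assume ij: "i \<in> I" "j \<in> I" "g i = g j"
    have eqs: "u i = u j" "v i = v j" "w i = w j" "k i = k j" using ij(3) unfolding g_def by auto
    have "Nm i = Nm j" unfolding Nm_def by (simp only: eqs)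
    then have "\<Prod>(fst i) * k i = \<Prod>(fst j) * k i" using Nm(2)[OF ij(1)] Nm(2)[OF ij(2)] eqs by simp
    then have "\<Prod>(fst i) = \<Prod>(fst j)" using Nm(4)[OF ij(1)] by simp
    then have "prime_factors (\<Prod>(fst i)) = prime_factors (\<Prod>(fst j))" by simp
    then have T: "fst i = fst j"
      using prime_factors_prod_primes[OF IT(1,3)[OF ij(1)]] prime_factors_prod_primes[OF IT(1,3)[OF ij(2)]] by simp
    have "snd i p = snd j p" if p: "p \<in> fst i" for p
    proof (rule ccontr)
      assume ne: "snd i p \<noteq> snd j p"
      have pj: "p \<in> fst j" using p T by simp
      have pp: "prime p" using IT(3)[OF ij(1) p] .
      have nd: "\<not> int p dvd snd j p - snd i p"
      proof
        assume "int p dvd snd j p - snd i p"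
        then have "snd j p mod int p = snd i p mod int p" by (simp only: mod_eq_dvd_iff)
        then show False using Iroot(2)[OF ij(1) p] Iroot(2)[OF ij(2) pj] ne by (simp add: cubic_roots_def)
      qed
      have "int p ^ 2 dvd norm_form P Q (u i) (v i) (w i)"
        using square_dvd_norm_form[OF pp Iroot(1)[OF ij(1) p] aldvd[OF ij(1) p] Iroot(1)[OF ij(2) pj] _ nd]
          aldvd[OF ij(2) pj] eqs by simp
      then have "int (p ^ 2) dvd int (Nm i)" unfolding Nm_def by simp
      then have d: "p ^ 2 dvd Nm i" by (simp only: of_nat_dvd_iff)
      have "\<Prod>(fst i) = p * \<Prod>(fst i - {p})" using p IT(1)[OF ij(1)] by (rule prod.remove[rotated])
      then have "p * p dvd p * (\<Prod>(fst i - {p}) * k i)"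
        using d Nm(2)[OF ij(1)] by (simp add: power2_eq_square mult.assoc)
      then have "p dvd \<Prod>(fst i - {p}) * k i" using pp by simp
      moreover have "\<not> p dvd \<Prod>(fst i - {p})"
      proof
        assume "p dvd \<Prod>(fst i - {p})"
        then obtain q where "q \<in> fst i - {p}" "p dvd q"
          using IT(1)[OF ij(1)] pp by (auto simp: prime_dvd_prod_iff)
        then show False using primes_dvd_imp_eq[of p q] pp IT(3)[OF ij(1), of q] by auto
      qed
      ultimately have "p dvd k i" using pp by (simp add: prime_dvd_mult_iff)
      then have "p \<le> k i" using Nm(4)[OF ij(1)] by (rule dvd_imp_le)
      moreover have "p > NC" using A(3) p IT(2)[OF ij(1)] unfolding NC_def by blast
      ultimately show False using Nm(3)[OF ij(1)] by simp
    qed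
    moreover have "snd i \<in> extensional (fst i)" "snd j \<in> extensional (fst i)"
      using ij(1,2) T by (auto simp: I_def PiE_def)
    ultimately have "snd i = snd j" by (intro extensionalityI[of "snd i" "fst i"]) auto
    then show "i = j" using T by (simp add: prod_eq_iff)
  qed
  \<comment> \<open>The sup norm. The sum is organized by its shells, of at most
    \<open>54 m^2\<close> points; \<open>mx^3 \<le> \<Prod>T\<close> turns the weights into
    \<open>m powr (- 3 - 3 * e)\<close>, so each shell contributes like
    \<open>m powr (- 1 - 3 * e)\<close>.\<close>
  define mx where "mx a = nat (max \<bar>fst a\<bar> (max \<bar>fst (snd a)\<bar> \<bar>snd (snd a)\<bar>))" for a :: "int \<times> int \<times> int"
  define M where "M = Max (insert 1 ((\<lambda>i. mx (u i, v i, w i)) ` I))"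
  have mxM: "mx (u i, v i, w i) \<le> M" if "i \<in> I" for i
    unfolding M_def using Ifin that by (intro Max_ge) auto
  have mx1: "mx (u i, v i, w i) \<ge> 1" "mx (u i, v i, w i) \<le> b i" if "i \<in> I" for i
    using al'[OF that] unfolding mx_def by auto
  define Sh where "Sh m = {a. mx a = m}" for m
  have Sh: "finite (Sh m)" "card (Sh m) \<le> 54 * m^2" if "m \<ge> 1" for m
  proof -
    define J where "J = {- int m..int m}"
    define S where "S = ({- int m, int m} \<times> J \<times> J) \<union> (J \<times> {- int m, int m} \<times> J) \<union> (J \<times> J \<times> {- int m, int m})"
    have sub: "Sh m \<subseteq> S"
    proof
      fix a assume a: "a \<in> Sh m"
      obtain x y z where xyz: "a = (x, y, z)" by (rule prod_cases3)
      have maxD: "X \<le> N \<and> Y \<le> N \<and> Z \<le> N \<and> (X = N \<or> Y = N \<or> Z = N)" if "max X (max Y Z) = N" for X Y Z N :: int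
        using that by (auto simp: max_def split: if_splits)
      have "nat (max \<bar>x\<bar> (max \<bar>y\<bar> \<bar>z\<bar>)) = m" using a unfolding Sh_def mx_def xyz by simp
      then have "max \<bar>x\<bar> (max \<bar>y\<bar> \<bar>z\<bar>) = int m" using that by (metis int_nat_eq le_max_iff_disj abs_ge_zero)
      from maxD[OF this] have le: "\<bar>x\<bar> \<le> int m" "\<bar>y\<bar> \<le> int m" "\<bar>z\<bar> \<le> int m"
        and eq: "\<bar>x\<bar> = int m \<or> \<bar>y\<bar> = int m \<or> \<bar>z\<bar> = int m" by simp_all
      have J: "x \<in> J" "y \<in> J" "z \<in> J" using le unfolding J_def abs_le_iff by simp_all
      have E: "t \<in> {- int m, int m}" if "\<bar>t\<bar> = int m" for t using that by (auto simp: abs_if split: if_splits)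
      show "a \<in> S" using eq J E unfolding S_def xyz by blast
    qed
    have Sfin: "finite S" by (simp add: S_def J_def)
    show "finite (Sh m)" by (rule finite_subset[OF sub Sfin])
    have J: "card J = 2 * m + 1" by (simp add: J_def)
    have two: "card {- int m, int m} \<le> 2" by (simp add: card_insert_if)
    have "card (Sh m) \<le> card S" by (rule card_mono[OF Sfin sub])
    also have "\<dots> \<le> card ({- int m, int m} \<times> J \<times> J) + card (J \<times> {- int m, int m} \<times> J) + card (J \<times> J \<times> {- int m, int m})"
      unfolding S_def by (meson card_Un_le add_le_mono le_trans order_refl)
    also have "\<dots> = 3 * (card {- int m, int m} * (2 * m + 1)^2)"
    proof -
      have "c * (n * n) + n * (c * n) + n * (n * c) = 3 * (c * (n * n))" for c n :: nat
        by (simp add: algebra_simps)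
      then show ?thesis by (simp only: card_cartesian_product J power2_eq_square)
    qed
    also have "\<dots> \<le> 3 * (2 * (3 * m)^2)"
      using two that by (intro mult_le_mono power_mono order_refl) auto
    also have "\<dots> = 54 * m^2" by (simp add: power_mult_distrib)
    finally show "card (Sh m) \<le> 54 * m^2" .
  qed
  have "(\<Prod>p\<in>A. 1 + 3 * real p powr (- 1 - e)) = (\<Sum>T\<in>Pow A. \<Prod>p\<in>T. 3 * real p powr (- 1 - e))"
    using prod_add[OF A(1), of "\<lambda>p. 3 * real p powr (- 1 - e)" "\<lambda>_. 1"] by (simp add: add.commute)
  also have "\<dots> = (\<Sum>T\<in>Pow A. \<Sum>c\<in>PiE T (cubic_roots P Q). real (\<Prod>T) powr (- 1 - e))"
  proof (rule sum.cong[OF refl])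
    fix T assume "T \<in> Pow A"
    then have T: "T \<subseteq> A" "finite T" using A(1) by (auto intro: finite_subset)
    have "(\<Prod>p\<in>T. 3 * real p powr (- 1 - e)) = 3 ^ card T * (\<Prod>p\<in>T. real p powr (- 1 - e))"
      by (simp add: prod.distrib)
    also have "(\<Prod>p\<in>T. real p powr (- 1 - e)) = real (\<Prod>T) powr (- 1 - e)"
      using T(2) by (induction T rule: finite_induct) (auto simp: powr_mult)
    also have "(3::real) ^ card T = real (card (PiE T (cubic_roots P Q)))"
    proof -
      have "card (PiE T (cubic_roots P Q)) = (\<Prod>p\<in>T. card (cubic_roots P Q p))" by (rule card_PiE[OF T(2)])
      also have "\<dots> = (\<Prod>p\<in>T. 3)" using T(1) Ap(2) by (intro prod.cong) auto
      also have "\<dots> = 3 ^ card T" by simp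
      finally show ?thesis by simp
    qed
    finally show "(\<Prod>p\<in>T. 3 * real p powr (- 1 - e)) = (\<Sum>c\<in>PiE T (cubic_roots P Q). real (\<Prod>T) powr (- 1 - e))"
      by simp
  qed
  also have "\<dots> = (\<Sum>i\<in>I. real (\<Prod>(fst i)) powr (- 1 - e))"
    unfolding I_def using A(1)
    by (subst sum.Sigma) (auto intro!: finite_PiE intro: finite_subset[OF _ A(1)] simp: case_prod_beta)
  also have "\<dots> \<le> (\<Sum>i\<in>I. real (mx (u i, v i, w i)) powr (- 3 - 3 * e))"
  proof (rule sum_mono)
    fix i assume i: "i \<in> I"
    have "mx (u i, v i, w i) ^ 3 \<le> b i ^ 3" using mx1(2)[OF i] by (intro power_mono) auto
    also have "\<dots> \<le> \<Prod>(fst i)" by (rule al'(1)[OF i])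
    finally have "real (mx (u i, v i, w i) ^ 3) \<le> real (\<Prod>(fst i))" by (rule of_nat_mono)
    then have le: "real (mx (u i, v i, w i)) ^ 3 \<le> real (\<Prod>(fst i))" by (simp only: of_nat_power)
    have m0: "real (mx (u i, v i, w i)) > 0" using mx1(1)[OF i] by simp
    have "real (\<Prod>(fst i)) powr (- 1 - e) \<le> (real (mx (u i, v i, w i)) ^ 3) powr (- 1 - e)"
      using le m0 e by (intro powr_mono2') auto
    also have "\<dots> = (real (mx (u i, v i, w i)) powr 3) powr (- 1 - e)" using m0 by (simp add: powr_numeral)
    also have "\<dots> = real (mx (u i, v i, w i)) powr (3 * (- 1 - e))" by (simp only: powr_powr)
    also have "3 * (- 1 - e) = - 3 - 3 * e" by simp
    finally show "real (\<Prod>(fst i)) powr (- 1 - e) \<le> real (mx (u i, v i, w i)) powr (- 3 - 3 * e)" .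
  qed
  also have "\<dots> = (\<Sum>x\<in>g ` I. real (mx (fst x)) powr (- 3 - 3 * e))"
    using inj by (subst sum.reindex) (auto simp: g_def)
  also have "\<dots> \<le> (\<Sum>x\<in>(\<Union>m\<in>{1..M}. Sh m) \<times> {1..NC}. real (mx (fst x)) powr (- 3 - 3 * e))"
  proof (rule sum_mono2)
    show "finite ((\<Union>m\<in>{1..M}. Sh m) \<times> {1..NC})" using Sh(1) by auto
    show "g ` I \<subseteq> (\<Union>m\<in>{1..M}. Sh m) \<times> {1..NC}"
      using mxM mx1(1) Nm(3,4) by (auto simp: g_def Sh_def Suc_le_eq)
  qed simp
  also have "\<dots> = (\<Sum>a\<in>(\<Union>m\<in>{1..M}. Sh m). \<Sum>k\<in>{1..NC}. real (mx a) powr (- 3 - 3 * e))"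
    by (subst sum.cartesian_product) (simp add: case_prod_beta)
  also have "\<dots> = real NC * (\<Sum>a\<in>(\<Union>m\<in>{1..M}. Sh m). real (mx a) powr (- 3 - 3 * e))"
    by (simp add: sum_distrib_left)
  also have "(\<Sum>a\<in>(\<Union>m\<in>{1..M}. Sh m). real (mx a) powr (- 3 - 3 * e)) =
     (\<Sum>m=1..M. \<Sum>a\<in>Sh m. real (mx a) powr (- 3 - 3 * e))"
    using Sh(1) by (intro sum.UNION_disjoint) (auto simp: Sh_def)
  also have "\<dots> \<le> (\<Sum>m=1..M. 54 * real m powr (- 1 - 3 * e))"
  proof (rule sum_mono)
    fix m assume m: "m \<in> {1..M}"
    have "(\<Sum>a\<in>Sh m. real (mx a) powr (- 3 - 3 * e)) = real (card (Sh m)) * real m powr (- 3 - 3 * e)"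
      by (simp add: Sh_def)
    also have "\<dots> \<le> real (54 * m^2) * real m powr (- 3 - 3 * e)"
      using Sh(2)[of m] m by (intro mult_right_mono of_nat_mono) auto
    also have "\<dots> = 54 * (real m powr 2 * real m powr (- 3 - 3 * e))" using m by (simp add: powr_numeral)
    also have "real m powr 2 * real m powr (- 3 - 3 * e) = real m powr (2 + (- 3 - 3 * e))"
      by (simp only: powr_add)
    also have "2 + (- 3 - 3 * e) = - 1 - 3 * e" by simp
    finally show "(\<Sum>a\<in>Sh m. real (mx a) powr (- 3 - 3 * e)) \<le> 54 * real m powr (- 1 - 3 * e)" .
  qed
  also have "\<dots> = 54 * (\<Sum>m=1..M. real m powr (- 1 - 3 * e))" by (simp add: sum_distrib_left)
  also have "\<dots> \<le> 54 * (1 + 1 / (3 * e))" using e by (intro mult_left_mono sum_powr_le) auto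
  finally show ?thesis using NC by (simp add: NC_def mult_ac)
qed

text \<open>Were the sum bounded, Mertens would give split primes the full weight
  \<open>ln ln x\<close> up to a constant. The Euler product would then be at least a constant times
  \<open>(ln x) powr (3/2)\<close>, against the upper bound of order \<open>ln x\<close>.\<close>

theorem sum_nonsplit_unbounded:
  "\<exists>x. (\<Sum>p\<in>primes_le x - split_primes P Q. ln (real p) / real p) > K"
proof (rule ccontr)
  assume "\<not> ?thesis"
  then have bnd: "(\<Sum>p\<in>primes_le x - split_primes P Q. ln (real p) / real p) \<le> K" for x
    by (meson linorder_not_le)
  obtain C where C: "\<And>n. n \<ge> 2 \<Longrightarrow> (\<Sum>p\<in>primes_le n. 1 / real p) \<ge> ln (ln (real n)) - C"
    by (rule mertens_second) blast
  define NC where "NC = norm_bound P Q"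
  have NC: "NC \<ge> 1" unfolding NC_def by (rule norm_bound_pos)
  define N0 where "N0 = max NC 9"
  define C' where "C' = C + K / ln 2 + real N0"
  define M where "M = 2 * (3 / 2 * C' + 9 + ln (108 * real NC))"
  define x where "x = nat \<lceil>exp (exp (\<bar>M\<bar> + 1))\<rceil>"
  have "exp (exp (\<bar>M\<bar> + 1)) \<le> real x" unfolding x_def by (rule real_nat_ceiling_ge)
  moreover have "exp 1 \<le> exp (exp (\<bar>M\<bar> + 1))" by simp
  ultimately have x: "exp (exp (\<bar>M\<bar> + 1)) \<le> real x" "exp 1 \<le> real x" by linarith+
  have "real x \<ge> 2" using x(2) exp_ge_add_one_self[of 1] by linarith
  then have x2: "x \<ge> 2" by simp
  define L where "L = ln (real x)"
  have L: "exp (\<bar>M\<bar> + 1) \<le> L" "L \<ge> 1" unfolding L_def using x x2 by (auto simp: ln_ge_iff)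
  have lnL: "\<bar>M\<bar> + 1 \<le> ln L" using L by (subst ln_ge_iff) auto
  \<comment> \<open>With this choice \<open>p powr (- e) \<ge> 1/2\<close> for all
    \<open>p \<le> x\<close>, so half of the exponent 3 survives, still more than 1, while
    \<open>1 / e\<close> is only \<open>2 * L\<close>.\<close>
  define e where "e = 1 / (2 * L)"
  have e: "e > 0" using L by (simp add: e_def)
  define A where "A = {p\<in>split_primes P Q \<inter> primes_le x. p > N0}"
  have Afin: "finite A" by (simp add: A_def)
  have Ap: "prime p" "p \<le> x" "p > N0" if "p \<in> A" for p
    using that by (auto simp: A_def primes_le_def)
  have up: "(\<Prod>p\<in>A. 1 + 3 * real p powr (- 1 - e)) \<le> 54 * real NC * (1 + 1 / (3 * e))"
    unfolding NC_def by (rule euler_product_le[OF Afin _ _ e]) (auto simp: A_def N0_def NC_def)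
  also have "1 + 1 / (3 * e) \<le> 2 * L" using L(2) by (simp add: e_def)
  then have "54 * real NC * (1 + 1 / (3 * e)) \<le> 54 * real NC * (2 * L)" by (intro mult_left_mono) auto
  finally have up: "(\<Prod>p\<in>A. 1 + 3 * real p powr (- 1 - e)) \<le> 108 * real NC * L" by simp
  have low: "exp (3 / 2 * (1 / real p) - 9 * (1 / (real p * (real p - 1)))) \<le> 1 + 3 * real p powr (- 1 - e)"
    if p: "p \<in> A" for p
  proof -
    have p9: "real p > 9" using Ap(3)[OF p] by (simp add: N0_def)
    define y where "y = 3 * real p powr (- 1 - e)"
    have pw: "real p powr (- 1 - e) = real p powr (- e) / real p"
      using p9 powr_add[of "real p" "- e" "-1"] by (simp add: powr_minus divide_inverse add.commute)
    have "e * ln (real p) \<le> e * L"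
      unfolding L_def using Ap(2)[OF p] p9 e by (intro mult_left_mono) auto
    also have "e * L = 1 / 2" using L(2) by (simp add: e_def)
    finally have "1 / 2 \<le> 1 + - (e * ln (real p))" by simp
    also have "\<dots> \<le> exp (- (e * ln (real p)))" by (rule exp_ge_add_one_self)
    also have "\<dots> = real p powr (- e)" using p9 by (simp add: powr_def)
    finally have half: "1 / 2 \<le> real p powr (- e)" .
    have le1: "real p powr (- e) \<le> 1" using p9 e powr_mono[of "- e" 0 "real p"] by simp
    have "(1 / 2) / real p \<le> real p powr (- e) / real p" using half p9 by (intro divide_right_mono) auto
    then have y1: "y \<ge> 3 / 2 * (1 / real p)" unfolding y_def pw by simp
    have "real p powr (- e) / real p \<le> 1 / real p" using le1 p9 by (intro divide_right_mono) auto
    then have y2: "y \<le> 3 * (1 / real p)" unfolding y_def pw by simp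
    have y0: "y \<ge> 0" by (simp add: y_def)
    have "3 * (1 / real p) \<le> 1" using p9 by simp
    then have y3: "y \<le> 1" using y2 by linarith
    have "y^2 \<le> (3 * (1 / real p))^2" using y2 y0 by (rule power_mono)
    also have "\<dots> = 9 * (1 / (real p * real p))" by (simp add: power2_eq_square)
    also have "\<dots> \<le> 9 * (1 / (real p * (real p - 1)))"
      using p9 by (intro mult_left_mono divide_left_mono) auto
    finally have "3 / 2 * (1 / real p) - 9 * (1 / (real p * (real p - 1))) \<le> y - y^2" using y1 by linarith
    also have "\<dots> \<le> ln (1 + y)" by (rule ln_one_plus_pos_lower_bound[OF y0 y3])
    finally have "exp (3 / 2 * (1 / real p) - 9 * (1 / (real p * (real p - 1)))) \<le> exp (ln (1 + y))" by simp
    also have "\<dots> = 1 + y" using y0 by simp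
    finally show ?thesis unfolding y_def .
  qed
  have "exp (\<Sum>p\<in>A. 3 / 2 * (1 / real p) - 9 * (1 / (real p * (real p - 1))))
     = (\<Prod>p\<in>A. exp (3 / 2 * (1 / real p) - 9 * (1 / (real p * (real p - 1)))))" by (rule exp_sum[OF Afin])
  also have "\<dots> \<le> (\<Prod>p\<in>A. 1 + 3 * real p powr (- 1 - e))" using low by (intro prod_mono) auto
  also have "\<dots> \<le> 108 * real NC * L" by (rule up)
  finally have "ln (exp (\<Sum>p\<in>A. 3 / 2 * (1 / real p) - 9 * (1 / (real p * (real p - 1))))) \<le> ln (108 * real NC * L)"
    using NC L(2) by (subst ln_le_cancel_iff) auto
  then have 1: "(\<Sum>p\<in>A. 3 / 2 * (1 / real p) - 9 * (1 / (real p * (real p - 1)))) \<le> ln (108 * real NC) + ln L"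
    using NC L(2) by (simp add: ln_mult)
  have 2: "(\<Sum>p\<in>A. 3 / 2 * (1 / real p) - 9 * (1 / (real p * (real p - 1)))) =
     3 / 2 * (\<Sum>p\<in>A. 1 / real p) - 9 * (\<Sum>p\<in>A. 1 / (real p * (real p - 1)))"
    by (simp only: sum_subtractf sum_distrib_left)
  have 3: "(\<Sum>p\<in>A. 1 / (real p * (real p - 1))) \<le> 1"
  proof -
    have "(\<Sum>p\<in>A. 1 / (real p * (real p - 1))) \<le> (\<Sum>p\<in>{1<..x}. 1 / (real p * (real p - 1)))"
    proof (rule sum_mono2)
      show "A \<subseteq> {1<..x}"
      proof
        fix p assume "p \<in> A"
        then show "p \<in> {1<..x}" using Ap[of p] prime_gt_1_nat[of p] by simp
      qed
    qed auto
    also have "\<dots> \<le> 1 / real 1" by (rule sum_telescope_le) simp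
    finally show ?thesis by simp
  qed
  have 4: "(\<Sum>p\<in>A. 1 / real p) \<ge> ln L - C'"
  proof -
    have "(\<Sum>p\<in>primes_le x. 1 / real p) \<le> (\<Sum>p\<in>A \<union> (primes_le x - split_primes P Q) \<union> {1..N0}. 1 / real p)"
      using Afin by (intro sum_mono2) (auto simp: A_def primes_le_def Suc_le_eq prime_gt_0_nat)
    also have "\<dots> \<le> (\<Sum>p\<in>A \<union> (primes_le x - split_primes P Q). 1 / real p) + (\<Sum>p\<in>{1..N0}. 1 / real p)"
      using Afin by (subst sum_Un) (auto intro!: sum_nonneg)
    also have "(\<Sum>p\<in>A \<union> (primes_le x - split_primes P Q). 1 / real p) \<le> (\<Sum>p\<in>A. 1 / real p) + (\<Sum>p\<in>primes_le x - split_primes P Q. 1 / real p)"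
      using Afin by (subst sum_Un) (auto intro!: sum_nonneg)
    also have "(\<Sum>p\<in>{1..N0}. 1 / real p) \<le> (\<Sum>p\<in>{1..N0}. 1)" by (intro sum_mono) auto
    also have "(\<Sum>p\<in>{1..N0}. (1::real)) = real N0" by simp
    also have "(\<Sum>p\<in>primes_le x - split_primes P Q. 1 / real p) \<le> K / ln 2"
    proof -
      have "(\<Sum>p\<in>primes_le x - split_primes P Q. 1 / real p) \<le> (\<Sum>p\<in>primes_le x - split_primes P Q. (ln (real p) / real p) / ln 2)"
      proof (rule sum_mono)
        fix p assume "p \<in> primes_le x - split_primes P Q"
        then have "p \<ge> 2" using prime_ge_2_nat by (auto simp: primes_le_def)
        then have "ln 2 \<le> ln (real p)" by simp
        then show "1 / real p \<le> (ln (real p) / real p) / ln 2"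
          using \<open>p \<ge> 2\<close> by (simp add: field_simps)
      qed
      also have "\<dots> = (\<Sum>p\<in>primes_le x - split_primes P Q. ln (real p) / real p) / ln 2"
        by (simp only: sum_divide_distrib)
      also have "\<dots> \<le> K / ln 2" using bnd[of x] by (intro divide_right_mono) auto
      finally show ?thesis .
    qed
    finally show ?thesis using C[OF x2] by (simp add: C'_def L_def)
  qed
  have "3 / 2 * (l - c) - 9 \<le> r" if "3 / 2 * s - 9 * t \<le> r" "t \<le> 1" "l - c \<le> s" for l c r s t :: real
    using that by argo
  from this[OF 1[unfolded 2] 3 4]
  have "3 / 2 * (ln L - C') - 9 \<le> ln (108 * real NC) + ln L" .
  then have "ln L \<le> M" unfolding M_def by (simp add: algebra_simps)
  then show False using lnL by linarith
qed

end

section \<open>Cubic polynomials\<close>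

text \<open>If \<open>p\<close> divides the resultant of \<open>cubic P Q X\<close> and \<open>cubic P Q (X + t)\<close> then the two polynomials have a
  common root modulo \<open>p\<close>; it is rational because it generates the common factor.\<close>
lemma common_root:
  fixes p :: nat and P Q t :: int
  assumes p: "prime p" and n3Q: "\<not> int p dvd 6 * Q"
    and g: "int p dvd t^2 * (t^2 + 3 * P)^2 + (4 * P^3 + 27 * Q^2)"
  shows "\<exists>y. int p dvd cubic P Q y \<and> int p dvd cubic P Q (y + t)"
proof -
  have pi: "prime (int p)" using p by simp
  define m where "m = t^2 + P"
  have n2: "\<not> int p dvd 2" "\<not> int p dvd 3" "\<not> int p dvd Q"
  proof -
    show "\<not> int p dvd 2"
    proof
      assume "int p dvd 2"
      then have "int p dvd 2 * (3 * Q)" by (rule dvd_mult2)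
      then show False using n3Q by simp
    qed
    show "\<not> int p dvd 3"
    proof
      assume "int p dvd 3"
      then have "int p dvd 3 * (2 * Q)" by (rule dvd_mult2)
      then show False using n3Q by simp
    qed
    show "\<not> int p dvd Q" using n3Q dvd_mult by blast
  qed
  have geq: "t^2 * (t^2 + 3 * P)^2 + (4 * P^3 + 27 * Q^2) = m * (t^4 + 5 * t^2 * P + 4 * P^2) + 27 * Q^2"
    unfolding m_def by algebra
  \<comment> \<open>If \<open>p\<close> divided \<open>m\<close>, the resultant would reduce to
    \<open>27 * Q^2\<close>.\<close>
  have nm: "\<not> int p dvd m"
  proof
    assume "int p dvd m"
    then have "int p dvd 27 * Q^2" using g unfolding geq by (metis dvd_add_right_iff dvd_mult2)
    also have "27 * Q^2 = 3 * (3 * (3 * (Q * Q)))" by (simp add: power2_eq_square)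
    finally show False using n2 pi by (simp only: prime_dvd_mult_iff) simp
  qed
  have n2m: "\<not> int p dvd 2 * m" using n2 nm pi by (simp only: prime_dvd_mult_iff) simp
  \<comment> \<open>The zero of the linear remainder in Euclid's algorithm:
    \<open>3 * cubic P Q X\<close> is
    \<open>(X - t) (3 X^2 + 3 t X + t^2 + P) + 2 m X + t m + 3 Q\<close>.\<close>
  obtain y where y: "int p dvd 2 * m * y + (t * m + 3 * Q)" using prime_linear_solution[OF p n2m] by blast
  have canc: "int p dvd x" if "int p dvd (2 * m)^3 * x" for x
    using that n2m pi by (metis prime_dvd_multD prime_dvd_power)
  have "(2 * m)^3 * cubic P Q y = (2 * m * y + (t * m + 3 * Q)) *
      ((2 * m * y)^2 - (2 * m * y) * (t * m + 3 * Q) + (t * m + 3 * Q)^2 + 4 * P * m^2)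
      - (t * m + Q) * (t^2 * (t^2 + 3 * P)^2 + (4 * P^3 + 27 * Q^2))"
    unfolding cubic_def m_def by algebra
  then have "int p dvd (2 * m)^3 * cubic P Q y" using y g by (metis dvd_diff dvd_mult dvd_mult2)
  then have 1: "int p dvd cubic P Q y" by (rule canc)
  have "(2 * m)^3 * cubic P Q (y + t) = (2 * m * y + (t * m + 3 * Q)) *
      ((2 * m * (y + t))^2 + (2 * m * (y + t)) * (t * m - 3 * Q) + (t * m - 3 * Q)^2 + 4 * P * m^2)
      - (Q - t * m) * (t^2 * (t^2 + 3 * P)^2 + (4 * P^3 + 27 * Q^2))"
    unfolding cubic_def m_def by algebra
  then have "int p dvd (2 * m)^3 * cubic P Q (y + t)" using y g by (metis dvd_diff dvd_mult dvd_mult2)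
  then have 2: "int p dvd cubic P Q (y + t)" by (rule canc)
  show ?thesis using 1 2 by blast
qed

text \<open>The roots sum to zero, so \<open>- 2 y - t\<close> is the third. The discriminant is the
  square of the product of the differences \<open>t\<close>, \<open>3 y + t\<close>,
  \<open>3 y + 2 t\<close>, whence distinctness.\<close>

lemma split_prime_of_two_roots:
  fixes p :: nat and P Q t y :: int
  assumes p: "prime p" and nD: "\<not> int p dvd 4 * P^3 + 27 * Q^2"
    and y: "int p dvd cubic P Q y" "int p dvd cubic P Q (y + t)" and t: "\<not> int p dvd t"
  shows "p \<in> split_primes P Q"
proof -
  have pi: "prime (int p)" using p by simp
  define al where "al = 3 * y^2 + 3 * y * t + t^2 + P"
  have "t * al = cubic P Q (y + t) - cubic P Q y" unfolding al_def cubic_def by algebra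
  then have "int p dvd t * al" using y by (simp add: dvd_diff)
  then have al: "int p dvd al" using t pi prime_dvd_multD by blast
  have "cubic P Q (- 2 * y - t) = al * (- 3 * y - t) + cubic P Q y" unfolding al_def cubic_def by algebra
  then have r3: "int p dvd cubic P Q (- 2 * y - t)" using al y(1) by (simp add: dvd_add)
  have disc: "4 * P^3 + 27 * Q^2 = - (t^2 * (3 * y + t)^2 * (3 * y + 2 * t)^2)
     + (al * (4 * (P^2 + P * (P - al) + (P - al)^2)) + (cubic P Q y - al * y) * (27 * (Q + (Q - (cubic P Q y - al * y)))))"
    unfolding al_def cubic_def by algebra
  have tail: "int p dvd al * (4 * (P^2 + P * (P - al) + (P - al)^2)) + (cubic P Q y - al * y) * (27 * (Q + (Q - (cubic P Q y - al * y))))"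
    using al y(1) by (intro dvd_add[OF dvd_mult2 dvd_mult2] dvd_diff dvd_mult2)
  have n: "\<not> int p dvd 3 * y + t" "\<not> int p dvd 3 * y + 2 * t"
  proof -
    have sq: "int p dvd 4 * P^3 + 27 * Q^2" if "int p dvd t^2 * (3 * y + t)^2 * (3 * y + 2 * t)^2"
      unfolding disc by (rule dvd_add[OF _ tail]) (simp only: dvd_minus_iff that)
    show "\<not> int p dvd 3 * y + t"
    proof
      assume "int p dvd 3 * y + t"
      then have "int p dvd t^2 * (3 * y + t)^2 * (3 * y + 2 * t)^2"
        by (intro dvd_mult2[of _ "t^2 * (3 * y + t)^2"] dvd_mult[of _ "(3 * y + t)^2"]) (simp add: power2_eq_square)
      then show False using sq nD by blast
    qed
    show "\<not> int p dvd 3 * y + 2 * t"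
    proof
      assume "int p dvd 3 * y + 2 * t"
      then have "int p dvd t^2 * (3 * y + t)^2 * (3 * y + 2 * t)^2"
        by (intro dvd_mult[of _ "(3 * y + 2 * t)^2"]) (simp add: power2_eq_square)
      then show False using sq nD by blast
    qed
  qed
  define r where "r x = x mod int p" for x
  have req: "int p dvd x - x'" if "r x = r x'" for x x' using that unfolding r_def by (simp only: mod_eq_dvd_iff)
  have mem: "r x \<in> cubic_roots P Q p" if "int p dvd cubic P Q x" for x
    unfolding r_def by (rule cubic_root_mod[OF p that])
  have "r y \<noteq> r (y + t)"
  proof
    assume "r y = r (y + t)"
    from req[OF this] show False using t by simp
  qed
  moreover have "r y \<noteq> r (- 2 * y - t)"
  proof
    assume "r y = r (- 2 * y - t)"
    from req[OF this] show False using n(1) by simp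
  qed
  moreover have "r (y + t) \<noteq> r (- 2 * y - t)"
  proof
    assume "r (y + t) = r (- 2 * y - t)"
    from req[OF this] show False using n(2) by (simp add: algebra_simps)
  qed
  ultimately have "card {r y, r (y + t), r (- 2 * y - t)} = 3" by simp
  moreover have "card {r y, r (y + t), r (- 2 * y - t)} \<le> card (cubic_roots P Q p)"
    using mem y r3 by (intro card_mono) auto
  ultimately have "card (cubic_roots P Q p) = 3" using card_cubic_roots[OF p, of P Q] by simp
  then show ?thesis using p by (simp add: split_primes_def)
qed

text \<open>Greedy choice of residue classes: each prime removes at least the average proportion.\<close>
lemma greedy_cover:
  fixes f :: "int poly" and rho :: "nat \<Rightarrow> nat" and R :: "nat set"
  assumes "finite Ps" "\<And>p. p \<in> Ps \<Longrightarrow> p > 0"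
    and "\<And>p. p \<in> Ps \<Longrightarrow> rho p \<le> card {r\<in>{0..<int p}. int p dvd poly f r}"
    and "finite R"
  shows "\<exists>c U. U \<subseteq> R \<and> (\<forall>i\<in>R - U. \<exists>p\<in>Ps. int p dvd poly f (c p + int i)) \<and>
    real (card U) \<le> real (card R) * exp (- (\<Sum>p\<in>Ps. real (rho p) / real p))"
  using assms
proof (induction Ps arbitrary: R rule: finite_induct)
  case empty
  show ?case by (intro exI[of _ "\<lambda>_. 0"] exI[of _ R]) auto
next
  case (insert q Ps)
  define Z where "Z = {r\<in>{0..<int q}. int q dvd poly f r}"

  have q: "q > 0" and rho: "rho q \<le> card Z" using insert.prems(1)[of q] insert.prems(2)[of q] by (simp_all add: Z_def)
  define H where "H c = {i\<in>R. int q dvd poly f (c + int i)}" for c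
  have Hfin: "finite (H c)" for c using insert.prems(3) by (simp add: H_def)
  \<comment> \<open>Every term \<open>i\<close> is hit by at least \<open>rho q\<close> of the
    \<open>q\<close> positions; averaging over positions finds one that hits the proportion
    \<open>rho q / q\<close>.\<close>
  have per: "card Z \<le> card {c\<in>{0..<int q}. int q dvd poly f (c + int i)}" for i
  proof (rule card_inj_on_le)
    show "inj_on (\<lambda>r. (r - int i) mod int q) Z"
    proof (rule inj_onI)
      fix x y assume xy: "x \<in> Z" "y \<in> Z" "(x - int i) mod int q = (y - int i) mod int q"
      then have "int q dvd (x - int i) - (y - int i)" by (simp only: mod_eq_dvd_iff)
      then have "int q dvd x - y" by simp
      then have "x mod int q = y mod int q" by (simp only: mod_eq_dvd_iff)
      then show "x = y" using xy(1,2) by (simp add: Z_def)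
    qed
    show "(\<lambda>r. (r - int i) mod int q) ` Z \<subseteq> {c\<in>{0..<int q}. int q dvd poly f (c + int i)}"
    proof
      fix c assume "c \<in> (\<lambda>r. (r - int i) mod int q) ` Z"
      then obtain r where r: "r \<in> Z" "c = (r - int i) mod int q" by blast
      have "int q dvd c - (r - int i)" unfolding r(2) by (simp add: mod_eq_dvd_iff[symmetric])
      then have "int q dvd (c + int i) - r" by (simp add: algebra_simps)
      then have "int q dvd poly f (c + int i)" by (rule dvd_poly_shift) (use r in \<open>simp add: Z_def\<close>)
      then show "c \<in> {c\<in>{0..<int q}. int q dvd poly f (c + int i)}" using q r(2) by simp
    qed
    show "finite {c\<in>{0..<int q}. int q dvd poly f (c + int i)}"
      by (rule finite_subset[of _ "{0..<int q}"]) auto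
  qed
  have "\<exists>c0. card R * rho q \<le> q * card (H c0)"
  proof (rule ccontr)
    assume "\<not> ?thesis"
    then have lt: "q * card (H c0) < card R * rho q" for c0 by (meson linorder_not_le)
    have "(\<Sum>c\<in>{0..<int q}. card (H c)) = (\<Sum>c\<in>{0..<int q}. \<Sum>i\<in>R. if int q dvd poly f (c + int i) then 1 else 0)"
      using insert.prems(3) by (simp add: H_def sum.If_cases Int_def)
    also have "\<dots> = (\<Sum>i\<in>R. \<Sum>c\<in>{0..<int q}. if int q dvd poly f (c + int i) then 1 else 0)" by (rule sum.swap)
    also have "\<dots> = (\<Sum>i\<in>R. card {c\<in>{0..<int q}. int q dvd poly f (c + int i)})"
      by (intro sum.cong refl) (simp add: sum.If_cases Int_def conj_ac)
    also have "\<dots> \<ge> (\<Sum>i\<in>R. rho q)" by (intro sum_mono le_trans[OF rho per])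
    finally have "card R * rho q \<le> (\<Sum>c\<in>{0..<int q}. card (H c))" by simp
    then have "q * (card R * rho q) \<le> (\<Sum>c\<in>{0..<int q}. q * card (H c))" by (simp add: sum_distrib_left[symmetric])
    also have "\<dots> < (\<Sum>c\<in>{0..<int q}. card R * rho q)" using lt q by (intro sum_strict_mono) auto
    also have "\<dots> = q * (card R * rho q)" by simp
    finally show False by simp
  qed
  then obtain c0 where c0: "card R * rho q \<le> q * card (H c0)" by blast
  define R1 where "R1 = R - H c0"
  have "real (card R) * real (rho q) \<le> real q * real (card (H c0))"
    using of_nat_mono[OF c0, where 'a = real] by simp
  then have "real (card R) * (real (rho q) / real q) \<le> real (card (H c0))" using q by (simp add: field_simps)
  moreover have "card R1 = card R - card (H c0)" "card (H c0) \<le> card R"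
    unfolding R1_def using Hfin insert.prems(3) by (auto simp: H_def intro!: card_Diff_subset card_mono)
  ultimately have "real (card R1) \<le> real (card R) * (1 + - (real (rho q) / real q))"
    by (simp add: of_nat_diff algebra_simps)
  also have "\<dots> \<le> real (card R) * exp (- (real (rho q) / real q))"
    by (intro mult_left_mono exp_ge_add_one_self) auto
  finally have R1: "real (card R1) \<le> real (card R) * exp (- (real (rho q) / real q))" .
  have "finite R1" using insert.prems(3) by (simp add: R1_def)
  then have "\<exists>c U. U \<subseteq> R1 \<and> (\<forall>i\<in>R1 - U. \<exists>p\<in>Ps. int p dvd poly f (c p + int i)) \<and>
    real (card U) \<le> real (card R1) * exp (- (\<Sum>p\<in>Ps. real (rho p) / real p))"
    using insert.prems by (intro insert.IH) auto
  then obtain c U where "U \<subseteq> R1 \<and> (\<forall>i\<in>R1 - U. \<exists>p\<in>Ps. int p dvd poly f (c p + int i)) \<and>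
    real (card U) \<le> real (card R1) * exp (- (\<Sum>p\<in>Ps. real (rho p) / real p))" by (elim exE)
  then have U: "U \<subseteq> R1" "\<And>i. i \<in> R1 - U \<Longrightarrow> \<exists>p\<in>Ps. int p dvd poly f (c p + int i)"
    "real (card U) \<le> real (card R1) * exp (- (\<Sum>p\<in>Ps. real (rho p) / real p))" by blast+
  have "U \<subseteq> R" using U(1) by (auto simp: R1_def)
  moreover have "\<exists>p\<in>insert q Ps. int p dvd poly f ((c(q := c0)) p + int i)" if i: "i \<in> R - U" for i
  proof (cases "i \<in> H c0")
    case True
    then show ?thesis by (simp add: H_def)
  next
    case False
    then obtain p where "p \<in> Ps" "int p dvd poly f (c p + int i)" using U(2)[of i] i by (auto simp: R1_def)
    moreover from this have "p \<noteq> q" using insert.hyps by auto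
    ultimately show ?thesis by auto
  qed
  moreover have "real (card U) \<le> real (card R) * exp (- (\<Sum>p\<in>insert q Ps. real (rho p) / real p))"
  proof -
    have "real (card R1) * exp (- (\<Sum>p\<in>Ps. real (rho p) / real p)) \<le>
       (real (card R) * exp (- (real (rho q) / real q))) * exp (- (\<Sum>p\<in>Ps. real (rho p) / real p))"
      using R1 by (intro mult_right_mono) auto
    also have "\<dots> = real (card R) * exp (- (\<Sum>p\<in>insert q Ps. real (rho p) / real p))"
      using insert.hyps by (simp add: exp_add[symmetric] mult.assoc)
    finally show ?thesis using U(3) by linarith
  qed
  ultimately show ?case by blast
qed

text \<open>The resultant at \<open>t = l s\<close> equals \<open>E * W s\<close> with
  \<open>W s = 1 + mu * (psi s)^2\<close>, because \<open>l^2 = mu * E\<close>. So prime factors of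
  \<open>W\<close> avoid all primes dividing \<open>l\<close>, where roots could degenerate, and the
  six roots of \<open>W\<close> modulo \<open>p\<close> lift uniquely.\<close>

lemma resultant_sequence:
  fixes P Q a :: int
  defines "E \<equiv> 4 * P^3 + 27 * Q^2"
  defines "l \<equiv> 6 * a * E * Q * (1 + \<bar>P\<bar>)"
  assumes nz: "a \<noteq> 0" "Q \<noteq> 0" "E \<noteq> 0"
  obtains C :: nat and w :: "nat \<Rightarrow> nat" where "C \<ge> 1"
    "\<And>s. s \<ge> 1 \<Longrightarrow> s ^ 6 \<le> w s" "\<And>s. s \<ge> 1 \<Longrightarrow> w s \<le> C * s ^ 6"
    "\<And>p e S. prime p \<Longrightarrow> e \<ge> 1 \<Longrightarrow>
       real (card {s\<in>{1..S}. p ^ e dvd w s}) \<le> real 6 * (real S / real p ^ e + 1)"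
    "\<And>p s. prime p \<Longrightarrow> p dvd w s \<Longrightarrow> \<not> int p dvd l * int s"
    "\<And>p s. prime p \<Longrightarrow> p dvd w s \<Longrightarrow> int p dvd (l * int s)^2 * ((l * int s)^2 + 3 * P)^2 + E"
proof -
  define mu where "mu = 36 * a^2 * E * Q^2 * (1 + \<bar>P\<bar>)^2"
  define psi where "psi s = s * ((l * s)^2 + 3 * P)" for s
  define W where "W s = 1 + mu * (psi s)^2" for s
  define w where "w s = nat \<bar>W (int s)\<bar>" for s
  have lmu: "l^2 = mu * E" unfolding l_def mu_def by algebra
  have EW: "E * W s = (l * s)^2 * ((l * s)^2 + 3 * P)^2 + E" for s
    unfolding W_def psi_def power_mult_distrib lmu by algebra
  have mu0: "mu \<noteq> 0" unfolding mu_def using nz by simp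
  have l0: "l \<noteq> 0" unfolding l_def using nz by (simp add: add_nonneg_eq_0_iff)
  have dvdw: "int m dvd W (int s) \<longleftrightarrow> m dvd w s" for m s
    using of_nat_dvd_iff[of m "w s", where 'a = int] by (simp add: w_def)
  have dvd1: False if "prime p" "int p dvd W s" "int p dvd mu * (psi s)^2" for p :: nat and s
  proof -
    have "int p dvd 1" using that(2,3) unfolding W_def by (simp only: dvd_add_left_iff)
    then show False using prime_gt_1_nat[OF that(1)] by simp
  qed
  have nmu: "\<not> int p dvd mu" "\<not> int p dvd psi s" "\<not> int p dvd 6 * a * E * Q * (1 + \<bar>P\<bar>)" "\<not> int p dvd s"
    if pW: "prime p" "int p dvd W s" for p :: nat and s
  proof -
    show 1: "\<not> int p dvd mu" using dvd1[OF pW] dvd_mult2 by blast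
    show 2: "\<not> int p dvd psi s"
    proof
      assume "int p dvd psi s"
      then have "int p dvd mu * (psi s)^2" by (simp add: power2_eq_square)
      then show False by (rule dvd1[OF pW])
    qed
    show "\<not> int p dvd 6 * a * E * Q * (1 + \<bar>P\<bar>)"
    proof
      assume "int p dvd 6 * a * E * Q * (1 + \<bar>P\<bar>)"
      then have "int p dvd 6 * a * E * Q * (1 + \<bar>P\<bar>) * (6 * a * Q * (1 + \<bar>P\<bar>))" by (rule dvd_mult2)
      also have "\<dots> = mu" unfolding mu_def by algebra
      finally show False using 1 by simp
    qed
    show "\<not> int p dvd s" using 2 unfolding psi_def by (meson dvd_mult2)
  qed
  define g where "g = [:1, 0, 9 * mu * P^2, 0, 6 * mu * l^2 * P, 0, mu * l^4:]"
  have g: "poly g s = W s" for s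
  proof -
    have "poly g s = 1 + s^2 * (9 * mu * P^2 + s^2 * (6 * mu * l^2 * P + s^2 * (mu * l^4)))"
      unfolding g_def by (simp add: power2_eq_square mult.assoc)
    also have "\<dots> = W s" unfolding W_def psi_def by algebra
    finally show ?thesis .
  qed
  have gdeg: "degree g = 6" "lead_coeff g = mu * l^4" unfolding g_def using mu0 l0 by auto
  \<comment> \<open>Uniqueness in Hensel's lemma: \<open>W s - W s'\<close> is \<open>s - s'\<close>
    times factors that are units modulo \<open>p\<close> as soon as the two roots agree modulo
    \<open>p\<close>.\<close>
  have hensel: "int p ^ e dvd s - s'"
    if pp: "prime p" and e: "e \<ge> 1" and d: "int p ^ e dvd W s" "int p ^ e dvd W s'" "int p dvd s - s'" for p e :: nat and s s'
  proof -
    have pi: "prime (int p)" using pp by simp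
    have pe: "int p dvd int p ^ e" using e by (simp add: dvd_power)
    have d1: "int p dvd W s" "int p dvd W s'" using d pe dvd_trans by blast+
    note n = nmu[OF pp d1(1)]
    have n6: "\<not> int p dvd 2" "\<not> int p dvd 3" "\<not> int p dvd Q"
    proof -
      have eqs: "6 * a * E * Q * (1 + \<bar>P\<bar>) = 2 * (3 * a * E * Q * (1 + \<bar>P\<bar>))"
        "6 * a * E * Q * (1 + \<bar>P\<bar>) = 3 * (2 * a * E * Q * (1 + \<bar>P\<bar>))"
        "6 * a * E * Q * (1 + \<bar>P\<bar>) = Q * (6 * a * E * (1 + \<bar>P\<bar>))" by algebra+
      show "\<not> int p dvd 2" using n(3) unfolding eqs(1) by (meson dvd_mult2)
      show "\<not> int p dvd 3" using n(3) unfolding eqs(2) by (meson dvd_mult2)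
      show "\<not> int p dvd Q" using n(3) unfolding eqs(3) by (meson dvd_mult2)
    qed
    have psidiff: "psi s - psi s' = (s - s') * (l^2 * (s^2 + s * s' + s'^2) + 3 * P)"
      unfolding psi_def by algebra
    have "int p dvd psi s - psi s'" unfolding psidiff using d(3) by (rule dvd_mult2)
    have nsum: "\<not> int p dvd psi s + psi s'"
    proof
      assume "int p dvd psi s + psi s'"
      then have "int p dvd (psi s + psi s') + (psi s - psi s')" using \<open>int p dvd psi s - psi s'\<close> by (rule dvd_add)
      then have "int p dvd 2 * psi s" by simp
      then show False using n6(1) n(2) pi prime_dvd_multD by blast
    qed
    \<comment> \<open>Modulo \<open>p\<close> this factor is \<open>3 * ((l s)^2 + P)\<close>. Its
      vanishing reduces \<open>E * W s\<close> to \<open>27 * Q^2\<close>, as for the common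
      root.\<close>
    have nfac: "\<not> int p dvd l^2 * (s^2 + s * s' + s'^2) + 3 * P"
    proof
      assume "int p dvd l^2 * (s^2 + s * s' + s'^2) + 3 * P"
      then have "int p dvd (l^2 * (s^2 + s * s' + s'^2) + 3 * P) + (s - s') * (l^2 * (2 * s + s'))"
        by (rule dvd_add[OF _ dvd_mult2[OF d(3)]])
      also have "\<dots> = 3 * ((l * s)^2 + P)" by algebra
      finally have m: "int p dvd (l * s)^2 + P" using n6(2) pi prime_dvd_multD by blast
      have "int p dvd E * W s" using d1(1) by (rule dvd_mult)
      moreover have "E * W s = ((l * s)^2 + P) * ((l * s)^4 + 5 * (l * s)^2 * P + 4 * P^2) + 27 * Q^2"
        unfolding EW unfolding E_def by algebra
      ultimately have "int p dvd 27 * Q^2" using m by (metis dvd_add_right_iff dvd_mult2)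
      also have "27 * Q^2 = 3 * (3 * (3 * (Q * Q)))" by (simp add: power2_eq_square)
      finally show False using n6 pi by (simp only: prime_dvd_mult_iff) simp
    qed
    have "int p ^ e dvd W s - W s'" using d(1,2) by (rule dvd_diff)
    also have "W s - W s' = (mu * (psi s + psi s')) * ((l^2 * (s^2 + s * s' + s'^2) + 3 * P) * (s - s'))"
    proof -
      have "W s - W s' = (mu * (psi s + psi s')) * (psi s - psi s')" unfolding W_def by algebra
      then show ?thesis unfolding psidiff by (simp only: mult_ac)
    qed
    finally have "int p ^ e dvd (mu * (psi s + psi s')) * ((l^2 * (s^2 + s * s' + s'^2) + 3 * P) * (s - s'))" .
    moreover have "\<not> int p dvd mu * (psi s + psi s')" using n(1) nsum pi prime_dvd_multD by blast
    then have "coprime (int p ^ e) (mu * (psi s + psi s'))"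
      using prime_imp_power_coprime[OF pi] coprime_commute by blast
    ultimately have "int p ^ e dvd (l^2 * (s^2 + s * s' + s'^2) + 3 * P) * (s - s')"
      using coprime_dvd_mult_right_iff by blast
    moreover have "coprime (int p ^ e) (l^2 * (s^2 + s * s' + s'^2) + 3 * P)"
      using prime_imp_power_coprime[OF pi nfac] coprime_commute by blast
    ultimately show "int p ^ e dvd s - s'" using coprime_dvd_mult_right_iff by blast
  qed
  define C where "C = nat (1 + \<bar>mu\<bar> * (l^2 + 3 * \<bar>P\<bar>)^2)"
  show ?thesis
  proof (rule that[of C w])
    have "0 \<le> \<bar>mu\<bar> * (l^2 + 3 * \<bar>P\<bar>)^2" by simp
    then have "nat 1 \<le> C" unfolding C_def by (intro nat_mono) simp
    then show "1 \<le> C" by simp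
  next
    fix p s :: nat assume p: "prime p" "p dvd w s"
    then have pW: "int p dvd W (int s)" using dvdw by simp
    have "\<not> int p dvd l" unfolding l_def using nmu(3)[OF p(1) pW] .
    then show "\<not> int p dvd l * int s" using nmu(4)[OF p(1) pW] prime_dvd_multD[of "int p" l "int s"] p(1) by auto
    show "int p dvd (l * int s)^2 * ((l * int s)^2 + 3 * P)^2 + E"
      unfolding EW[symmetric] using pW by (rule dvd_mult)
  next
    fix s :: nat assume s: "s \<ge> 1"
    define x where "x = (l * int s)^2 + 3 * P"
    define q where "q = 1 + \<bar>P\<bar>"
    have s2: "(int s)^2 \<ge> 1" using s by (simp add: self_le_power)
    have q1: "q \<ge> 1" by (simp add: q_def)
    \<comment> \<open>The factor \<open>1 + |P|\<close> in \<open>l\<close> makes \<open>l^2\<close>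
      outweigh \<open>3 * P\<close> even when \<open>P\<close> is negative; \<open>mu\<close> may be
      negative as well, which is why \<open>psi^2\<close> must exceed \<open>s^6\<close> with room
      to spare.\<close>
    have x2: "x \<ge> 2 * (int s)^2"
    proof -
      have "\<bar>a * E * Q\<bar> \<ge> 1" using nz by (simp add: int_one_le_iff_zero_less)
      then have "\<bar>a * E * Q\<bar>^2 \<ge> 1" by (rule one_le_power)
      then have "(a * E * Q)^2 \<ge> 1" by simp
      then have "36 * (a * E * Q)^2 * q^2 \<ge> 36 * 1 * q^2" by (intro mult_right_mono mult_left_mono) auto
      also have "36 * (a * E * Q)^2 * q^2 = l^2" unfolding l_def q_def by algebra
      finally have l2: "l^2 \<ge> 36 * q^2" by simp
      have "q^2 \<ge> q" using q1 by (simp add: self_le_power)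
      then have l2': "l^2 \<ge> 36 * q" using l2 by linarith
      have "l^2 * (int s)^2 \<ge> (36 * q) * (int s)^2" using l2' by (intro mult_right_mono) auto
      then have "l^2 * (int s)^2 \<ge> 36 * (q * (int s)^2)" by (simp only: mult.assoc)
      moreover have "q * (int s)^2 \<ge> q * 1" using s2 q1 by (intro mult_left_mono) auto
      moreover have "q * (int s)^2 \<ge> 1 * (int s)^2" using q1 by (intro mult_right_mono) auto
      moreover have "x = l^2 * (int s)^2 + 3 * P" unfolding x_def by (simp add: power_mult_distrib)
      moreover have "P \<ge> - q" unfolding q_def by linarith
      ultimately show ?thesis using q1 by linarith
    qed
    have xle: "x \<le> (l^2 + 3 * \<bar>P\<bar>) * (int s)^2"
    proof -
      have "\<bar>P\<bar> * 1 \<le> \<bar>P\<bar> * (int s)^2" using s2 by (intro mult_left_mono) auto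
      then have "P \<le> \<bar>P\<bar> * (int s)^2" by linarith
      then show ?thesis unfolding x_def by (simp add: power_mult_distrib algebra_simps)
    qed
    have x0: "x \<ge> 0" using x2 s2 by linarith
    have psix: "(psi (int s))^2 = (int s)^2 * x^2" unfolding psi_def x_def by (simp add: power_mult_distrib)
    have Weq: "W (int s) = 1 + mu * ((int s)^2 * x^2)" unfolding W_def psix ..
    have abs: "\<bar>mu * ((int s)^2 * x^2)\<bar> = \<bar>mu\<bar> * ((int s)^2 * x^2)" by (simp add: abs_mult)
    have "(2 * (int s)^2)^2 \<le> x^2" using x2 by (intro power_mono) auto
    then have "(int s)^2 * (2 * (int s)^2)^2 \<le> (int s)^2 * x^2" by (intro mult_left_mono) auto
    also have "(int s)^2 * (2 * (int s)^2)^2 = 4 * (int s)^6" by (simp add: power_mult_distrib flip: power_add power_mult)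
    finally have y4: "4 * (int s)^6 \<le> (int s)^2 * x^2" .
    have "1 * ((int s)^2 * x^2) \<le> \<bar>mu\<bar> * ((int s)^2 * x^2)" using mu0 by (intro mult_right_mono) auto
    then have lo: "4 * (int s)^6 \<le> \<bar>mu * ((int s)^2 * x^2)\<bar>" using y4 abs by linarith
    have s6: "(int s)^6 \<ge> 1" using s by simp
    have "(int s)^6 \<le> \<bar>W (int s)\<bar>" unfolding Weq using lo s6 by linarith
    then have "int (s^6) \<le> int (w s)" unfolding w_def by simp
    then show "s ^ 6 \<le> w s" by (simp only: of_nat_le_iff)
    have "x^2 \<le> ((l^2 + 3 * \<bar>P\<bar>) * (int s)^2)^2" using xle x0 by (rule power_mono)
    then have "\<bar>mu\<bar> * ((int s)^2 * x^2) \<le> \<bar>mu\<bar> * ((int s)^2 * ((l^2 + 3 * \<bar>P\<bar>) * (int s)^2)^2)"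
      by (intro mult_left_mono) auto
    also have "\<dots> = \<bar>mu\<bar> * (l^2 + 3 * \<bar>P\<bar>)^2 * (int s)^6" by algebra
    finally have "\<bar>W (int s)\<bar> \<le> 1 + \<bar>mu\<bar> * (l^2 + 3 * \<bar>P\<bar>)^2 * (int s)^6"
      unfolding Weq using abs by linarith
    also have "\<dots> \<le> (1 + \<bar>mu\<bar> * (l^2 + 3 * \<bar>P\<bar>)^2) * (int s)^6" using s6 by (simp add: algebra_simps)
    also have "\<dots> = int (C * s^6)" unfolding C_def by simp
    finally have "int (w s) \<le> int (C * s^6)" unfolding w_def by simp
    then show "w s \<le> C * s ^ 6" by (simp only: of_nat_le_iff)
  next
    fix p e S :: nat assume p: "prime p" and e: "e \<ge> 1"
    have pi: "prime (int p)" using p by simp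
    define A where "A = {s\<in>{1..S}. p ^ e dvd w s}"
    have AW: "int p ^ e dvd W (int s)" "int p dvd W (int s)" if "s \<in> A" for s
    proof -
      have "int (p ^ e) dvd W (int s)" using that dvdw[of "p ^ e" s] by (simp add: A_def)
      then show 1: "int p ^ e dvd W (int s)" by simp
      have "int p dvd int p ^ e" using e by (simp add: dvd_power)
      then show "int p dvd W (int s)" using 1 dvd_trans by blast
    qed
    define R where "R = (\<lambda>s. s mod p ^ e) ` A"
    have Rfin: "finite R" unfolding R_def A_def by simp
    have "card R \<le> 6"
    proof (cases "A = {}")
      case True
      then show ?thesis by (simp add: R_def)
    next
      case False
      then obtain s0 where s0: "s0 \<in> A" by blast
      have pdvd: "p dvd p ^ e" using e by (simp add: dvd_power)
      define T where "T = (\<lambda>s. int s mod int p) ` A"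
      have "card R \<le> card T"
      proof (rule card_inj_on_le)
        show "inj_on (\<lambda>r. int r mod int p) R"
        proof (rule inj_onI)
          fix r r' assume r: "r \<in> R" "r' \<in> R" "int r mod int p = int r' mod int p"
          obtain s where s: "s \<in> A" "r = s mod p ^ e" using r(1) by (auto simp: R_def)
          obtain s' where s': "s' \<in> A" "r' = s' mod p ^ e" using r(2) by (auto simp: R_def)
          have "int (r mod p) = int (r' mod p)" using r(3) by (simp only: zmod_int)
          then have "s mod p = s' mod p" unfolding s(2) s'(2) using pdvd by (simp add: mod_mod_cancel)
          then have "int s mod int p = int s' mod int p" by (simp only: zmod_int[symmetric])
          then have "int p dvd int s - int s'" by (simp only: mod_eq_dvd_iff)
          then have "int p ^ e dvd int s - int s'"
            by (rule hensel[OF p e AW(1)[OF s(1)] AW(1)[OF s'(1)]])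
          then have "int s mod int (p ^ e) = int s' mod int (p ^ e)" by (simp add: mod_eq_dvd_iff)
          then have "int (s mod p ^ e) = int (s' mod p ^ e)" by (simp only: zmod_int)
          then show "r = r'" using s s' by simp
        qed
        show "(\<lambda>r. int r mod int p) ` R \<subseteq> T"
        proof
          fix y assume "y \<in> (\<lambda>r. int r mod int p) ` R"
          then obtain s where s: "s \<in> A" "y = int (s mod p ^ e) mod int p" by (auto simp: R_def)
          have "y = int (s mod p ^ e mod p)" using s(2) by (simp only: zmod_int)
          also have "\<dots> = int (s mod p)" using pdvd by (simp add: mod_mod_cancel)
          also have "\<dots> = int s mod int p" by (simp only: zmod_int)
          finally show "y \<in> T" using s(1) by (simp add: T_def)
        qed
        show "finite T" by (simp add: T_def A_def)
      qed
      also have "card T \<le> degree g"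
      proof (rule card_roots_mod_prime[OF pi])
        have n: "\<not> int p dvd mu" "\<not> int p dvd l"
          using nmu(1,3)[OF p AW(2)[OF s0]] unfolding l_def by blast+
        show "\<not> int p dvd lead_coeff g"
          unfolding gdeg(2) using n pi by (metis prime_dvd_multD prime_dvd_power)
        show "finite T" by (simp add: T_def A_def)
        fix x assume "x \<in> T"
        then obtain s where s: "s \<in> A" "x = int s mod int p" by (auto simp: T_def)
        have "int p dvd x - int s" unfolding s(2) by (simp add: mod_eq_dvd_iff[symmetric])
        then show "int p dvd poly g x" by (rule dvd_poly_shift) (simp only: g AW(2)[OF s(1)])
      next
        fix x y assume xy: "x \<in> T" "y \<in> T" "int p dvd x - y"
        then have "x mod int p = y mod int p" by (simp only: mod_eq_dvd_iff)
        then show "x = y" using xy(1,2) by (auto simp: T_def)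
      qed
      finally show ?thesis by (simp only: gdeg(1))
    qed
    then have "real (card A) \<le> real 6 * (real S / real (p ^ e) + 1)"
      using p by (intro card_le_residues[OF _ Rfin]) (auto simp: A_def R_def prime_gt_0_nat)
    then show "real (card {s\<in>{1..S}. p ^ e dvd w s}) \<le> real 6 * (real S / real p ^ e + 1)"
      by (simp add: A_def)
  qed
qed

context irreducible_cubic
begin

text \<open>The pool is proportional to \<open>sigma / ln X\<close> with a constant depending on the
  cubic, so the sieve must beat this for arbitrarily small \<open>c\<close>. Omitting the primes
  that divide \<open>n\<close> costs a bounded factor.\<close>

lemma sieve_bound:
  fixes c :: real and n :: int
  assumes c: "c > 0" and n: "n \<noteq> 0"
  shows "\<exists>X0. \<forall>X\<ge>X0. exp (- (\<Sum>p\<in>{p\<in>primes_le X. \<not> int p dvd n}. real (card (cubic_roots P Q p)) / real p))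
    \<le> c * (\<Sum>p\<in>primes_le X - split_primes P Q. ln (real p) / real p) / ln (real X)"
proof -
  define h where "h X = (\<Sum>p\<in>{p\<in>primes_le X. \<not> int p dvd n}. real (card (cubic_roots P Q p)) / real p)" for X
  define sg where "sg X = (\<Sum>p\<in>primes_le X - split_primes P Q. ln (real p) / real p)" for X
  define t1 where "t1 X = (\<Sum>p\<in>root_primes P Q \<inter> primes_le X. 1 / real p)" for X
  define t3 where "t3 X = (\<Sum>p\<in>split_primes P Q \<inter> primes_le X. 1 / real p)" for X
  define tn where "tn X = (\<Sum>p\<in>primes_le X - split_primes P Q. 1 / real p)" for X
  define N where "N = {p. prime p \<and> int p dvd n}"
  have Nfin: "finite N"
  proof (rule finite_subset)
    show "N \<subseteq> {..nat \<bar>n\<bar>}"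
    proof
      fix p assume "p \<in> N"
      then have "int p dvd n" by (simp add: N_def)
      then have "\<bar>int p\<bar> \<le> \<bar>n\<bar>" using n by (rule dvd_imp_le_int[rotated])
      then show "p \<in> {..nat \<bar>n\<bar>}" by (simp add: le_nat_iff)
    qed
  qed simp
  define K3 where "K3 = real (card N)"
  have Nsum: "(\<Sum>p\<in>N. 1 / real p) \<le> K3"
  proof -
    have "(\<Sum>p\<in>N. 1 / real p) \<le> (\<Sum>p\<in>N. 1)"
    proof (rule sum_mono)
      fix p assume "p \<in> N"
      then have "p \<ge> 1" by (intro prime_ge_1_nat) (simp add: N_def)
      then show "1 / real p \<le> 1" by simp
    qed
    then show ?thesis by (simp add: K3_def)
  qed
  have lnp: "ln (real p) / real p \<ge> 0" if "p \<in> primes_le X" for p X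
    using that prime_ge_1_nat[of p] by (auto simp: primes_le_def)
  have rest: "(\<Sum>p\<in>B. 1 / real p) \<le> (\<Sum>p\<in>B - N. 1 / real p) + K3" if "finite B" for B
  proof -
    have "(\<Sum>p\<in>B. 1 / real p) \<le> (\<Sum>p\<in>(B - N) \<union> N. 1 / real p)"
      using that Nfin by (intro sum_mono2) auto
    also have "\<dots> = (\<Sum>p\<in>B - N. 1 / real p) + (\<Sum>p\<in>N. 1 / real p)"
      using that Nfin by (intro sum.union_disjoint) auto
    finally show ?thesis using Nsum by linarith
  qed
  have h1: "h X \<ge> t1 X - K3" for X
  proof -
    have "t1 X \<le> (\<Sum>p\<in>root_primes P Q \<inter> primes_le X - N. 1 / real p) + K3" unfolding t1_def by (rule rest) simp
    also have "(\<Sum>p\<in>root_primes P Q \<inter> primes_le X - N. 1 / real p) \<le>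
       (\<Sum>p\<in>root_primes P Q \<inter> primes_le X - N. real (card (cubic_roots P Q p)) / real p)"
    proof (intro sum_mono divide_right_mono)
      fix p assume "p \<in> root_primes P Q \<inter> primes_le X - N"
      then obtain r where r: "prime p" "int p dvd cubic P Q r" by (auto simp: root_primes_def)
      have "r mod int p \<in> cubic_roots P Q p" by (rule cubic_root_mod[OF r])
      then have "card (cubic_roots P Q p) \<noteq> 0" by auto
      then show "1 \<le> real (card (cubic_roots P Q p))" by linarith
    qed simp
    also have "\<dots> \<le> h X" unfolding h_def by (intro sum_mono2) (auto simp: N_def primes_le_def)
    finally show ?thesis by simp
  qed
  have h3: "h X \<ge> 3 * t3 X - 3 * K3" for X
  proof -
    have "t3 X \<le> (\<Sum>p\<in>split_primes P Q \<inter> primes_le X - N. 1 / real p) + K3" unfolding t3_def by (rule rest) simp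
    moreover have "3 * (\<Sum>p\<in>split_primes P Q \<inter> primes_le X - N. 1 / real p) =
       (\<Sum>p\<in>split_primes P Q \<inter> primes_le X - N. real (card (cubic_roots P Q p)) / real p)"
      unfolding sum_distrib_left by (intro sum.cong) (auto simp: split_primes_def)
    moreover have "\<dots> \<le> h X" unfolding h_def by (intro sum_mono2) (auto simp: N_def primes_le_def)
    ultimately show ?thesis by argo
  qed
  obtain C where C1: "\<And>m. m \<ge> 2 \<Longrightarrow> (\<Sum>p\<in>primes_le m. 1 / real p) \<le> ln (ln (real m)) + C"
    and C2: "\<And>m. m \<ge> 2 \<Longrightarrow> (\<Sum>p\<in>primes_le m. 1 / real p) \<ge> ln (ln (real m)) - C"
    by (rule mertens_second) blast
  define C9 where "C9 = exp (3 * K3 + 6 * C + 3)"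
  \<comment> \<open>The threshold between the two cases: below it the cubic gain satisfies
    \<open>C9 * z^3 \<le> C9 * ep * z \<le> c * z\<close> for \<open>z = sigma / ln X\<close>; above
    it the right-hand side is at least \<open>c * ep\<close>, a constant.\<close>
  define ep where "ep = min 1 (c / C9)"
  have ep: "ep > 0" "ep \<le> 1" "C9 * ep \<le> c"
    unfolding ep_def C9_def using c by (auto simp: min_def field_simps)
  obtain Xa where Xa: "t1 Xa > K3 - ln (c * ep)"
    using sum_root_primes_unbounded[of "K3 - ln (c * ep)"] unfolding t1_def by blast
  obtain Xb where Xb: "sg Xb > 1" using sum_nonsplit_unbounded[of 1] unfolding sg_def by blast
  have t1m: "t1 x \<le> t1 y" if "x \<le> y" for x y
    unfolding t1_def using that by (intro sum_mono2) (auto simp: primes_le_def)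
  have sgm: "sg x \<le> sg y" if "x \<le> y" for x y
    unfolding sg_def using that lnp by (intro sum_mono2) (auto simp: primes_le_def)
  show ?thesis
  proof (intro exI[of _ "max 3 (max Xa Xb)"] allI impI)
    fix X assume X: "X \<ge> max 3 (max Xa Xb)"
    define L where "L = ln (real X)"
    have L0: "L > 0" using X by (simp add: L_def)
    have s1: "sg X > 1" using Xb sgm[of Xb X] X by simp
    have "exp (- h X) \<le> c * sg X / L"
    proof (cases "sg X \<ge> ep * L")
      case True
      have "- h X \<le> ln (c * ep)" using h1[of X] Xa t1m[of Xa X] X by simp
      then have "exp (- h X) \<le> exp (ln (c * ep))" by simp
      also have "\<dots> = c * ep" using c ep by simp
      also have "\<dots> \<le> c * sg X / L"
        using mult_left_mono[OF True, of c] c L0 by (simp add: pos_le_divide_eq mult_ac)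
      finally show ?thesis .
    next
      case False
      \<comment> \<open>Cutting at \<open>exp sigma\<close> bounds the reciprocals of non-split
        primes: up to \<open>y\<close> Mertens gives \<open>ln sigma + C\<close>, beyond it each
        \<open>1 / p\<close> is at most \<open>(ln p / p) / sigma\<close>, and these add up to at
        most 1.\<close>
      define y where "y = nat \<lfloor>exp (sg X)\<rfloor>"
      have "exp (sg X) \<ge> 1 + sg X" by (rule exp_ge_add_one_self)
      then have e2: "exp (sg X) \<ge> 2" using s1 by linarith
      then have y2: "y \<ge> 2" unfolding y_def by (simp add: le_nat_floor)
      have yle: "real y \<le> exp (sg X)" unfolding y_def using e2 by simp
      have ygt: "exp (sg X) < real y + 1" unfolding y_def using e2 by linarith
      have tn: "tn X \<le> ln (sg X) + C + 1"
      proof -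
        define G where "G = primes_le X - split_primes P Q"
        have Gp: "prime p" if "p \<in> G" for p using that by (auto simp: G_def primes_le_def)
        have "tn X \<le> (\<Sum>p\<in>primes_le y \<union> (G - primes_le y). 1 / real p)"
          unfolding tn_def by (intro sum_mono2) (auto simp: G_def)
        also have "\<dots> = (\<Sum>p\<in>primes_le y. 1 / real p) + (\<Sum>p\<in>G - primes_le y. 1 / real p)"
          by (intro sum.union_disjoint) (auto simp: G_def)
        also have "(\<Sum>p\<in>primes_le y. 1 / real p) \<le> ln (ln (real y)) + C" by (rule C1[OF y2])
        also have "ln (ln (real y)) \<le> ln (sg X)"
        proof -
          have "ln (real y) \<le> ln (exp (sg X))" using yle y2 by (subst ln_le_cancel_iff) auto
          then have "ln (real y) \<le> sg X" by simp
          then show ?thesis using y2 s1 by (subst ln_le_cancel_iff) auto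
        qed
        also have "(\<Sum>p\<in>G - primes_le y. 1 / real p) \<le> (\<Sum>p\<in>G - primes_le y. (ln (real p) / real p) / sg X)"
        proof (rule sum_mono)
          fix p assume p: "p \<in> G - primes_le y"
          then have "p > y" using Gp[of p] by (auto simp: primes_le_def)
          then have "exp (sg X) \<le> real p" using ygt by linarith
          then have "sg X \<le> ln (real p)" using \<open>p > y\<close> by (subst ln_ge_iff) auto
          then have "sg X / real p \<le> ln (real p) / real p" by (intro divide_right_mono) auto
          then have "(sg X / real p) / sg X \<le> (ln (real p) / real p) / sg X"
            by (rule divide_right_mono) (use s1 in simp)
          moreover have "(sg X / real p) / sg X = 1 / real p" using s1 by simp
          ultimately show "1 / real p \<le> (ln (real p) / real p) / sg X" by linarith
        qed
        also have "\<dots> \<le> (\<Sum>p\<in>G. (ln (real p) / real p) / sg X)"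
        proof (rule sum_mono2)
          fix p assume "p \<in> G - (G - primes_le y)"
          then have "p \<in> primes_le y" by blast
          then show "0 \<le> (ln (real p) / real p) / sg X" using lnp[of p y] s1 by (simp only: divide_nonneg_pos less_trans[OF zero_less_one])
        qed (auto simp: G_def)
        also have "\<dots> = 1" using s1 unfolding sum_divide_distrib[symmetric] sg_def G_def by simp
        finally show ?thesis by simp
      qed
      have "(\<Sum>p\<in>primes_le X. 1 / real p) = t3 X + tn X"
      proof -
        have "primes_le X = (split_primes P Q \<inter> primes_le X) \<union> (primes_le X - split_primes P Q)" by blast
        then have "(\<Sum>p\<in>primes_le X. 1 / real p) = (\<Sum>p\<in>(split_primes P Q \<inter> primes_le X) \<union> (primes_le X - split_primes P Q). 1 / real p)"
          by simp
        also have "\<dots> = t3 X + tn X" unfolding t3_def tn_def by (intro sum.union_disjoint) auto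
        finally show ?thesis .
      qed
      then have "t3 X \<ge> ln L - ln (sg X) - 2 * C - 1"
        using C2[of X] X tn unfolding L_def by simp
      then have "- h X \<le> (3 * K3 + 6 * C + 3) + 3 * ln (sg X / L)"
        using h3[of X] s1 L0 by (simp add: ln_div)
      then have "exp (- h X) \<le> exp ((3 * K3 + 6 * C + 3) + 3 * ln (sg X / L))" by simp
      also have "\<dots> = C9 * (sg X / L)^3"
      proof -
        have "exp (3 * ln (sg X / L)) = exp (ln (sg X / L))^3" by (metis exp_of_nat_mult of_nat_numeral)
        also have "\<dots> = (sg X / L)^3" using s1 L0 by simp
        finally show ?thesis by (simp only: exp_add C9_def)
      qed
      also have "\<dots> \<le> C9 * (ep * (sg X / L))"
      proof (rule mult_left_mono)
        define z where "z = sg X / L"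
        have z: "z \<ge> 0" "z \<le> ep" unfolding z_def using False s1 L0 by (auto simp: pos_divide_le_eq)
        have "z * z \<le> ep * 1" using z ep by (intro mult_mono) auto
        then have "z * z * z \<le> ep * z" using z by (intro mult_right_mono) auto
        then show "(sg X / L)^3 \<le> ep * (sg X / L)" unfolding z_def[symmetric] by (simp add: power3_eq_cube)
      qed (simp add: C9_def)
      also have "\<dots> = (C9 * ep) * (sg X / L)" by simp
      also have "\<dots> \<le> c * (sg X / L)" using ep(3) s1 L0 by (intro mult_right_mono) auto
      finally show ?thesis by simp
    qed
    then show "exp (- (\<Sum>p\<in>{p\<in>primes_le X. \<not> int p dvd n}. real (card (cubic_roots P Q p)) / real p))
      \<le> c * (\<Sum>p\<in>primes_le X - split_primes P Q. ln (real p) / real p) / ln (real X)"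
      unfolding h_def sg_def L_def .
  qed
qed


lemma nonzero_resultant: "Q \<noteq> 0" "4 * P^3 + 27 * Q^2 \<noteq> 0"
proof -
  show Q: "Q \<noteq> 0"
  proof
    assume "Q = 0"
    then have "0^3 + P * 0 * 1^2 + Q * 1^3 = (0::int)" by simp
    then show False using no_root by (metis one_neq_zero)
  qed
  show "4 * P^3 + 27 * Q^2 \<noteq> 0"
  proof
    assume E: "4 * P^3 + 27 * Q^2 = 0"
    \<comment> \<open>With vanishing discriminant, \<open>3 Q / P\<close> is a rational root of the
      cubic.\<close>
    have "(3 * Q)^3 + P * (3 * Q) * P^2 + Q * P^3 = Q * (4 * P^3 + 27 * Q^2)" by algebra
    then have "(3 * Q)^3 + P * (3 * Q) * P^2 + Q * P^3 = 0" using E by simp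
    then have "P = 0" by (rule no_root)
    then show False using E Q by simp
  qed
qed

text \<open>The sieve uses all primes up to half the block, the pool only larger ones, so their
  positions never conflict. It remains to compare constants, with \<open>sigma\<close> past the
  point where half of it outlasts the fixed losses.\<close>

lemma irreducible_cubic_coverable:
  fixes a b c d :: int
  assumes a: "a \<noteq> 0" and P: "P = 9 * a * c - 3 * b^2" and Q: "Q = 27 * a^2 * d - 9 * a * b * c + 2 * b^3"
  shows "\<exists>K. \<forall>k\<ge>K. coverable [:d, c, b, a:] 1 k"
proof -
  define f where "f = [:d, c, b, a:]"
  have f: "27 * a^2 * poly f x = cubic P Q (3 * a * x + b)" for x
  proof -
    have "poly f x = d + x * (c + x * (b + x * a))" by (simp add: f_def)
    then show ?thesis unfolding cubic_def P Q by algebra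
  qed
  define E where "E = 4 * P^3 + 27 * Q^2"
  define l where "l = 6 * a * E * Q * (1 + \<bar>P\<bar>)"
  obtain C :: nat and w :: "nat \<Rightarrow> nat" where C: "C \<ge> 1"
    and wl: "\<And>s. s \<ge> 1 \<Longrightarrow> s ^ 6 \<le> w s" and wu: "\<And>s. s \<ge> 1 \<Longrightarrow> w s \<le> C * s ^ 6"
    and wr: "\<And>p e S. prime p \<Longrightarrow> e \<ge> 1 \<Longrightarrow>
       real (card {s\<in>{1..S}. p ^ e dvd w s}) \<le> real 6 * (real S / real p ^ e + 1)"
    and wn: "\<And>p s. prime p \<Longrightarrow> p dvd w s \<Longrightarrow> \<not> int p dvd l * int s"
    and wd: "\<And>p s. prime p \<Longrightarrow> p dvd w s \<Longrightarrow> int p dvd (l * int s)^2 * ((l * int s)^2 + 3 * P)^2 + E"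
    unfolding l_def E_def by (rule resultant_sequence[OF a nonzero_resultant]) blast
  \<comment> \<open>A shift of the argument of \<open>f\<close> by \<open>h * s\<close> shifts the
    depressed variable by \<open>3 a h s = l * s\<close>; thus \<open>q = |h|\<close> is the unit of
    distance within the block.\<close>
  define h where "h = 2 * E * Q * (1 + \<bar>P\<bar>)"
  have lh: "l = 3 * a * h" unfolding l_def h_def by algebra
  define q where "q = nat \<bar>h\<bar>"
  have h0: "h \<noteq> 0" unfolding h_def E_def using nonzero_resultant by (simp add: add_nonneg_eq_0_iff)
  have q: "q \<ge> 1" "int q = \<bar>h\<bar>" unfolding q_def using h0 by auto
  have ndvd: "\<not> int p dvd 3 * a" "\<not> int p dvd E" "\<not> int p dvd 6 * Q" if pw: "prime p" "p dvd w s" for p s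
  proof -
    have n: "\<not> int p dvd l * int s" by (rule wn[OF pw])
    have eqs: "l * int s = (3 * a) * (h * int s)" "l * int s = E * (6 * a * Q * (1 + \<bar>P\<bar>) * int s)"
       "l * int s = (6 * Q) * (a * E * (1 + \<bar>P\<bar>) * int s)"
      unfolding l_def h_def by algebra+
    show "\<not> int p dvd 3 * a" using n unfolding eqs(1) by (meson dvd_mult2)
    show "\<not> int p dvd E" using n unfolding eqs(2) by (meson dvd_mult2)
    show "\<not> int p dvd 6 * Q" using n unfolding eqs(3) by (meson dvd_mult2)
  qed
  have roots: "\<exists>y. int p dvd cubic P Q y \<and> int p dvd cubic P Q (y + l * int s)" if pw: "prime p" "p dvd w s" for p s
    using common_root[OF pw(1) ndvd(3)[OF pw]] wd[OF pw] unfolding E_def by blast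
  have split: "p \<in> split_primes P Q" if pw: "prime p" "p dvd w s" for p s
    using split_prime_of_two_roots[OF pw(1)] roots[OF pw] ndvd(2)[OF pw] wn[OF pw] unfolding E_def by blast
  have f_root: "int p dvd poly f x" if "prime p" "\<not> int p dvd 3 * a" "int p dvd cubic P Q (3 * a * x + b)" for p x
  proof -
    have pi: "prime (int p)" using that by simp
    have "int p dvd (3 * a) * ((3 * a) * (3 * poly f x))" using that(3) f[of x] by (simp add: power2_eq_square mult_ac)
    then have "int p dvd 3 * poly f x" using that(2) pi prime_dvd_multD by blast
    moreover have "\<not> int p dvd 3" using that(2) by (meson dvd_mult2)
    ultimately show ?thesis using pi prime_dvd_multD by blast
  qed
  have rho: "card (cubic_roots P Q p) \<le> card {r\<in>{0..<int p}. int p dvd poly f r}"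
    if p: "prime p" "\<not> int p dvd 3 * a" for p
  proof -
    \<comment> \<open>Inverts the substitution \<open>3 a n + b\<close> modulo \<open>p\<close>,
      carrying roots of the depressed cubic to roots of \<open>f\<close>.\<close>
    define r where "r y = (SOME n. int p dvd 3 * a * n + (b - y)) mod int p" for y
    have r: "int p dvd 3 * a * r y + b - y" for y
    proof -
      define n where "n = (SOME n. int p dvd 3 * a * n + (b - y))"
      have "int p dvd 3 * a * n + (b - y)" unfolding n_def by (rule someI_ex) (rule prime_linear_solution[OF p])
      moreover have "int p dvd r y - n" unfolding r_def n_def by (simp add: mod_eq_dvd_iff[symmetric])
      then have "int p dvd 3 * a * (r y - n)" by (rule dvd_mult)
      ultimately have "int p dvd (3 * a * n + (b - y)) + 3 * a * (r y - n)" by (rule dvd_add)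
      also have "\<dots> = 3 * a * r y + b - y" by (simp add: algebra_simps)
      finally show ?thesis .
    qed
    show ?thesis
    proof (rule card_inj_on_le)
      show "inj_on r (cubic_roots P Q p)"
      proof (rule inj_onI)
        fix x y assume xy: "x \<in> cubic_roots P Q p" "y \<in> cubic_roots P Q p" "r x = r y"
        have "int p dvd (3 * a * r x + b - y) - (3 * a * r x + b - x)" using r[of x] r[of y] xy(3) by (metis dvd_diff)
        then have "int p dvd x - y" by simp
        then have "x mod int p = y mod int p" by (simp only: mod_eq_dvd_iff)
        then show "x = y" using xy(1,2) by (simp add: cubic_roots_def)
      qed
      show "r ` cubic_roots P Q p \<subseteq> {r\<in>{0..<int p}. int p dvd poly f r}"
      proof
        fix z assume "z \<in> r ` cubic_roots P Q p"
        then obtain y where y: "y \<in> cubic_roots P Q p" "z = r y" by blast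
        have "int p dvd poly [:Q, P, 0, 1:] (3 * a * r y + b)"
          by (rule dvd_poly_shift[OF r]) (use y(1) in \<open>simp only: poly_cubic cubic_roots_def mem_Collect_eq\<close>)
        then have "int p dvd poly f z" unfolding y(2) by (intro f_root p) (simp only: poly_cubic)
        moreover have "z \<in> {0..<int p}" unfolding y(2) r_def using prime_gt_0_nat[OF p(1)] by simp
        ultimately show "z \<in> {r\<in>{0..<int p}. int p dvd poly f r}" by simp
      qed
      show "finite {r\<in>{0..<int p}. int p dvd poly f r}" by (rule finite_subset[of _ "{0..<int p}"]) auto
    qed
  qed
  define sg where "sg X = (\<Sum>p\<in>primes_le X - split_primes P Q. ln (real p) / real p)" for X
  have sgm: "sg x \<le> sg y" if "x \<le> y" for x y
    unfolding sg_def using that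
    by (intro sum_mono2) (auto simp: primes_le_def intro!: divide_nonneg_nonneg dest: prime_ge_1_nat)
  \<comment> \<open>The fixed losses: 9 from Chebyshev's method, \<open>ln (2 q)\<close> from
    \<open>X \<le> 2 q S\<close>, and \<open>196 q = 7 * 14 * 2 q\<close> from the primes up to
    \<open>X\<close>. Requiring \<open>sigma > 2 * C6\<close> keeps at least half of
    \<open>sigma\<close>.\<close>
  define C6 where "C6 = 9 + ln (2 * real q) + 196 * real q"
  have C6: "C6 > 0" unfolding C6_def using q by (simp add: add_pos_nonneg)
  define Ps where "Ps X = {p\<in>primes_le X. \<not> int p dvd 3 * a}" for X
  \<comment> \<open>\<open>168 = 3 * 56\<close>, with 3 from \<open>k \<le> 3 * X\<close> and 56
    from the lower bound for the pool below.\<close>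
  obtain X0 where X0: "\<And>X. X \<ge> X0 \<Longrightarrow> exp (- (\<Sum>p\<in>Ps X. real (card (cubic_roots P Q p)) / real p))
    \<le> (1 / (168 * real q)) * sg X / ln (real X)"
    using sieve_bound[of "1 / (168 * real q)" "3 * a"] q a unfolding Ps_def sg_def by auto
  obtain X1 where X1: "sg X1 > 2 * C6" using sum_nonsplit_unbounded[of "2 * C6"] unfolding sg_def by blast
  show ?thesis
  proof (intro exI[of _ "2 * (X0 + X1 + C + 3) + 2 * q + 1"] allI impI)
    fix k assume k: "k \<ge> 2 * (X0 + X1 + C + 3) + 2 * q + 1"
    \<comment> \<open>A prime up to half the block length always has a partner at distance
      \<open>p\<close>, so covering a term once by such a prime suffices.\<close>
    define X where "X = k div 2"
    define S where "S = (k - 1) div (2 * q)"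
    have X: "X \<ge> X0" "X \<ge> X1" "X \<ge> C" "X \<ge> 3" unfolding X_def using k by (simp_all add: less_eq_div_iff_mult_less_eq)
    have kX: "k \<le> 2 * X + 1" "2 * X \<le> k" unfolding X_def by linarith+
    have "2 * q div (2 * q) \<le> S" unfolding S_def using k by (intro div_le_mono) linarith
    then have S1: "S \<ge> 1" using q by simp
    have qS: "2 * (q * S) \<le> k - 1" unfolding S_def using div_times_less_eq_dividend[of "k - 1" "2 * q"] by (simp add: mult_ac)
    have SX: "S \<le> X"
    proof -
      have "1 * S \<le> q * S" using q by (intro mult_le_mono1)
      then show ?thesis using qS kX by linarith
    qed
    have XS: "X \<le> 2 * q * S"
    proof -
      have "k - 1 < 2 * q * (S + 1)" unfolding S_def using q dividend_less_times_div[of "2 * q" "k - 1"] by simp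
      also have "\<dots> \<le> 2 * q * (2 * S)" using S1 by (intro mult_le_mono2) simp
      finally show ?thesis using kX k by linarith
    qed
    have Xr: "real X \<ge> 3" using X by simp
    define L where "L = ln (real X)"
    have L0: "L > 0" unfolding L_def using Xr by simp
    have sgX: "sg X > 2 * C6" using X1 sgm[OF X(2)] by linarith
    define M where "M = {p. prime p \<and> p > X \<and> (\<exists>s\<in>{1..S}. p dvd w s)}"
    have enough: "real X * sg X \<le> 56 * real q * real (card M) * L"
    proof -
      define B where "B = real (C * S ^ 6)"
      have B1: "B \<ge> 1"
      proof -
        have "1 \<le> C * S ^ 6" using C S1 by (simp add: Suc_le_eq)
        then have "real 1 \<le> B" unfolding B_def by (rule of_nat_mono)
        then show ?thesis by simp
      qed
      have bnd: "real (w s) \<le> B" if s: "s \<in> {1..S}" for s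
      proof -
        have "w s \<le> C * s ^ 6" using wu s by simp
        also have "\<dots> \<le> C * S ^ 6" using s by (intro mult_left_mono power_mono) auto
        finally show ?thesis unfolding B_def by (rule of_nat_mono)
      qed
      have lnS: "ln (real S) \<le> L" unfolding L_def using SX S1 by simp
      have lnB: "ln B \<le> 7 * L"
      proof -
        have "ln B = ln (real C) + 6 * ln (real S)"
          unfolding B_def using C S1 by (simp add: ln_mult ln_realpow)
        also have "ln (real C) \<le> L" unfolding L_def using C X(3) by simp
        finally show ?thesis using lnS by simp
      qed
      have "real S * (ln (real S) - ln (real X) + sg X - 9) \<le>
          (real (card (primes_le X)) + real (card M) * (real S / real X + 1)) * ln B"
      proof -
        have "primes_le X - split_primes P Q \<inter> primes_le X = primes_le X - split_primes P Q" by blast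
        then show ?thesis
          using large_primes_lower[of 6 S w B "split_primes P Q \<inter> primes_le X" X] wl wr X S1 B1 bnd split
          unfolding M_def sg_def by (auto simp: primes_le_def)
      qed
      also have "\<dots> \<le> (real (card (primes_le X)) + real (card M) * 2) * (7 * L)"
      proof (intro mult_mono add_mono)
        have "real S / real X \<le> 1" using SX Xr by simp
        then show "real S / real X + 1 \<le> 2" by simp
      qed (use lnB B1 in \<open>auto intro!: add_nonneg_nonneg\<close>)
      also have "\<dots> = 7 * (real (card (primes_le X)) * ln (real X)) + 14 * (real (card M) * L)"
        by (simp add: L_def algebra_simps)
      also have "\<dots> \<le> 7 * (14 * real X) + 14 * (real (card M) * L)"
        by (intro add_mono mult_left_mono card_primes_le_bound order_refl) simp
      also have "\<dots> \<le> 196 * (real q * real S) + 14 * (real (card M) * L)"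
        using of_nat_mono[OF XS, where 'a = real] by (simp add: ac_simps)
      finally have "real S * (ln (real S) - ln (real X) + sg X - 9) - real S * (196 * real q) \<le> 14 * (real (card M) * L)"
        by (simp add: algebra_simps)
      moreover have "real S * (sg X - C6) \<le> real S * (ln (real S) - ln (real X) + sg X - 9 - 196 * real q)"
      proof (rule mult_left_mono)
        have "ln (real X) \<le> ln (2 * real q * real S)"
          using of_nat_mono[OF XS, where 'a = real] Xr S1 q by (subst ln_le_cancel_iff) auto
        also have "\<dots> = ln (2 * real q) + ln (real S)" using q S1 by (subst ln_mult_pos) auto
        finally show "sg X - C6 \<le> ln (real S) - ln (real X) + sg X - 9 - 196 * real q" by (simp add: C6_def)
      qed simp
      ultimately have main: "real S * (sg X - C6) \<le> 14 * (real (card M) * L)"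
        by (simp add: right_diff_distrib)
      have "real X * sg X \<le> real X * (2 * (sg X - C6))" using sgX by (intro mult_left_mono) auto
      also have "\<dots> \<le> (2 * real q * real S) * (2 * (sg X - C6))"
        using of_nat_mono[OF XS, where 'a = real] sgX C6 by (intro mult_right_mono) auto
      also have "\<dots> = 4 * real q * (real S * (sg X - C6))" by simp
      also have "\<dots> \<le> 4 * real q * (14 * (real (card M) * L))" using main by (intro mult_left_mono) auto
      finally show ?thesis by simp
    qed
    \<comment> \<open>An infinite set would have \<open>card\<close> equal to \<open>0\<close>,
      against the positive lower bound.\<close>
    have Mfin: "finite M"
    proof (rule ccontr)
      assume "infinite M"
      then have "real X * sg X \<le> 0" using enough by simp
      moreover have "real X * sg X > 0" using Xr sgX C6 by (intro mult_pos_pos) auto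
      ultimately show False by simp
    qed
    have PsX: "finite (Ps X)" "\<And>p. p \<in> Ps X \<Longrightarrow> prime p \<and> p \<le> X \<and> \<not> int p dvd 3 * a"
      by (auto simp: Ps_def primes_le_def)
    have "\<exists>c U. U \<subseteq> {1..k} \<and> (\<forall>i\<in>{1..k} - U. \<exists>p\<in>Ps X. int p dvd poly f (c p + int i)) \<and>
        real (card U) \<le> real (card {1..k}) * exp (- (\<Sum>p\<in>Ps X. real (card (cubic_roots P Q p)) / real p))"
      using PsX rho prime_gt_0_nat by (intro greedy_cover) auto
    then obtain c0 U where "U \<subseteq> {1..k} \<and> (\<forall>i\<in>{1..k} - U. \<exists>p\<in>Ps X. int p dvd poly f (c0 p + int i)) \<and>
        real (card U) \<le> real (card {1..k}) * exp (- (\<Sum>p\<in>Ps X. real (card (cubic_roots P Q p)) / real p))"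
      by (elim exE)
    then have U: "U \<subseteq> {1..k}" "\<And>i. i \<in> {1..k} - U \<Longrightarrow> \<exists>p\<in>Ps X. int p dvd poly f (c0 p + int i)"
        "real (card U) \<le> real (card {1..k}) * exp (- (\<Sum>p\<in>Ps X. real (card (cubic_roots P Q p)) / real p))"
      by blast+
    have Ufin: "finite U" using U(1) by (rule finite_subset) simp
    have U_le: "card U \<le> card M"
    proof -
      have "real (card U) \<le> real k * ((1 / (168 * real q)) * sg X / L)"
        using U(3) mult_left_mono[OF X0[OF X(1)], of "real k"] unfolding L_def by simp
      also have "\<dots> \<le> (3 * real X) * ((1 / (168 * real q)) * sg X / L)"
      proof (rule mult_right_mono)
        have "k \<le> 3 * X" using kX(1) X by linarith
        then show "real k \<le> 3 * real X" using of_nat_mono[of k "3 * X", where 'a = real] by simp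
        show "0 \<le> (1 / (168 * real q)) * sg X / L" using sgX C6 L0 by simp
      qed
      also have "\<dots> = (real X * sg X) / (56 * real q * L)" by simp
      also have "\<dots> \<le> (56 * real q * real (card M) * L) / (56 * real q * L)"
        using enough L0 q by (intro divide_right_mono) auto
      also have "\<dots> = real (card M)" using L0 q by simp
      finally show ?thesis by simp
    qed
    have single: "\<exists>n. \<exists>j\<in>{1..k}. j \<noteq> i \<and> int p dvd poly f (n + int i) \<and> int p dvd poly f (n + int j)"
      if i: "i \<in> {1..k}" and p: "p \<in> M" for i p
    proof -
      obtain s where s: "prime p" "s \<in> {1..S}" "p dvd w s" using p by (auto simp: M_def)
      define t where "t = q * s"
      have "q * s \<le> q * S" using s(2) by (intro mult_le_mono2) simp
      then have t: "t \<ge> 1" "2 * t \<le> k - 1"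
        using s(2) q(1) qS unfolding t_def by (simp add: Suc_le_eq, linarith)
      define j where "j = (if i + t \<le> k then i + t else i - t)"
      have j: "j \<in> {1..k}" "j \<noteq> i" using t i by (auto simp: j_def)
      have jt: "int j - int i = int t \<or> int i - int j = int t" using t i by (auto simp: j_def of_nat_diff)
      have "int t = h * int s \<or> int t = - (h * int s)" unfolding t_def using q(2) by (auto simp: abs_if)
      then have "int j - int i = h * int s \<or> int i - int j = h * int s" using jt by linarith
      then obtain x y where xy: "(x = i \<and> y = j) \<or> (x = j \<and> y = i)" "int y - int x = h * int s" by blast
      obtain y0 where y0: "int p dvd cubic P Q y0" "int p dvd cubic P Q (y0 + l * int s)" using roots[OF s(1,3)] by blast
      have n3a: "\<not> int p dvd 3 * a" by (rule ndvd(1)[OF s(1,3)])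
      obtain n where n: "int p dvd 3 * a * n + (3 * a * int x + b - y0)"
        using prime_linear_solution[OF s(1) n3a] by blast
      have "int p dvd poly f (n + int x)"
      proof (rule f_root[OF s(1) n3a])
        have "int p dvd (3 * a * (n + int x) + b) - y0" using n by (simp add: algebra_simps)
        then have "int p dvd poly [:Q, P, 0, 1:] (3 * a * (n + int x) + b)"
          by (rule dvd_poly_shift) (simp only: poly_cubic y0)
        then show "int p dvd cubic P Q (3 * a * (n + int x) + b)" by (simp only: poly_cubic)
      qed
      moreover have "int p dvd poly f (n + int y)"
      proof (rule f_root[OF s(1) n3a])
        have "(3 * a * (n + int y) + b) - (y0 + l * int s) = 3 * a * n + (3 * a * int x + b - y0) + 3 * a * ((int y - int x) - h * int s)"
          unfolding lh by (simp add: algebra_simps)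
        then have eq: "(3 * a * (n + int y) + b) - (y0 + l * int s) = 3 * a * n + (3 * a * int x + b - y0)"
          using xy(2) by simp
        have "int p dvd (3 * a * (n + int y) + b) - (y0 + l * int s)" unfolding eq by (rule n)
        then have "int p dvd poly [:Q, P, 0, 1:] (3 * a * (n + int y) + b)"
          by (rule dvd_poly_shift) (simp only: poly_cubic y0)
        then show "int p dvd cubic P Q (3 * a * (n + int y) + b)" by (simp only: poly_cubic)
      qed
      ultimately have "int p dvd poly f (n + int i) \<and> int p dvd poly f (n + int j)" using xy(1) by blast
      then show ?thesis using j by blast
    qed
    have cov: "\<exists>p\<in>Ps X. \<exists>j\<in>{1..k}. j \<noteq> i \<and>
        int p dvd poly f (c0 p + int i) \<and> int p dvd poly f (c0 p + int j)" if i: "i \<in> {1..k} - U" for i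
    proof -
      obtain p where p: "p \<in> Ps X" "int p dvd poly f (c0 p + int i)" using U(2)[OF i] by blast
      have pp: "p > 0" "p \<le> X" using PsX(2)[OF p(1)] prime_gt_0_nat by auto
      define j where "j = (if i + p \<le> k then i + p else i - p)"
      have j: "j \<in> {1..k}" "j \<noteq> i" using i pp kX by (auto simp: j_def)
      have "int p dvd (c0 p + int j) - (c0 p + int i)" using pp kX i by (auto simp: j_def of_nat_diff)
      then have "int p dvd poly f (c0 p + int j)" using p(2) by (rule dvd_poly_shift)
      then show ?thesis using p j by blast
    qed
    show "coverable [:d, c, b, a:] 1 k"
      unfolding f_def[symmetric]
    proof (intro coverable_by_spare_primes[where c = c0, OF PsX(1) Mfin _ _ U(1) U_le cov single])
      show "Ps X \<inter> M = {}" using PsX(2) by (force simp: M_def)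
      show "prime p \<and> \<not> int p dvd 1" if "p \<in> Ps X \<union> M" for p
        using that PsX(2) prime_gt_1_nat[of p] by (auto simp: M_def)
    qed (use U(1) in auto)
  qed
qed

end

text \<open>A rational root leaves a quadratic cofactor \<open>g\<close>, and \<open>f\<close> is a
  multiple of it up to the constant \<open>27 a^2 y^3\<close>. The primes used for \<open>g\<close>
  avoid \<open>2 * g2 = 18 a^2 y^2\<close>, hence this constant.\<close>

lemma reducible_cubic_coverable:
  fixes a b c d P Q x y :: int
  assumes a: "a \<noteq> 0" and P: "P = 9 * a * c - 3 * b^2" and Q: "Q = 27 * a^2 * d - 9 * a * b * c + 2 * b^3"
    and xy: "x^3 + P * x * y^2 + Q * y^3 = 0" "y \<noteq> 0"
  shows "\<exists>K. \<forall>k\<ge>K. coverable [:d, c, b, a:] 1 k"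
proof -
  \<comment> \<open>Coefficients of \<open>y^2 Z^2 + x y Z + x^2 + P y^2\<close> at
    \<open>Z = 3 a n + b\<close>, the cofactor of \<open>y Z - x\<close> in
    \<open>y^3 (Z^3 + P Z + Q)\<close>.\<close>
  define g2 g1 g0 where "g2 = 9 * a^2 * y^2" and "g1 = 6 * a * b * y^2 + 3 * a * x * y"
    and "g0 = b^2 * y^2 + x * y * b + x^2 + P * y^2"
  define f where "f = [:d, c, b, a:]"
  define g where "g = [:g0, g1, g2:]"
  have fg: "27 * a^2 * y^3 * poly f n = (y * (3 * a * n + b) - x) * poly g n" for n
  proof -
    have "poly f n = d + n * (c + n * (b + n * a))" "poly g n = g0 + n * (g1 + n * g2)"
      by (simp_all add: f_def g_def)
    moreover have "27 * a^2 * y^3 * (d + n * (c + n * (b + n * a))) =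
       (y * (3 * a * n + b) - x) * (g0 + n * (g1 + n * g2)) + (x^3 + P * x * y^2 + Q * y^3)"
      unfolding g0_def g1_def g2_def P Q by algebra
    ultimately show ?thesis using xy(1) by simp
  qed
  have "g2 \<noteq> 0" unfolding g2_def using a xy(2) by simp
  then obtain K where K: "\<And>k. k \<ge> K \<Longrightarrow> coverable g (2 * g2) k"
    using quadratic_coverable[of g2 g0 g1] unfolding g_def by blast
  have "coverable f 1 k" if k: "k \<ge> K" for k
  proof -
    obtain Ps e where Ps: "finite Ps" "\<forall>p\<in>Ps. prime p \<and> \<not> int p dvd 2 * g2"
      and cov: "\<forall>i\<in>{1..k}. \<exists>p\<in>Ps. \<exists>j\<in>{1..k}. j \<noteq> i \<and> int p dvd poly g (e p + int i) \<and> int p dvd poly g (e p + int j)"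
      using K[OF k] unfolding coverable_def by blast
    have tr: "int p dvd poly f n" if p: "p \<in> Ps" and d: "int p dvd poly g n" for p n
    proof -
      have pi: "prime (int p)" and nd: "\<not> int p dvd 2 * g2" using Ps(2) p by auto
      have n3: "\<not> int p dvd 3" "\<not> int p dvd a" "\<not> int p dvd y"
      proof -
        have eqs: "2 * g2 = 3 * (6 * a^2 * y^2)" "2 * g2 = a * (18 * a * y^2)" "2 * g2 = y * (18 * a^2 * y)"
          unfolding g2_def by algebra+
        show "\<not> int p dvd 3" using nd unfolding eqs(1) by (meson dvd_mult2)
        show "\<not> int p dvd a" using nd unfolding eqs(2) by (meson dvd_mult2)
        show "\<not> int p dvd y" using nd unfolding eqs(3) by (meson dvd_mult2)
      qed
      have "int p dvd 27 * a^2 * y^3 * poly f n" unfolding fg using d by (rule dvd_mult)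
      also have "27 * a^2 * y^3 * poly f n = 3 * (3 * (3 * (a * (a * (y * (y * (y * poly f n)))))))" by algebra
      finally show ?thesis using n3 pi by (simp only: prime_dvd_mult_iff) simp
    qed
    have "\<forall>p\<in>Ps. prime p \<and> \<not> int p dvd 1" using Ps(2) prime_gt_1_nat by auto
    moreover have "\<forall>i\<in>{1..k}. \<exists>p\<in>Ps. \<exists>j\<in>{1..k}. j \<noteq> i \<and> int p dvd poly f (e p + int i) \<and> int p dvd poly f (e p + int j)"
      using cov tr by meson
    ultimately show ?thesis unfolding coverable_def using Ps(1) by blast
  qed
  then show ?thesis unfolding f_def by blast
qed

section \<open>Reduction to the quadratic, reducible and irreducible cases\<close>

lemma coverable_eventually:
  fixes f :: "int poly"
  assumes "degree f = 2 \<or> degree f = 3"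
  shows "\<exists>K u. \<forall>k\<ge>K. coverable f u k"
proof (cases "degree f = 2")
  case True
  define a b c where "a = coeff f 2" and "b = coeff f 1" and "c = coeff f 0"
  have a: "a \<noteq> 0" unfolding a_def using True by (metis leading_coeff_0_iff degree_0 zero_neq_numeral)
  have f: "f = [:c, b, a:]"
  proof (rule poly_eqI)
    fix n
    show "coeff f n = coeff [:c, b, a:] n"
    proof (cases "n \<le> 2")
      case True
      then have "n = 0 \<or> n = 1 \<or> n = 2" by auto
      then show ?thesis unfolding a_def b_def c_def by (auto simp: numeral_2_eq_2)
    next
      case False
      then show ?thesis using \<open>degree f = 2\<close> by (simp add: coeff_eq_0 coeff_pCons split: nat.split)
    qed
  qed
  show ?thesis using quadratic_coverable[OF a, of c b] unfolding f by blast
next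
  case False
  then have deg: "degree f = 3" using assms by simp
  define a b c d where "a = coeff f 3" and "b = coeff f 2" and "c = coeff f 1" and "d = coeff f 0"
  have a: "a \<noteq> 0" unfolding a_def using deg by (metis leading_coeff_0_iff degree_0 zero_neq_numeral)
  have f: "f = [:d, c, b, a:]"
  proof (rule poly_eqI)
    fix n
    show "coeff f n = coeff [:d, c, b, a:] n"
    proof (cases "n \<le> 3")
      case True
      then have "n = 0 \<or> n = 1 \<or> n = 2 \<or> n = 3" by auto
      then show ?thesis unfolding a_def b_def c_def d_def by (auto simp: numeral_2_eq_2 numeral_3_eq_3)
    next
      case False
      then show ?thesis using deg by (simp add: coeff_eq_0 coeff_pCons split: nat.split)
    qed
  qed
  define P where "P = 9 * a * c - 3 * b^2"
  define Q where "Q = 27 * a^2 * d - 9 * a * b * c + 2 * b^3"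
  show ?thesis
  proof (cases "\<exists>x y. x^3 + P * x * y^2 + Q * y^3 = 0 \<and> y \<noteq> 0")
    case True
    then show ?thesis using reducible_cubic_coverable[OF a P_def Q_def] unfolding f by blast
  next
    case False
    then have "irreducible_cubic P Q" by unfold_locales blast
    then show ?thesis using irreducible_cubic.irreducible_cubic_coverable[OF _ a P_def Q_def] unfolding f by blast
  qed
qed

theorem theorem1p1:
  fixes f :: "int poly"
  assumes "degree f = 2 \<or> degree f = 3"
  shows "G_exists f \<and> (\<forall>k\<ge>G_f f. infinite {n::nat. has_property f n k})"
proof -
  obtain K u where K: "\<And>k. k \<ge> K \<Longrightarrow> coverable f u k" using coverable_eventually[OF assms] by blast
  have "G_admissible f (max K 2)"
    unfolding G_admissible_def using K coverable_imp_has_property by (meson max.bounded_iff max.cobounded2)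
  then have ex: "\<exists>G. G_admissible f G" ..
  then have "G_admissible f (G_f f)" unfolding G_f_def by (rule LeastI_ex)
  then have "infinite {n. has_property f n k}" if "k \<ge> G_f f" for k
    using that has_property_infinite unfolding G_admissible_def by blast
  then show ?thesis using ex unfolding G_exists_def by blast
qed

end
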